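(* For every space bound $s(n)\in o(\log\log n)$, QTM-WOMs are strictly superior to PTM-WOMs in terms of language recognition with unbounded error in space $s$. That is, every language recognized with unbounded error by an $s(n)$-space PTM-WOM is recognized with unbounded error by an $s(n)$-space QTM-WOM, and there is a language recognized with unbounded error by an $s(n)$-space QTM-WOM but not by any $s(n)$-space PTM-WOM.
   Context: A PTM is a standard probabilistic Turing machine with a two-way read-only input tape (containing ¢$w$\$ for input $w\in\Sigma^*$) and one two-way read/write work tape. A PTM-WOM additionally has a write-only memory (WOM): a two-way tape with finite alphabet $\Gamma$ containing the blank symbol and the empty symbol $\varepsilon$, whose content is never read. In each step the machine writes a symbol of $\Gamma$ on the square under the WOM head (writing $\varepsilon$ leaves the square unchanged) and moves the WOM head left, right, or not at all, the transition not depending on the WOM content. A QTM-WOM has the same components (finite state set, two-way read-only input tape, read/write work tape, WOM tape) together with a finite register with alphabet $\Omega$ partitioned into "accept", "reject" and "continue" symbols. Depending on the state and the scanned input and work tape symbols, in one step it changes state, writes on the work tape, moves the input and work heads, writes on the WOM and moves the WOM head, and writes $\omega\in\Omega$ in the register, with a given transition amplitude in $\mathbb C$ (amplitudes are efficiently computable numbers). A configuration consists of the state, the head positions and the contents of the work and WOM tapes (not the register). With $E_\omega$ the matrix of one-step amplitudes between configurations with $\omega$ written in the register, the machine must be well-formed: $\sum_{\omega\in\Omega}E_\omega^\dagger E_\omega=I$. After each step the register is observed. The machine halts and accepts (rejects) if an accept (reject) symbol is seen; otherwise the register is reset to its initial symbol and the computation continues. Space: a machine uses space $s(n)$ if, on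 every input of length $n$ and every computation path, at most $s(n)$ squares of the read/write work tape are used. The WOM is not counted. Recognition: with $f_{\mathcal M}(w)$ the probability that $\mathcal M$ accepts $w$, $L\subseteq\Sigma^*$ is recognized by $\mathcal M$ with unbounded error if there is $\lambda\in\mathbb R$ such that $L=\{w: f_{\mathcal M}(w)>\lambda\}$ (strict cutpoint) or $L=\{w: f_{\mathcal M}(w)\ge\lambda\}$ (nonstrict cutpoint). *)

theory Defs
  imports
    "HOL-Probability.Probability"
    "HOL-Library.Landau_Symbols"
    "HOL-Library.Log_Nat"
begin

section \<open>Efficiently computable numbers\<close>

text \<open>
  Algorithms are while-programs over registers holding natural numbers, with
  logarithmic cost: an instruction costs the total bit length of the numbers involved.
  Up to a polynomial, this is the running time of deterministic Turing machines.
\<close>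

type_synonym store = "nat \<Rightarrow> nat"

datatype prog =
    Const nat nat
  | Add nat nat nat
  | Sub nat nat nat
  | Mult nat nat nat
  | Div nat nat nat
  | Seq prog prog
  | Cond nat prog prog
  | While nat prog

definition cost :: "nat list \<Rightarrow> nat" where
  "cost xs = 1 + (\<Sum>x\<leftarrow>xs. floorlog 2 x)"

inductive exec :: "prog \<Rightarrow> store \<Rightarrow> nat \<Rightarrow> store \<Rightarrow> bool" where
  "exec (Const r k) s (cost [k]) (s(r := k))"
| "exec (Add r i j) s (cost [s i, s j, s i + s j]) (s(r := s i + s j))"
| "exec (Sub r i j) s (cost [s i, s j, s i - s j]) (s(r := s i - s j))"
| "exec (Mult r i j) s (cost [s i, s j, s i * s j]) (s(r := s i * s j))"
| "exec (Div r i j) s (cost [s i, s j, s i div s j]) (s(r := s i div s j))"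
| "exec P s t s' \<Longrightarrow> exec P' s' t' s'' \<Longrightarrow> exec (Seq P P') s (t + t') s''"
| "s r \<noteq> 0 \<Longrightarrow> exec P s t s' \<Longrightarrow> exec (Cond r P P') s (cost [s r] + t) s'"
| "s r = 0 \<Longrightarrow> exec P' s t s' \<Longrightarrow> exec (Cond r P P') s (cost [s r] + t) s'"
| "s r = 0 \<Longrightarrow> exec (While r P) s (cost [s r]) s"
| "s r \<noteq> 0 \<Longrightarrow> exec P s t s' \<Longrightarrow> exec (While r P) s' t' s'' \<Longrightarrow>
     exec (While r P) s (cost [s r] + t + t') s''"

text \<open>
  Registers 0 and 1 are read as the difference of two numerators over the
  denominator \<open>2 ^ n\<close>, so that both signs can occur. The time is polynomial in
  the precision \<open>n\<close>, not in its bit length.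
\<close>

definition eff_computable_real :: "real \<Rightarrow> bool" where
  "eff_computable_real x \<longleftrightarrow>
     (\<exists>P k. \<forall>n. \<exists>t s'. exec P ((\<lambda>_. 0)(0 := n)) t s' \<and> t \<le> k * (n + 1) ^ k \<and>
        \<bar>(real (s' 0) - real (s' 1)) / 2 ^ n - x\<bar> \<le> 1 / 2 ^ n)"

definition eff_computable :: "complex \<Rightarrow> bool" where
  "eff_computable z \<longleftrightarrow> eff_computable_real (Re z) \<and> eff_computable_real (Im z)"


section \<open>Tapes, configurations and moves\<close>

text \<open>
  States and symbols are natural numbers taken from finite sets. The blank of the work
  tape and the blank of the WOM are both 0. The empty symbol of the WOM can be written
  but never occurs on a square; writing it is represented by \<open>None\<close>.
\<close>

datatype input_symbol = LeftEnd | RightEnd | Letter nat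

datatype move = Lft | Stay | Rgt

fun shift :: "move \<Rightarrow> int" where
  "shift Lft = - 1"
| "shift Stay = 0"
| "shift Rgt = 1"

record action =
  new_state :: nat
  input_move :: move
  work_write :: nat
  work_move :: move
  wom_write :: "nat option"
  wom_move :: move

record config =
  state :: nat
  input_pos :: nat
  work_pos :: int
  work_tape :: "int \<Rightarrow> nat"
  wom_pos :: int
  wom_tape :: "int \<Rightarrow> nat"

record machine =
  alphabet :: "nat set"
  states :: "nat set"
  init_state :: nat
  work_symbols :: "nat set"
  wom_symbols :: "nat set"

definition machine_ok :: "('b) machine_scheme \<Rightarrow> bool" where
  "machine_ok M \<longleftrightarrow>
     finite (alphabet M) \<and> finite (states M) \<and> init_state M \<in> states M \<and>
     finite (work_symbols M) \<and> 0 \<in> work_symbols M \<and>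
     finite (wom_symbols M) \<and> 0 \<in> wom_symbols M"

definition actions :: "('b) machine_scheme \<Rightarrow> action set" where
  "actions M = {a. new_state a \<in> states M \<and> work_write a \<in> work_symbols M \<and>
                   set_option (wom_write a) \<subseteq> wom_symbols M}"

definition input_symbols :: "('b) machine_scheme \<Rightarrow> input_symbol set" where
  "input_symbols M = {LeftEnd, RightEnd} \<union> Letter ` alphabet M"

text \<open>The input head never leaves the part of the input tape delimited by the end-markers.\<close>

definition stays_on_input :: "input_symbol \<Rightarrow> action \<Rightarrow> bool" where
  "stays_on_input x a \<longleftrightarrow>
     (x = LeftEnd \<longrightarrow> input_move a \<noteq> Lft) \<and> (x = RightEnd \<longrightarrow> input_move a \<noteq> Rgt)"

definition input_at :: "nat list \<Rightarrow> nat \<Rightarrow> input_symbol" where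
  "input_at w i =
     (if i = 0 then LeftEnd else if i \<le> length w then Letter (w ! (i - 1)) else RightEnd)"

definition configs :: "('b) machine_scheme \<Rightarrow> nat list \<Rightarrow> config set" where
  "configs M w = {c. state c \<in> states M \<and> input_pos c \<le> length w + 1 \<and>
     range (work_tape c) \<subseteq> work_symbols M \<and> finite {i. work_tape c i \<noteq> 0} \<and>
     range (wom_tape c) \<subseteq> wom_symbols M \<and> finite {i. wom_tape c i \<noteq> 0}}"

definition init_config :: "('b) machine_scheme \<Rightarrow> config" where
  "init_config M = \<lparr>state = init_state M, input_pos = 0,
     work_pos = 0, work_tape = (\<lambda>_. 0), wom_pos = 0, wom_tape = (\<lambda>_. 0)\<rparr>"

definition perform :: "action \<Rightarrow> config \<Rightarrow> config" where
  "perform a c =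
     \<lparr>state = new_state a,
      input_pos = nat (int (input_pos c) + shift (input_move a)),
      work_pos = work_pos c + shift (work_move a),
      work_tape = (work_tape c)(work_pos c := work_write a),
      wom_pos = wom_pos c + shift (wom_move a),
      wom_tape = (case wom_write a of
                    None \<Rightarrow> wom_tape c
                  | Some g \<Rightarrow> (wom_tape c)(wom_pos c := g))\<rparr>"


section \<open>Recognition and space\<close>

definition recognizes_unbounded :: "nat set \<Rightarrow> (nat list \<Rightarrow> real) \<Rightarrow> nat list set \<Rightarrow> bool" where
  "recognizes_unbounded A f L \<longleftrightarrow>
     (\<exists>cut::real. L = {w \<in> lists A. f w > cut} \<or> L = {w \<in> lists A. f w \<ge> cut})"

text \<open>
  A square of the work tape is used when the work head is placed on it. The starting square is
  always used, so, as is customary, a bound below 1 is read as 1. Computation paths are given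
  by their finite initial segments, i.e. nonempty lists of configurations.
\<close>

definition uses_space ::
    "nat set \<Rightarrow> (nat list \<Rightarrow> config list \<Rightarrow> bool) \<Rightarrow> (nat \<Rightarrow> real) \<Rightarrow> bool" where
  "uses_space A is_path s \<longleftrightarrow>
     (\<forall>w\<in>lists A. \<forall>cs. is_path w cs \<longrightarrow>
        real (card (work_pos ` set cs)) \<le> max 1 (s (length w)))"


section \<open>Probabilistic Turing machines with write-only memory\<close>

record ptm_wom = machine +
  accept_state :: nat
  reject_state :: nat
  trans :: "nat \<Rightarrow> input_symbol \<Rightarrow> nat \<Rightarrow> action pmf"

definition ptm_wom :: "ptm_wom \<Rightarrow> bool" where
  "ptm_wom M \<longleftrightarrow> machine_ok M \<and>
     accept_state M \<in> states M \<and> reject_state M \<in> states M \<and> accept_state M \<noteq> reject_state M \<and>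
     (\<forall>q\<in>states M. \<forall>x\<in>input_symbols M. \<forall>g\<in>work_symbols M.
        set_pmf (trans M q x g) \<subseteq> {a \<in> actions M. stays_on_input x a} \<and>
        (\<forall>a. eff_computable_real (pmf (trans M q x g) a)))"

definition ptm_step :: "ptm_wom \<Rightarrow> nat list \<Rightarrow> config \<Rightarrow> config pmf" where
  "ptm_step M w c =
     (if state c \<in> {accept_state M, reject_state M} then return_pmf c
      else map_pmf (\<lambda>a. perform a c)
             (trans M (state c) (input_at w (input_pos c)) (work_tape c (work_pos c))))"

definition ptm_run :: "ptm_wom \<Rightarrow> nat list \<Rightarrow> nat \<Rightarrow> config pmf" where
  "ptm_run M w t = ((\<lambda>p. bind_pmf p (ptm_step M w)) ^^ t) (return_pmf (init_config M))"

text \<open>Halted configurations are kept, so the probabilities increase with the number of steps.\<close>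

definition ptm_accept_prob :: "ptm_wom \<Rightarrow> nat list \<Rightarrow> real" where
  "ptm_accept_prob M w =
     (SUP t. measure_pmf.prob (ptm_run M w t) {c. state c = accept_state M})"

definition ptm_path :: "ptm_wom \<Rightarrow> nat list \<Rightarrow> config list \<Rightarrow> bool" where
  "ptm_path M w cs \<longleftrightarrow> cs \<noteq> [] \<and> hd cs = init_config M \<and>
     (\<forall>i. Suc i < length cs \<longrightarrow> cs ! Suc i \<in> set_pmf (ptm_step M w (cs ! i)))"

definition ptm_wom_recognizable :: "(nat \<Rightarrow> real) \<Rightarrow> nat set \<Rightarrow> nat list set \<Rightarrow> bool" where
  "ptm_wom_recognizable s A L \<longleftrightarrow>
     (\<exists>M. ptm_wom M \<and> alphabet M = A \<and> uses_space A (ptm_path M) s \<and>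
          recognizes_unbounded A (ptm_accept_prob M) L)"


section \<open>Quantum Turing machines with write-only memory\<close>

text \<open>
  The register alphabet is the union of the three disjoint sets of accept, reject and continue
  symbols. The register is reset before every step, so its initial symbol has no bearing on the
  transitions and is left out.
\<close>

record qtm_wom = machine +
  accept_symbols :: "nat set"
  reject_symbols :: "nat set"
  continue_symbols :: "nat set"
  ampl :: "nat \<Rightarrow> input_symbol \<Rightarrow> nat \<Rightarrow> action \<Rightarrow> nat \<Rightarrow> complex"

definition register :: "qtm_wom \<Rightarrow> nat set" where
  "register M = accept_symbols M \<union> reject_symbols M \<union> continue_symbols M"

text \<open>
  \<open>evol M w r d c\<close> is the entry of \<open>E\<^sub>r\<close> in row \<open>d\<close> and column \<open>c\<close>, the amplitude of
  going from \<open>c\<close> to \<open>d\<close> in one step while writing \<open>r\<close> in the register. Actions that differ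
  only in what they write on the WOM may lead to the same configuration, hence the sum.
\<close>

definition evol :: "qtm_wom \<Rightarrow> nat list \<Rightarrow> nat \<Rightarrow> config \<Rightarrow> config \<Rightarrow> complex" where
  "evol M w r d c = (\<Sum>a | a \<in> actions M \<and> perform a c = d.
     ampl M (state c) (input_at w (input_pos c)) (work_tape c (work_pos c)) a r)"

definition well_formed :: "qtm_wom \<Rightarrow> bool" where
  "well_formed M \<longleftrightarrow>
     (\<forall>w\<in>lists (alphabet M). \<forall>c\<in>configs M w. \<forall>c'\<in>configs M w.
        (\<Sum>r\<in>register M. \<Sum>\<^sub>\<infinity>d\<in>configs M w. cnj (evol M w r d c) * evol M w r d c')
          = (if c = c' then 1 else 0))"

definition qtm_wom :: "qtm_wom \<Rightarrow> bool" where
  "qtm_wom M \<longleftrightarrow> machine_ok M \<and> finite (register M) \<and>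
     accept_symbols M \<inter> reject_symbols M = {} \<and>
     accept_symbols M \<inter> continue_symbols M = {} \<and>
     reject_symbols M \<inter> continue_symbols M = {} \<and>
     (\<forall>q\<in>states M. \<forall>x\<in>input_symbols M. \<forall>g\<in>work_symbols M. \<forall>a\<in>actions M. \<forall>r\<in>register M.
        eff_computable (ampl M q x g a r) \<and>
        (\<not> stays_on_input x a \<longrightarrow> ampl M q x g a r = 0)) \<and>
     well_formed M"

type_synonym superposition = "config \<Rightarrow> complex"

definition evol_apply ::
    "qtm_wom \<Rightarrow> nat list \<Rightarrow> nat \<Rightarrow> superposition \<Rightarrow> superposition" where
  "evol_apply M w r \<psi> = (\<lambda>d. \<Sum>\<^sub>\<infinity>c\<in>configs M w. evol M w r d c * \<psi> c)"

text \<open>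
  The superposition after the register symbols \<open>rs\<close> have been observed in this order. It is not
  normalized: its squared norm is the probability of observing \<open>rs\<close>.
\<close>

definition evolved :: "qtm_wom \<Rightarrow> nat list \<Rightarrow> nat list \<Rightarrow> superposition" where
  "evolved M w rs = fold (evol_apply M w) rs (\<lambda>c. if c = init_config M then 1 else 0)"

definition observation_prob :: "qtm_wom \<Rightarrow> nat list \<Rightarrow> nat list \<Rightarrow> real" where
  "observation_prob M w rs = (\<Sum>\<^sub>\<infinity>c\<in>configs M w. (cmod (evolved M w rs c))\<^sup>2)"

definition qtm_accept_prob :: "qtm_wom \<Rightarrow> nat list \<Rightarrow> real" where
  "qtm_accept_prob M w =
     (\<Sum>t. \<Sum>rs | length rs = t \<and> set rs \<subseteq> continue_symbols M.
        \<Sum>r\<in>accept_symbols M. observation_prob M w (rs @ [r]))"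

text \<open>Only the last step of a path may write an accept or a reject symbol.\<close>

definition qtm_path :: "qtm_wom \<Rightarrow> nat list \<Rightarrow> config list \<Rightarrow> bool" where
  "qtm_path M w cs \<longleftrightarrow> cs \<noteq> [] \<and> hd cs = init_config M \<and>
     (\<forall>i. Suc i < length cs \<longrightarrow>
        (\<exists>r \<in> (if Suc (Suc i) < length cs then continue_symbols M else register M).
           evol M w r (cs ! Suc i) (cs ! i) \<noteq> 0))"

definition qtm_wom_recognizable :: "(nat \<Rightarrow> real) \<Rightarrow> nat set \<Rightarrow> nat list set \<Rightarrow> bool" where
  "qtm_wom_recognizable s A L \<longleftrightarrow>
     (\<exists>M. qtm_wom M \<and> alphabet M = A \<and> uses_space A (qtm_path M) s \<and>
          recognizes_unbounded A (qtm_accept_prob M) L)"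

end

theory Submission
  imports Defs "Jordan_Normal_Form.Determinant" "HOL-Real_Asymp.Real_Asymp"
begin

text \<open>
  A probabilistic machine never profits from its WOM, so a quantum machine simulates it by taking
  square roots of the transition probabilities as amplitudes and recording each step in the
  register, which keeps different paths from interfering.

  The converse fails for the language of words over \<open>{0, 1, 2}\<close> with a prefix \<open>p2\<close> such that \<open>p\<close>
  contains as many 0s as 1s. A quantum machine runs two paths in superposition that count the 0s
  and the 1s by the position of the WOM head; at each 2 it splits off a part of the amplitude in
  which the paths interfere precisely if their counters agree, and this pushes the acceptance
  probability above 1/2. For a probabilistic machine with \<open>K\<close> internal configurations the
  discounted acceptance probability of \<open>uv\<close> is, by Cramer's rule, a quotient of functions of rank
  \<open>2^O(K log K)\<close> in \<open>(u, v)\<close>, so at most that many prefixes can be shattered by suffixes. Space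
  \<open>o(log log n)\<close> gives \<open>K = (log n)^o(1)\<close>, but linearly many prefixes \<open>0^j\<close> are shattered.
\<close>

section \<open>Square roots of efficiently computable numbers\<close>

text \<open>Counting the behaviours of a prefix, as one does for deterministic machines, fails here:
  the probabilities with which runs cross the border between \<open>u\<close> and \<open>v\<close>
  are reals, so arbitrarily many prefixes may behave differently. What stays bounded is a dimension:
  all interaction passes through the \<open>K\<close> cores at the border, and the Leibniz expansion
  of a determinant of order \<open>K\<close> separates \<open>u\<close> from \<open>v\<close>. Two
  obstacles shape the argument. A machine may loop forever, which can make the border system
  singular, hence the discount; as only finitely many words are compared at a time, a discount close
  to 1 preserves their separation, whether the cutpoint is strict or not. In the other direction,
  amplitudes have to be efficiently computable again, so a square root algorithm is programmed and
  timed in the given cost model. On the quantum side, the content of the WOM is useless; its head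
  position matters only because paths interfere precisely if they reach the same configuration. A
  test may consume only a part of the amplitude, since further tests can follow.\<close>

primrec max_reg :: "prog \<Rightarrow> nat" where
  "max_reg (Const r k) = r"
| "max_reg (Add r i j) = max r (max i j)"
| "max_reg (Sub r i j) = max r (max i j)"
| "max_reg (Mult r i j) = max r (max i j)"
| "max_reg (Div r i j) = max r (max i j)"
| "max_reg (Seq P P') = max (max_reg P) (max_reg P')"
| "max_reg (Cond r P P') = max r (max (max_reg P) (max_reg P'))"
| "max_reg (While r P) = max r (max_reg P)"

lemma exec_frame_upd:
  assumes "\<forall>i<F. \<sigma> i = s i" "exec P \<sigma> t (\<sigma>(r := v))" "r < F"
  shows "\<exists>\<sigma>'. exec P \<sigma> t \<sigma>' \<and> (\<forall>i<F. \<sigma>' i = (s(r := v)) i) \<and> (\<forall>i\<ge>F. \<sigma>' i = \<sigma> i)"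
  using assms by (intro exI[of _ "\<sigma>(r := v)"] conjI) simp_all

text \<open>\<open>P\<close> cannot see the registers from \<open>F\<close> on, so a surrounding
  program may keep its own data there: the cost and the visible result stay the same. The program
  for the square root calls an arbitrary given \<open>P\<close> in this way.\<close>

lemma exec_frame:
  assumes "exec P s t s'" "max_reg P < F" "\<forall>i<F. \<sigma> i = s i"
  shows "\<exists>\<sigma>'. exec P \<sigma> t \<sigma>' \<and> (\<forall>i<F. \<sigma>' i = s' i) \<and> (\<forall>i\<ge>F. \<sigma>' i = \<sigma> i)"
  using assms
proof (induction arbitrary: \<sigma>)
  case (1 r k s)
  then show ?case by (intro exI[of _ "\<sigma>(r := k)"] conjI exec.intros(1)) auto
next
  case (2 r i j s)
  then have "s i = \<sigma> i" "s j = \<sigma> j" "r < F" by auto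
  then show ?case using exec.intros(2)[of r i j \<sigma>] exec_frame_upd[OF 2(2)] by metis
next
  case (3 r i j s)
  then have "s i = \<sigma> i" "s j = \<sigma> j" "r < F" by auto
  then show ?case using exec.intros(3)[of r i j \<sigma>] exec_frame_upd[OF 3(2)] by metis
next
  case (4 r i j s)
  then have "s i = \<sigma> i" "s j = \<sigma> j" "r < F" by auto
  then show ?case using exec.intros(4)[of r i j \<sigma>] exec_frame_upd[OF 4(2)] by metis
next
  case (5 r i j s)
  then have "s i = \<sigma> i" "s j = \<sigma> j" "r < F" by auto
  then show ?case using exec.intros(5)[of r i j \<sigma>] exec_frame_upd[OF 5(2)] by metis
next
  case (6 P s t s' P' t' s'')
  from "6.IH"(1)[of \<sigma>] "6.prems" obtain \<sigma>1 where
    1: "exec P \<sigma> t \<sigma>1" "\<forall>i<F. \<sigma>1 i = s' i" "\<forall>i\<ge>F. \<sigma>1 i = \<sigma> i" by auto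
  from "6.IH"(2)[of \<sigma>1] "6.prems" 1(2) obtain \<sigma>2 where
    2: "exec P' \<sigma>1 t' \<sigma>2" "\<forall>i<F. \<sigma>2 i = s'' i" "\<forall>i\<ge>F. \<sigma>2 i = \<sigma>1 i" by auto
  show ?case using exec.intros(6)[OF 1(1) 2(1)] 1(3) 2(2,3) by metis
next
  case (7 s r P t s' P')
  from "7.IH"[of \<sigma>] "7.prems" obtain \<sigma>1 where
    1: "exec P \<sigma> t \<sigma>1" "\<forall>i<F. \<sigma>1 i = s' i" "\<forall>i\<ge>F. \<sigma>1 i = \<sigma> i" by auto
  have r: "\<sigma> r = s r" using "7.prems" by auto
  show ?case using exec.intros(7)[of \<sigma> r, OF _ 1(1)] 1(2,3) r 7(1) by metis
next
  case (8 s r P' t s' P)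
  from "8.IH"[of \<sigma>] "8.prems" obtain \<sigma>1 where
    1: "exec P' \<sigma> t \<sigma>1" "\<forall>i<F. \<sigma>1 i = s' i" "\<forall>i\<ge>F. \<sigma>1 i = \<sigma> i" by auto
  have r: "\<sigma> r = s r" using "8.prems" by auto
  show ?case using exec.intros(8)[of \<sigma> r, OF _ 1(1)] 1(2,3) r 8(1) by metis
next
  case (9 s r P)
  have r: "\<sigma> r = s r" using "9.prems" by auto
  show ?case using exec.intros(9)[of \<sigma> r] r 9 by metis
next
  case (10 s r P t s' t' s'')
  from "10.IH"(1)[of \<sigma>] "10.prems" obtain \<sigma>1 where
    1: "exec P \<sigma> t \<sigma>1" "\<forall>i<F. \<sigma>1 i = s' i" "\<forall>i\<ge>F. \<sigma>1 i = \<sigma> i" by auto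
  from "10.IH"(2)[of \<sigma>1] "10.prems" 1(2) obtain \<sigma>2 where
    2: "exec (While r P) \<sigma>1 t' \<sigma>2" "\<forall>i<F. \<sigma>2 i = s'' i" "\<forall>i\<ge>F. \<sigma>2 i = \<sigma>1 i" by auto
  have r: "\<sigma> r = s r" using "10.prems" by auto
  show ?case using exec.intros(10)[of \<sigma> r, OF _ 1(1) 2(1)] 1(3) 2(2,3) r 10(1) by metis
qed

text \<open>A number can only be written at a cost of at least its bit length.\<close>

lemma exec_floorlog_le:
  assumes "exec P s t s'"
  shows "floorlog 2 (s' r) \<le> max (floorlog 2 (s r)) t"
  using assms
  by induction (auto simp: cost_def)

section \<open>Running times when all numbers have at most \<open>B\<close> bits\<close>

definition runs :: "prog \<Rightarrow> store \<Rightarrow> nat \<Rightarrow> store \<Rightarrow> bool" where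
  "runs P s T s' \<longleftrightarrow> (\<exists>t\<le>T. exec P s t s')"

lemma floorlog_2_le: "x < 2 ^ B \<Longrightarrow> floorlog 2 x \<le> B"
  using floorlog_leI[of x 2 B] by simp

text \<open>An instruction costs \<open>1\<close> plus at most three bit lengths, hence at most
  \<open>4 * B\<close> once every number involved is below \<open>2 ^ B\<close> and
  \<open>B > 0\<close>. One global \<open>B\<close> replaces the exact costs, which depend on every
  intermediate value.\<close>

lemma runs_arith:
  assumes "B > 0"
  shows runs_Const: "k < 2 ^ B \<Longrightarrow> s' = s(r := k) \<Longrightarrow> runs (Const r k) s (4 * B) s'"
    and runs_Add: "s i < 2 ^ B \<Longrightarrow> s j < 2 ^ B \<Longrightarrow> s i + s j < 2 ^ B \<Longrightarrow> s' = s(r := s i + s j)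
      \<Longrightarrow> runs (Add r i j) s (4 * B) s'"
    and runs_Sub: "s i < 2 ^ B \<Longrightarrow> s j < 2 ^ B \<Longrightarrow> s' = s(r := s i - s j)
      \<Longrightarrow> runs (Sub r i j) s (4 * B) s'"
    and runs_Mult: "s i < 2 ^ B \<Longrightarrow> s j < 2 ^ B \<Longrightarrow> s i * s j < 2 ^ B \<Longrightarrow> s' = s(r := s i * s j)
      \<Longrightarrow> runs (Mult r i j) s (4 * B) s'"
    and runs_Div: "s i < 2 ^ B \<Longrightarrow> s j < 2 ^ B \<Longrightarrow> s' = s(r := s i div s j)
      \<Longrightarrow> runs (Div r i j) s (4 * B) s'"
proof -
  have *: "a < 2 ^ B \<Longrightarrow> b < 2 ^ B \<Longrightarrow> c < 2 ^ B \<Longrightarrow> cost [a, b, c] \<le> 4 * B" for a b c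
    using floorlog_2_le[of a B] floorlog_2_le[of b B] floorlog_2_le[of c B] assms
    by (auto simp: cost_def)
  show "k < 2 ^ B \<Longrightarrow> s' = s(r := k) \<Longrightarrow> runs (Const r k) s (4 * B) s'"
  proof -
    assume "k < 2 ^ B" "s' = s(r := k)"
    moreover have "cost [k] \<le> 4 * B" if "k < 2 ^ B"
      using floorlog_2_le[OF that] assms by (auto simp: cost_def)
    ultimately show "runs (Const r k) s (4 * B) s'"
      unfolding runs_def by (auto intro: exec.intros)
  qed
  show "s i < 2 ^ B \<Longrightarrow> s j < 2 ^ B \<Longrightarrow> s i + s j < 2 ^ B \<Longrightarrow> s' = s(r := s i + s j)
      \<Longrightarrow> runs (Add r i j) s (4 * B) s'"
    unfolding runs_def by (intro exI[of _ "cost [s i, s j, s i + s j]"]) (auto intro: exec.intros *)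
  show "s i < 2 ^ B \<Longrightarrow> s j < 2 ^ B \<Longrightarrow> s' = s(r := s i - s j)
      \<Longrightarrow> runs (Sub r i j) s (4 * B) s'"
    unfolding runs_def
    by (intro exI[of _ "cost [s i, s j, s i - s j]"]) (auto intro!: exec.intros *)
  show "s i < 2 ^ B \<Longrightarrow> s j < 2 ^ B \<Longrightarrow> s i * s j < 2 ^ B \<Longrightarrow> s' = s(r := s i * s j)
      \<Longrightarrow> runs (Mult r i j) s (4 * B) s'"
    unfolding runs_def by (intro exI[of _ "cost [s i, s j, s i * s j]"]) (auto intro: exec.intros *)
  show "s i < 2 ^ B \<Longrightarrow> s j < 2 ^ B \<Longrightarrow> s' = s(r := s i div s j)
      \<Longrightarrow> runs (Div r i j) s (4 * B) s'"
    unfolding runs_def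
    by (intro exI[of _ "cost [s i, s j, s i div s j]"])
       (auto intro!: exec.intros * elim: le_less_trans[OF div_le_dividend])
qed

lemma runs_mono: "runs P s T s' \<Longrightarrow> T \<le> T' \<Longrightarrow> runs P s T' s'"
  unfolding runs_def using le_trans by blast

lemma runs_Seq: "runs P s T s' \<Longrightarrow> runs P' s' T' s'' \<Longrightarrow> runs (Seq P P') s (T + T') s''"
  unfolding runs_def by (meson add_mono exec.intros(6))

lemma runs_Cond:
  assumes "if s r \<noteq> 0 then runs P s T s' else runs P' s T s'" "B > 0" "s r < 2 ^ B"
  shows "runs (Cond r P P') s (2 * B + T) s'"
proof -
  have *: "cost [s r] \<le> 2 * B" using floorlog_2_le[OF assms(3)] assms(2) by (auto simp: cost_def)
  obtain t where t: "t \<le> T" "if s r \<noteq> 0 then exec P s t s' else exec P' s t s'"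
    using assms(1) unfolding runs_def by (auto split: if_splits)
  have "exec (Cond r P P') s (cost [s r] + t) s'"
  proof (cases "s r = 0")
    case True
    then show ?thesis using t by (intro exec.intros(8)) auto
  next
    case False
    then show ?thesis using t by (intro exec.intros(7)) auto
  qed
  with t * show ?thesis unfolding runs_def by (meson add_mono)
qed

lemma runs_While_0:
  assumes "s r = 0"
  shows "runs (While r P) s 1 s"
proof -
  have "cost [s r] = 1" using assms by (simp add: cost_def floorlog_def)
  then show ?thesis using exec.intros(9)[of s r P, OF assms] unfolding runs_def by force
qed

lemma runs_While:
  assumes "s r \<noteq> 0" "runs P s T s'" "runs (While r P) s' T' s''" "B > 0" "s r < 2 ^ B"
  shows "runs (While r P) s (2 * B + T + T') s''"
proof -
  have *: "cost [s r] \<le> 2 * B" using floorlog_2_le[OF assms(5)] assms(4) by (auto simp: cost_def)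
  obtain t t' where t: "t \<le> T" "t' \<le> T'" "exec P s t s'" "exec (While r P) s' t' s''"
    using assms unfolding runs_def by auto
  have "exec (While r P) s (cost [s r] + t + t') s''"
    using t assms by (auto intro: exec.intros)
  with t * show ?thesis unfolding runs_def by (meson add_mono)
qed

text \<open>The power is computed by repeated doubling: \<open>c\<close> holds the exponent and is
  counted down to \<open>0\<close>, while \<open>u\<close> and \<open>w\<close> supply the constants
  1 and 2.\<close>

definition pow2_prog :: "nat \<Rightarrow> nat \<Rightarrow> nat \<Rightarrow> nat \<Rightarrow> prog" where
  "pow2_prog b c u w = Seq (Const u 1) (Seq (Const w 2) (Seq (Const b 1)
     (While c (Seq (Mult b b w) (Sub c c u)))))"

lemma runs_pow2_loop:
  assumes "distinct [b, c, u, w]" "s u = 1" "s w = 2" "s c = n" "s b * 2 ^ n < 2 ^ B" "n < 2 ^ B"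
    "B \<ge> 2"
  shows "runs (While c (Seq (Mult b b w) (Sub c c u))) s (n * (10 * B) + 1)
    (s(b := s b * 2 ^ n, c := 0))" (is "runs ?W _ _ _")
  using assms(2-6)
proof (induction n arbitrary: s)
  case 0
  then have "s(b := s b * 2 ^ 0, c := 0) = s" using assms(1) by auto
  then show ?case using runs_While_0[of s c] 0 by simp
next
  case (Suc n)
  define s1 where "s1 = s(b := s b * 2)"
  define s2 where "s2 = s1(c := n)"
  have B2: "(4::nat) \<le> 2 ^ B" using power_increasing[of 2 B "2::nat"] assms(7) by simp
  have "s b * 2 \<le> s b * 2 ^ Suc n" by simp
  then have b: "s b * 2 < 2 ^ B" using Suc.prems by linarith
  have 1: "runs (Mult b b w) s (4 * B) s1"
    using Suc.prems b B2 assms by (intro runs_Mult) (auto simp: s1_def)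
  have 2: "runs (Sub c c u) s1 (4 * B) s2"
    using Suc.prems B2 assms by (intro runs_Sub) (auto simp: s1_def s2_def)
  have 3: "runs ?W s2 (n * (10 * B) + 1)
      (s2(b := s2 b * 2 ^ n, c := 0))"
    using Suc.prems assms(1) by (intro Suc.IH) (auto simp: s1_def s2_def)
  have 4: "s2(b := s2 b * 2 ^ n, c := 0) = s(b := s b * 2 ^ Suc n, c := 0)"
    using assms(1) by (auto simp: s1_def s2_def)
  \<comment> \<open>A round costs \<open>2 * B\<close> for the test and \<open>4 * B\<close> for
    each of the two instructions, which gives \<open>10 * B\<close>; the last, failing test costs
    \<open>1\<close>.\<close>
  have "runs ?W s
      (2 * B + (4 * B + 4 * B) + (n * (10 * B) + 1)) (s(b := s b * 2 ^ Suc n, c := 0))"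
    using Suc.prems assms(7)
    by (intro runs_While[OF _ runs_Seq[OF 1 2] 3[unfolded 4]]) auto
  then show ?case by (rule runs_mono) (simp add: algebra_simps)
qed

lemma runs_pow2:
  assumes "distinct [b, c, u, w]" "s c = n" "n < B" "B \<ge> 2"
  shows "runs (pow2_prog b c u w) s (n * (10 * B) + 13 * B)
    (s(u := 1, w := 2, b := 2 ^ n, c := 0))"
proof -
  have B2: "(4::nat) \<le> 2 ^ B" using power_increasing[of 2 B "2::nat"] assms by simp
  have n: "n < 2 ^ B" using less_exp[of B] assms by linarith
  have "runs (pow2_prog b c u w) s (4 * B + (4 * B + (4 * B + (n * (10 * B) + 1))))
    ((s(u := 1, w := 2, b := 1))(b := (s(u := 1, w := 2, b := 1)) b * 2 ^ n, c := 0))"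
    unfolding pow2_prog_def
  proof (intro runs_Seq)
    have "(1::nat) < 2 ^ B" using B2 by linarith
    then show "runs (Const u 1) s (4 * B) (s(u := 1))"
      and "runs (Const b 1) (s(u := 1, w := 2)) (4 * B) (s(u := 1, w := 2, b := 1))"
      using assms by (auto intro!: runs_Const)
    show "runs (Const w 2) (s(u := 1)) (4 * B) (s(u := 1, w := 2))"
      using assms B2 by (intro runs_Const) auto
    show "runs (While c (Seq (Mult b b w) (Sub c c u))) (s(u := 1, w := 2, b := 1))
      (n * (10 * B) + 1)
      ((s(u := 1, w := 2, b := 1))(b := (s(u := 1, w := 2, b := 1)) b * 2 ^ n, c := 0))"
      using assms n by (intro runs_pow2_loop) (auto intro: power_strict_increasing)
  qed
  moreover have "(s(u := 1, w := 2, b := 1))(b := (s(u := 1, w := 2, b := 1)) b * 2 ^ n, c := 0) =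
      s(u := 1, w := 2, b := 2 ^ n, c := 0)"
    by simp
  ultimately show ?thesis using assms by (simp only:) (erule runs_mono, simp)
qed

text \<open>Tries the bit \<open>b\<close> of the root: the truncated difference \<open>d\<close> of
  \<open>(r + b)^2\<close> and \<open>N\<close> is \<open>0\<close> precisely if
  \<open>r + b\<close> does not overshoot, and only then is \<open>r\<close> increased.
  \<open>Const x 0\<close> serves as the empty program, and \<open>w\<close> holds 2, by which
  \<open>b\<close> is divided.\<close>

definition isqrt_body :: "nat \<Rightarrow> nat \<Rightarrow> nat \<Rightarrow> nat \<Rightarrow> nat \<Rightarrow> nat \<Rightarrow> prog" where
  "isqrt_body r b N x d w = Seq (Add x r b) (Seq (Mult d x x) (Seq (Sub d d N)
     (Seq (Cond d (Const x 0) (Add r r b)) (Div b b w))))"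

lemma runs_isqrt_body:
  assumes "distinct [r, b, N, x, d, w]" "s w = 2" "(s r + 2 * s b)\<^sup>2 < 2 ^ B" "s N < 2 ^ B" "B \<ge> 2"
  shows "\<exists>s'. runs (isqrt_body r b N x d w) s (22 * B) s' \<and>
    s' r = (if (s r + s b)\<^sup>2 \<le> s N then s r + s b else s r) \<and> s' b = s b div 2 \<and>
    (\<forall>i. i \<notin> {r, b, x, d} \<longrightarrow> s' i = s i)"
proof -
  define y where "y = s r + s b"
  define z where "z = y\<^sup>2 - s N"
  have B2: "(4::nat) \<le> 2 ^ B" using power_increasing[of 2 B "2::nat"] assms by simp
  have "y\<^sup>2 \<le> (s r + 2 * s b)\<^sup>2" unfolding y_def by (intro power_mono) auto
  then have y2: "y\<^sup>2 < 2 ^ B" using assms by linarith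
  have "y \<le> y\<^sup>2" by (simp add: power2_eq_square)
  then have y: "y < 2 ^ B" using y2 by linarith
  define s1 where "s1 = s(x := y)"
  define s2 where "s2 = s1(d := y\<^sup>2)"
  define s3 where "s3 = s2(d := z)"
  define s4 where "s4 = (if z \<noteq> 0 then s3(x := 0) else s3(r := y))"
  define s5 where "s5 = s4(b := s b div 2)"
  have 1: "runs (Add x r b) s (4 * B) s1"
    using assms y by (intro runs_Add) (auto simp: s1_def y_def)
  have 2: "runs (Mult d x x) s1 (4 * B) s2"
    using assms y y2 by (intro runs_Mult) (auto simp: s1_def s2_def power2_eq_square)
  have 3: "runs (Sub d d N) s2 (4 * B) s3"
    using assms y y2 by (intro runs_Sub) (auto simp: s1_def s2_def s3_def z_def)
  have 4: "runs (Cond d (Const x 0) (Add r r b)) s3 (2 * B + 4 * B) s4"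
  proof (intro runs_Cond)
    show "if s3 d \<noteq> 0 then runs (Const x 0) s3 (4 * B) s4 else runs (Add r r b) s3 (4 * B) s4"
    proof (cases "z = 0")
      case True
      have "runs (Add r r b) s3 (4 * B) s4"
        using assms y True by (intro runs_Add) (auto simp: s1_def s2_def s3_def s4_def y_def)
      then show ?thesis using True by (simp add: s3_def)
    next
      case False
      have "runs (Const x 0) s3 (4 * B) s4"
        using assms y False by (intro runs_Const) (auto simp: s4_def)
      then show ?thesis using False by (simp add: s3_def)
    qed
    show "s3 d < 2 ^ B" using y2 by (auto simp: s3_def z_def)
  qed (use assms in auto)
  have 5: "runs (Div b b w) s4 (4 * B) s5"
    using assms y B2
    by (intro runs_Div) (auto simp: s1_def s2_def s3_def s4_def s5_def y_def)
  have "runs (isqrt_body r b N x d w) s (4 * B + (4 * B + (4 * B + (2 * B + 4 * B + 4 * B)))) s5"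
    unfolding isqrt_body_def by (intro runs_Seq[OF 1] runs_Seq[OF 2] runs_Seq[OF 3] runs_Seq[OF 4] 5)
  moreover have "s5 r = (if (s r + s b)\<^sup>2 \<le> s N then s r + s b else s r)"
    using assms by (auto simp: s1_def s2_def s3_def s4_def s5_def z_def y_def)
  moreover have "s5 b = s b div 2" by (auto simp: s5_def)
  moreover have "\<forall>i. i \<notin> {r, b, x, d} \<longrightarrow> s5 i = s i"
    using assms by (auto simp: s1_def s2_def s3_def s4_def s5_def)
  ultimately show ?thesis by (intro exI[of _ s5]) simp
qed

text \<open>Bitwise integer square root: \<open>r\<close> agrees with the root in the bits above \<open>b\<close>.\<close>

lemma runs_isqrt:
  assumes "distinct [r, b, N, x, d, w]" "s w = 2" "s b = 2 ^ i div 2" "(s r)\<^sup>2 \<le> s N"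
    "s N < (s r + 2 ^ i)\<^sup>2" "(s r + 2 ^ i)\<^sup>2 < 2 ^ B" "B \<ge> 2"
  shows "\<exists>s'. runs (While b (isqrt_body r b N x d w)) s (i * (24 * B) + 1) s' \<and>
    (s' r)\<^sup>2 \<le> s N \<and> s N < (s' r + 1)\<^sup>2 \<and> (\<forall>i. i \<notin> {r, b, x, d} \<longrightarrow> s' i = s i)" (is "\<exists>s'. runs ?W _ _ _ \<and> _")
  using assms(2-6)
proof (induction i arbitrary: s)
  case 0
  \<comment> \<open>As \<open>2 ^ 0 div 2 = 0\<close>, the loop stops when the root is enclosed
    between \<open>r\<close> and \<open>r + 1\<close>.\<close>
  then show ?case using runs_While_0[of s b] by (intro exI[of _ s]) auto
next
  case (Suc i)
  have sb: "s b = 2 ^ i" using Suc.prems by simp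
  obtain s1 where s1: "runs (isqrt_body r b N x d w) s (22 * B) s1"
    "s1 r = (if (s r + s b)\<^sup>2 \<le> s N then s r + s b else s r)" "s1 b = s b div 2"
    "\<forall>i. i \<notin> {r, b, x, d} \<longrightarrow> s1 i = s i"
    using runs_isqrt_body[of r b N x d w s B] assms(1,7) Suc.prems sb by auto
  have fr: "s1 w = 2" "s1 N = s N" using s1 Suc.prems assms(1) by auto
  have "(s1 r + 2 ^ i)\<^sup>2 \<le> (s r + 2 ^ Suc i)\<^sup>2"
    unfolding s1(2) sb by (intro power_mono) auto
  then have le: "(s1 r + 2 ^ i)\<^sup>2 < 2 ^ B" using Suc.prems by linarith
  have "\<exists>s'. runs ?W s1 (i * (24 * B) + 1) s' \<and>
    (s' r)\<^sup>2 \<le> s1 N \<and> s1 N < (s' r + 1)\<^sup>2 \<and> (\<forall>i. i \<notin> {r, b, x, d} \<longrightarrow> s' i = s1 i)"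
  proof (rule Suc.IH[OF fr(1) _ _ _ le])
    show "s1 b = 2 ^ i div 2" using s1(3) sb by simp
    show "(s1 r)\<^sup>2 \<le> s1 N" using fr s1(2) Suc.prems by auto
    show "s1 N < (s1 r + 2 ^ i)\<^sup>2" using fr s1(2) Suc.prems sb by (auto simp: not_le algebra_simps mult_2)
  qed
  then obtain s2 where s2: "runs ?W s1 (i * (24 * B) + 1) s2"
    "(s2 r)\<^sup>2 \<le> s1 N" "s1 N < (s2 r + 1)\<^sup>2" "\<forall>i. i \<notin> {r, b, x, d} \<longrightarrow> s2 i = s1 i" by blast
  have "s r + 2 ^ Suc i \<le> (s r + 2 ^ Suc i)\<^sup>2" by (simp add: power2_nat_le_imp_le power2_eq_square)
  moreover have "s b \<le> s r + 2 ^ Suc i" unfolding sb by simp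
  ultimately have b: "s b < 2 ^ B" using Suc.prems(5) by linarith
  have "runs ?W s (2 * B + 22 * B + (i * (24 * B) + 1)) s2"
    using sb s1 assms b by (intro runs_While[OF _ s1(1) s2(1)]) auto
  then have "runs ?W s (Suc i * (24 * B) + 1) s2"
    by (rule runs_mono) (simp add: algebra_simps)
  then show ?case using s2 fr s1 by (intro exI[of _ s2]) auto
qed

lemma poly_bound_le:
  assumes "t \<le> a * (n + 1) ^ b" "a \<le> K" "b \<le> K"
  shows "t \<le> K * (n + 1 :: nat) ^ K"
  using assms(2,3) by (intro order_trans[OF assms(1)] mult_mono power_increasing) auto

text \<open>Decouples the factor of the time bound from the exponent, which the definition ties to a
  single \<open>k\<close>.\<close>

lemma eff_computable_real_iff_runs:
  "eff_computable_real x \<longleftrightarrow> (\<exists>P a b. \<forall>n. \<exists>s'. runs P ((\<lambda>_. 0)(0 := n)) (a * (n + 1) ^ b) s' \<and>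
     \<bar>(real (s' 0) - real (s' 1)) / 2 ^ n - x\<bar> \<le> 1 / 2 ^ n)" (is "_ = ?r")
proof
  assume "eff_computable_real x"
  then show ?r unfolding eff_computable_real_def runs_def by meson
next
  assume ?r
  then obtain P a b where P: "\<forall>n. \<exists>s'. runs P ((\<lambda>_. 0)(0 := n)) (a * (n + 1) ^ b) s' \<and>
     \<bar>(real (s' 0) - real (s' 1)) / 2 ^ n - x\<bar> \<le> 1 / 2 ^ n" by blast
  show "eff_computable_real x" unfolding eff_computable_real_def
  proof (rule exI[of _ P], rule exI[of _ "a + b"], rule allI)
    fix n
    from P obtain s' t where "t \<le> a * (n + 1) ^ b" "exec P ((\<lambda>_. 0)(0 := n)) t s'"
      "\<bar>(real (s' 0) - real (s' 1)) / 2 ^ n - x\<bar> \<le> 1 / 2 ^ n"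
      unfolding runs_def by meson
    then show "\<exists>t s'. exec P ((\<lambda>_. 0)(0 := n)) t s' \<and> t \<le> (a + b) * (n + 1) ^ (a + b) \<and>
        \<bar>(real (s' 0) - real (s' 1)) / 2 ^ n - x\<bar> \<le> 1 / 2 ^ n"
      using poly_bound_le[of t a n b "a + b"] by auto
  qed
qed

text \<open>Both quotients are rounded down, each by at most one unit \<open>1 / 2 ^ n\<close>. In
  the difference these errors have opposite signs, so together they do not exceed one unit
  either.\<close>

lemma eff_computable_real_rat:
  fixes a b d :: nat
  assumes "d > 0"
  shows "eff_computable_real ((real a - real b) / real d)"
proof -
  define P where "P = Seq (pow2_prog 2 0 3 4) (Seq (Const 5 d)
    (Seq (Const 0 a) (Seq (Mult 0 0 2) (Seq (Div 0 0 5)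
    (Seq (Const 1 b) (Seq (Mult 1 1 2) (Div 1 1 5)))))))"
  have "\<exists>s'. runs P ((\<lambda>_. 0)(0 := n)) ((51 * (a + b + d + 2)) * (n + 1) ^ 2) s' \<and>
    \<bar>(real (s' 0) - real (s' 1)) / 2 ^ n - (real a - real b) / d\<bar> \<le> 1 / 2 ^ n" for n
  proof -
  define B where "B = n + a + b + d + 2"
  define N where "N = (2::nat) ^ n"
  define s where "s = ((\<lambda>_. 0)(0 := n) :: store)"
  define s1 where "s1 = s(3 := 1, 4 := 2, 2 := N, 0 := 0)"
  define s' where "s' = s1(5 := d, 0 := a * N div d, 1 := b * N div d)"
  have lt: "x * 2 ^ n < 2 ^ B" if "x \<le> a + b" for x
  proof -
    have "x * 2 ^ n < 2 ^ x * (2::nat) ^ n" by simp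
    also have "\<dots> = 2 ^ (x + n)" by (simp add: power_add)
    also have "\<dots> \<le> 2 ^ B" using that by (intro power_increasing) (auto simp: B_def)
    finally show ?thesis .
  qed
  have ltN: "N < 2 ^ B" unfolding N_def B_def by (rule power_strict_increasing) auto
  have lt': "x < 2 ^ B" if "x \<le> B" for x using that less_exp[of B] by linarith
  have B0: "B > 0" by (simp add: B_def)
  have ab: "a < 2 ^ B" "b < 2 ^ B" "d < 2 ^ B" by (intro lt'; simp add: B_def)+
  have aN: "a * N < 2 ^ B" "b * N < 2 ^ B" using lt by (auto simp: N_def)
  define time where "time = (n * (10 * B) + 13 * B) + (4 * B + (4 * B + (4 * B + (4 * B +
      (4 * B + (4 * B + 4 * B))))))"
  have "runs P s time s'"
    unfolding P_def time_def
  proof (intro runs_Seq)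
    show "runs (pow2_prog 2 0 3 4) s (n * (10 * B) + 13 * B) s1"
      unfolding s1_def N_def by (intro runs_pow2) (auto simp: s_def B_def)
    show "runs (Const 5 d) s1 (4 * B) (s1(5 := d))"
      by (intro runs_Const lt') (auto simp: B_def)
    show "runs (Const 0 a) (s1(5 := d)) (4 * B) (s1(5 := d, 0 := a))"
      by (intro runs_Const lt') (auto simp: B_def)
    show "runs (Mult 0 0 2) (s1(5 := d, 0 := a)) (4 * B) (s1(5 := d, 0 := a * N))"
      using aN ltN ab B0 by (intro runs_Mult) (auto simp: s1_def fun_eq_iff)
    show "runs (Div 0 0 5) (s1(5 := d, 0 := a * N)) (4 * B) (s1(5 := d, 0 := a * N div d))"
      using aN ab B0 by (intro runs_Div) (auto simp: s1_def fun_eq_iff)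
    show "runs (Const 1 b) (s1(5 := d, 0 := a * N div d)) (4 * B) (s1(5 := d, 0 := a * N div d, 1 := b))"
      by (intro runs_Const lt') (auto simp: B_def)
    show "runs (Mult 1 1 2) (s1(5 := d, 0 := a * N div d, 1 := b)) (4 * B)
        (s1(5 := d, 0 := a * N div d, 1 := b * N))"
      using aN ltN ab B0 by (intro runs_Mult) (auto simp: s1_def fun_eq_iff)
    show "runs (Div 1 1 5) (s1(5 := d, 0 := a * N div d, 1 := b * N)) (4 * B) s'"
      using aN ab B0 by (intro runs_Div) (auto simp: s1_def s'_def fun_eq_iff)
  qed
  moreover have "time \<le> (51 * (a + b + d + 2)) * (n + 1) ^ 2"
  proof -
    have "time = (10 * n + 41) * B" by (simp add: time_def algebra_simps)
    also have "\<dots> \<le> (51 * (n + 1)) * ((a + b + d + 2) * (n + 1))"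
      by (intro mult_mono) (auto simp: B_def algebra_simps)
    also have "\<dots> = (51 * (a + b + d + 2)) * (n + 1) ^ 2" by (simp add: power2_eq_square algebra_simps)
    finally show ?thesis .
  qed
  ultimately have r: "runs P s ((51 * (a + b + d + 2)) * (n + 1) ^ 2) s'" by (rule runs_mono)
  have q: "real (x * N div d) / 2 ^ n \<le> real x / d" "real x / d - 1 / 2 ^ n \<le> real (x * N div d) / 2 ^ n"
    for x
  proof -
    have e: "real (x * N) = real (x * N div d) * d + real (x * N mod d)"
      using div_mult_mod_eq[of "x * N" d] by (metis of_nat_add of_nat_mult)
    have m: "real (x * N mod d) < d" using assms by simp
    have N: "real N = 2 ^ n" by (simp add: N_def)
    show "real (x * N div d) / 2 ^ n \<le> real x / d"
      using e m assms unfolding N[symmetric] by (simp add: field_simps N_def)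
    show "real x / d - 1 / 2 ^ n \<le> real (x * N div d) / 2 ^ n"
      using e m assms unfolding N[symmetric] by (simp add: field_simps N_def)
  qed
  have "\<bar>(real (s' 0) - real (s' 1)) / 2 ^ n - (real a - real b) / d\<bar> \<le> 1 / 2 ^ n"
    using q[of a] q[of b] unfolding s'_def
    by (simp add: diff_divide_distrib)
  then show ?thesis using r unfolding s_def by blast
  qed
  then show ?thesis unfolding eff_computable_real_iff_runs by blast
qed

text \<open>The root is not Lipschitz at 0: an error \<open>2 ^ (-m)\<close> in \<open>x\<close> can
  become \<open>2 ^ (-m/2)\<close> in the root. Hence \<open>x\<close> is computed to
  \<open>m = 2 * n + 4\<close> bits, where the 4 yields two spare bits in the root. In units of
  \<open>2 ^ (-n-2)\<close>, the error of \<open>N\<close>, the integer root and the final rounding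
  to a multiple of 4 contribute at most 1, 1 and 2, in total one unit of
  \<open>2 ^ (-n)\<close>.\<close>

lemma eff_computable_real_sqrt:
  assumes "eff_computable_real x" "0 \<le> x" "x \<le> 1"
  shows "eff_computable_real (sqrt x)"
proof -
  obtain P a b where P: "\<And>n. \<exists>s'. runs P ((\<lambda>_. 0)(0 := n)) (a * (n + 1) ^ b) s' \<and>
     \<bar>(real (s' 0) - real (s' 1)) / 2 ^ n - x\<bar> \<le> 1 / 2 ^ n"
    using assms(1) unfolding eff_computable_real_iff_runs by blast
  define F where "F = max_reg P + 2"
  have F: "F \<ge> 2" "max_reg P < F" by (simp_all add: F_def)
  \<comment> \<open>Register \<open>F + 2\<close> is still \<open>0\<close> when the first
    \<open>Add\<close> copies \<open>n\<close> to \<open>F + 1\<close>, where it survives the call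
    of \<open>P\<close>. Below \<open>F\<close> only register 0 has been changed, so
    \<open>P\<close> starts from the store that it expects, with precision
    \<open>n + n + 4\<close>.\<close>
  define Q where "Q = Seq (Const F 4) (Seq (Add (F + 1) 0 (F + 2)) (Seq (Add 0 0 0) (Seq (Add 0 0 F)
    (Seq P (Seq (Sub 0 0 1) (Seq (Const (F + 2) 2) (Seq (Add (F + 1) (F + 1) (F + 2))
    (Seq (pow2_prog (F + 3) (F + 1) (F + 4) (F + 2))
    (Seq (While (F + 3) (isqrt_body (F + 5) (F + 3) 0 (F + 6) (F + 7) (F + 2)))
    (Seq (Add 0 (F + 5) (F + 2)) (Seq (Div 0 0 F) (Const 1 0))))))))))))"
  have "\<exists>s'. runs Q ((\<lambda>_. 0)(0 := n)) (200 * (20 + a * 5 ^ b) * (n + 1) ^ (b + 2)) s' \<and>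
     \<bar>(real (s' 0) - real (s' 1)) / 2 ^ n - sqrt x\<bar> \<le> 1 / 2 ^ n" for n
  proof -
    define m where "m = n + n + 4"
    define T where "T = a * (m + 1) ^ b"
    \<comment> \<open>Within time \<open>T\<close>, \<open>P\<close> cannot write a number of more
      than \<open>T\<close> bits, so \<open>B\<close> bounds the bit lengths of what it leaves
      behind and of everything computed afterwards.\<close>
    define B where "B = T + 2 * n + 20"
    define s where "s = ((\<lambda>_. 0)(0 := n) :: store)"
    obtain p where p: "runs P ((\<lambda>_. 0)(0 := m)) T p"
      "\<bar>(real (p 0) - real (p 1)) / 2 ^ m - x\<bar> \<le> 1 / 2 ^ m"
      using P[of m] unfolding T_def by blast
    then obtain t where t: "t \<le> T" "exec P ((\<lambda>_. 0)(0 := m)) t p" unfolding runs_def by blast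
    define s1 where "s1 = s(F := 4, F + 1 := n, 0 := m)"
    have "\<forall>i<F. s1 i = ((\<lambda>_. 0)(0 := m)) i" using F by (auto simp: s1_def s_def)
    then obtain s2 where s2: "exec P s1 t s2" "\<forall>i<F. s2 i = p i" "\<forall>i\<ge>F. s2 i = s1 i"
      using exec_frame[OF t(2) F(2)] by blast
    have B2: "B \<ge> 2" "B > 0" by (auto simp: B_def)
    have lt: "y < 2 ^ B" if "y \<le> B" for y using that less_exp[of B] by linarith
    have bits: "p i < 2 ^ B" for i
    proof -
      have "m < 2 ^ m" by (rule less_exp)
      then have "floorlog 2 m \<le> m" by (rule floorlog_2_le)
      then have "floorlog 2 (((\<lambda>_. 0)(0 := m)) i) \<le> m" by (auto simp: floorlog_def)
      then have "floorlog 2 (p i) \<le> B"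
        using exec_floorlog_le[OF t(2), of i] t(1) by (auto simp: B_def m_def)
      then show ?thesis using floorlog_leD[of 2 "p i" B] by simp
    qed
    define N where "N = p 0 - p 1"
    have m2: "(2::nat) ^ m = (2 ^ (n + 2))\<^sup>2"
    proof -
      have "m = (n + 2) * 2" by (simp add: m_def)
      then show ?thesis by (simp only: power_mult)
    qed
    have Nle: "N \<le> 2 ^ m + 1"
    proof (cases "p 1 \<le> p 0")
      case True
      have "(real (p 0) - real (p 1)) / 2 ^ m \<le> 1 + 1 / 2 ^ m"
        using p(2) assms by linarith
      then have "real (p 0) - real (p 1) \<le> (1 + 1 / 2 ^ m) * 2 ^ m" by (simp only: pos_divide_le_eq zero_less_power zero_less_numeral)
      also have "\<dots> = 2 ^ m + 1" by (simp add: distrib_right)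
      finally have "real (p 0) - real (p 1) \<le> 2 ^ m + 1" .
      then have "real (p 0 - p 1) \<le> real (2 ^ m + 1)" using True by (simp add: of_nat_diff)
      then show ?thesis unfolding N_def using of_nat_le_iff by blast
    qed (simp add: N_def)
    define s3 where "s3 = s2(0 := N)"
    define s4 where "s4 = s3(F + 2 := 2)"
    define s5 where "s5 = s4(F + 1 := n + 2)"
    define s6 where "s6 = s5(F + 4 := 1, F + 2 := 2, F + 3 := 2 ^ (n + 2), F + 1 := 0)"
    have s6: "s6 (F + 5) = 0" "s6 0 = N" "s6 (F + 2) = 2" "s6 (F + 3) = 2 ^ (n + 2)" "s6 F = 4"
      using s2 F by (auto simp: s6_def s5_def s4_def s3_def s1_def s_def)
    have "N < (2 ^ (n + 3))\<^sup>2"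
    proof -
      have "(1::nat) \<le> 2 ^ m" by simp
      then have "2 ^ m + 1 < 4 * (2::nat) ^ m" by linarith
      also have "\<dots> = (2 ^ (n + 3))\<^sup>2" unfolding m2 by (simp add: power2_eq_square power_add)
      finally show ?thesis using Nle by linarith
    qed
    moreover have "(2 ^ (n + 3))\<^sup>2 < (2::nat) ^ B"
    proof -
      have "(2 ^ (n + 3))\<^sup>2 = (2::nat) ^ ((n + 3) * 2)" by (simp only: power_mult)
      also have "\<dots> < 2 ^ B" by (rule power_strict_increasing) (auto simp: B_def)
      finally show ?thesis .
    qed
    ultimately obtain s7 where s7: "runs (While (F + 3) (isqrt_body (F + 5) (F + 3) 0 (F + 6) (F + 7) (F + 2)))
        s6 ((n + 3) * (24 * B) + 1) s7"
        "(s7 (F + 5))\<^sup>2 \<le> N" "N < (s7 (F + 5) + 1)\<^sup>2"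
        "\<forall>i. i \<notin> {F + 5, F + 3, F + 6, F + 7} \<longrightarrow> s7 i = s6 i"
      using runs_isqrt[of "F + 5" "F + 3" 0 "F + 6" "F + 7" "F + 2" s6 "n + 3" B] s6 F B2 by (auto simp: power_add)
    define R where "R = s7 (F + 5)"
    have R: "R\<^sup>2 \<le> N" "N < (R + 1)\<^sup>2" using s7 by (auto simp: R_def)
    have "R \<le> R\<^sup>2" by (simp add: power2_eq_square)
    moreover have "2 ^ m + 3 < (2::nat) ^ B"
    proof -
      have "3 \<le> (2::nat) ^ m" using power_increasing[of 2 m "2::nat"] by (simp add: m_def)
      then have "2 ^ m + 3 \<le> (2::nat) ^ (m + 1)" by simp
      also have "\<dots> < 2 ^ B" by (rule power_strict_increasing) (auto simp: B_def m_def)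
      finally show ?thesis .
    qed
    ultimately have R2: "R + 2 < 2 ^ B" using R Nle by linarith
    have s7': "s7 0 = N" "s7 (F + 2) = 2" "s7 F = 4" using s7(4) s6 F by auto
    define s8 where "s8 = s7(0 := R + 2)"
    define s9 where "s9 = s8(0 := (R + 2) div 4)"
    define s10 where "s10 = s9(1 := 0)"
    define time where "time = 4 * B + (4 * B + (4 * B + (4 * B + (T + (4 * B + (4 * B + (4 * B +
       ((n + 2) * (10 * B) + 13 * B + ((n + 3) * (24 * B) + 1 + (4 * B + (4 * B + 4 * B)))))))))))"
    have "runs Q s time s10"
      unfolding Q_def time_def
    proof (intro runs_Seq)
      have small: "4 < (2::nat) ^ B" "n < 2 ^ B" "n + n < 2 ^ B" "m < 2 ^ B" "n + 2 < 2 ^ B"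
        by (rule lt, simp add: B_def m_def)+
      note small = small B2(2)
      show "runs (Const F 4) s (4 * B) (s(F := 4))"
        using small by (intro runs_Const) auto
      show "runs (Add (F + 1) 0 (F + 2)) (s(F := 4)) (4 * B) (s(F := 4, F + 1 := n))"
        using small F by (intro runs_Add) (auto simp: s_def)
      show "runs (Add 0 0 0) (s(F := 4, F + 1 := n)) (4 * B) (s(F := 4, F + 1 := n, 0 := n + n))"
        using small F by (intro runs_Add) (auto simp: s_def)
      show "runs (Add 0 0 F) (s(F := 4, F + 1 := n, 0 := n + n)) (4 * B) s1"
        using small F by (intro runs_Add) (auto simp: s_def s1_def m_def)
      show "runs P s1 T s2" using s2 t by (auto simp: runs_def)
      show "runs (Sub 0 0 1) s2 (4 * B) s3"
        using small F s2 bits by (intro runs_Sub) (auto simp: s3_def N_def)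
      show "runs (Const (F + 2) 2) s3 (4 * B) s4"
        using small by (intro runs_Const) (auto simp: s4_def)
      show "runs (Add (F + 1) (F + 1) (F + 2)) s4 (4 * B) s5"
        using small F s2 by (intro runs_Add) (auto simp: s5_def s4_def s3_def s1_def)
      show "runs (pow2_prog (F + 3) (F + 1) (F + 4) (F + 2)) s5 ((n + 2) * (10 * B) + 13 * B) s6"
        unfolding s6_def by (intro runs_pow2) (auto simp: s5_def B_def)
      show "runs (While (F + 3) (isqrt_body (F + 5) (F + 3) 0 (F + 6) (F + 7) (F + 2)))
        s6 ((n + 3) * (24 * B) + 1) s7" by fact
      show "runs (Add 0 (F + 5) (F + 2)) s7 (4 * B) s8"
        using small s7' R2 by (intro runs_Add) (auto simp: s8_def R_def)
      show "runs (Div 0 0 F) s8 (4 * B) s9"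
        using small s7' R2 F by (intro runs_Div) (auto simp: s8_def s9_def)
      show "runs (Const 1 0) s9 (4 * B) s10"
        using small by (intro runs_Const) (auto simp: s10_def)
    qed
    moreover have "time
      \<le> 200 * (20 + a * 5 ^ b) * (n + 1) ^ (b + 2)"
    proof -
      have "T \<le> a * (5 * (n + 1)) ^ b" unfolding T_def
        by (intro mult_mono power_mono) (auto simp: m_def)
      also have "\<dots> = a * 5 ^ b * (n + 1) ^ b" by (simp only: power_mult_distrib mult.assoc)
      also have "\<dots> \<le> a * 5 ^ b * (n + 1) ^ (b + 1)" by (intro mult_mono power_increasing) auto
      finally have T: "T \<le> a * 5 ^ b * (n + 1) ^ (b + 1)" .
      have "(n + 1) ^ 1 \<le> (n + 1) ^ (b + 1)" by (intro power_increasing) auto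
      then have "2 * n + 20 \<le> 20 * (n + 1) ^ (b + 1)" by simp
      with T have B: "B \<le> (20 + a * 5 ^ b) * (n + 1) ^ (b + 1)"
        unfolding B_def by (simp add: algebra_simps)
      have "time
        = (34 * n + 145) * B + T + 1" by (simp add: time_def algebra_simps)
      also have "\<dots> \<le> (34 * n + 147) * B" by (simp add: B_def algebra_simps)
      also have "\<dots> \<le> (200 * (n + 1)) * ((20 + a * 5 ^ b) * (n + 1) ^ (b + 1))"
        by (intro mult_mono B) auto
      also have "\<dots> = 200 * (20 + a * 5 ^ b) * (n + 1) ^ (b + 2)" by (simp add: algebra_simps)
      finally show ?thesis .
    qed
    ultimately have r: "runs Q s (200 * (20 + a * 5 ^ b) * (n + 1) ^ (b + 2)) s10" by (rule runs_mono)
    \<comment> \<open>Truncated subtraction turns a negative estimate into \<open>0\<close>, which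
      is only closer to \<open>2 ^ m * x\<close>, as \<open>x\<close> is nonnegative.\<close>
    have "\<bar>real N - 2 ^ m * x\<bar> \<le> 1"
    proof -
      have "\<bar>(real (p 0) - real (p 1)) - 2 ^ m * x\<bar> \<le> 1"
        using p(2) by (simp add: field_simps abs_le_iff)
      moreover have "0 \<le> 2 ^ m * x" using assms by simp
      ultimately show ?thesis unfolding N_def by (cases "p 1 \<le> p 0") (auto simp: of_nat_diff)
    qed
    then have le: "real N \<le> 2 ^ m * x + 1" "2 ^ m * x \<le> real N + 1" by auto
    have sq: "sqrt (2 ^ m * x) = 4 * 2 ^ n * sqrt x"
    proof -
      have "m = (n + 2) * 2" by (simp add: m_def)
      then have "(2::real) ^ m = (2 ^ (n + 2))\<^sup>2" by (simp only: power_mult)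
      also have "\<dots> = (4 * 2 ^ n)\<^sup>2" by (simp add: power_add)
      finally have "(2::real) ^ m = (4 * 2 ^ n)\<^sup>2" .
      then show ?thesis by (simp add: real_sqrt_mult)
    qed
    have "sqrt (real N) \<le> sqrt (2 ^ m * x) + 1"
    proof (rule order_trans[OF real_sqrt_le_mono[OF le(1)]])
      show "sqrt (2 ^ m * x + 1) \<le> sqrt (2 ^ m * x) + 1"
        using sqrt_add_le_add_sqrt[of "2 ^ m * x" 1] assms by simp
    qed
    moreover have "sqrt (2 ^ m * x) \<le> sqrt (real N) + 1"
    proof (rule order_trans[OF real_sqrt_le_mono[OF le(2)]])
      show "sqrt (real N + 1) \<le> sqrt (real N) + 1"
        using sqrt_add_le_add_sqrt[of "real N" 1] by simp
    qed
    moreover have "real R \<le> sqrt (real N)"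
      using R(1) by (intro real_le_rsqrt) (metis of_nat_le_iff of_nat_power)
    moreover have "sqrt (real N) \<le> real R + 1"
    proof (intro real_le_lsqrt)
      have "real N \<le> real ((R + 1)\<^sup>2)" using R(2) by (simp del: of_nat_power)
      then show "real N \<le> (real R + 1)\<^sup>2" by (simp add: add.commute)
    qed auto
    moreover have "4 * real ((R + 2) div 4) \<le> real R + 2" "real R \<le> 4 * real ((R + 2) div 4) + 1"
      by linarith+
    ultimately have "\<bar>4 * real ((R + 2) div 4) - 4 * 2 ^ n * sqrt x\<bar> \<le> 4" unfolding sq by linarith
    then have "\<bar>real ((R + 2) div 4) - 2 ^ n * sqrt x\<bar> \<le> 1" by linarith
    then have "\<bar>real ((R + 2) div 4) / 2 ^ n - sqrt x\<bar> \<le> 1 / 2 ^ n"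
      by (simp add: field_simps abs_le_iff)
    then have "\<bar>(real (s10 0) - real (s10 1)) / 2 ^ n - sqrt x\<bar> \<le> 1 / 2 ^ n"
      by (simp add: s10_def s9_def)
    with r show ?thesis unfolding s_def by blast
  qed
  then show ?thesis unfolding eff_computable_real_iff_runs by blast
qed

section \<open>Quantum machines and the simulation of probabilistic ones\<close>

lemma finite_actions:
  assumes "machine_ok M"
  shows "finite (actions M)"
proof -
  let ?S = "states M \<times> (UNIV :: move set) \<times> work_symbols M \<times> (UNIV :: move set) \<times>
    insert None (Some ` wom_symbols M) \<times> (UNIV :: move set)"
  have m: "finite (UNIV :: move set)"
  proof -
    have "(UNIV :: move set) = {Lft, Stay, Rgt}" using move.exhaust by auto
    then show ?thesis by (metis finite.emptyI finite.insertI)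
  qed
  have "finite ?S" using assms m by (intro finite_cartesian_product) (auto simp: machine_ok_def)
  moreover have "actions M \<subseteq> (\<lambda>(q, i, g, m, v, k). \<lparr>new_state = q, input_move = i, work_write = g,
      work_move = m, wom_write = v, wom_move = k\<rparr>) ` ?S"
  proof
    fix a assume a: "a \<in> actions M"
    have v: "wom_write a \<in> insert None (Some ` wom_symbols M)"
      using a by (cases "wom_write a") (auto simp: actions_def)
    show "a \<in> (\<lambda>(q, i, g, m, v, k). \<lparr>new_state = q, input_move = i, work_write = g,
      work_move = m, wom_write = v, wom_move = k\<rparr>) ` ?S"
      by (rule image_eqI[of _ _ "(new_state a, input_move a, work_write a, work_move a, wom_write a,
        wom_move a)"]) (use a v in \<open>auto simp: actions_def\<close>)
  qed
  ultimately show ?thesis by (metis finite_imageI finite_subset)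
qed

lemma input_at_in_input_symbols:
  assumes "w \<in> lists (alphabet M)"
  shows "input_at w i \<in> input_symbols M"
proof (cases "i = 0 \<or> i > length w")
  case False
  then have "w ! (i - 1) \<in> set w" by auto
  then have "w ! (i - 1) \<in> alphabet M" using assms by (auto simp: in_lists_conv_set)
  with False show ?thesis by (auto simp: input_at_def input_symbols_def)
qed (auto simp: input_at_def input_symbols_def)

definition scanned :: "nat list \<Rightarrow> config \<Rightarrow> input_symbol" where
  "scanned w c = input_at w (input_pos c)"

definition work_symbol :: "config \<Rightarrow> nat" where
  "work_symbol c = work_tape c (work_pos c)"

lemma init_config_in_configs: "machine_ok M \<Longrightarrow> init_config M \<in> configs M w"
  by (auto simp: machine_ok_def init_config_def configs_def)

text \<open>The conversion \<open>nat\<close> in \<open>perform\<close> never truncates, because no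
  left move is made on the left end-marker. The second claim is what makes head moves
  invertible.\<close>

lemma input_pos_perform_le:
  assumes "input_pos c \<le> length w + 1" "stays_on_input (scanned w c) a"
  shows "input_pos (perform a c) \<le> length w + 1"
    "int (input_pos (perform a c)) = int (input_pos c) + shift (input_move a)"
proof -
  consider "input_pos c = 0" | "input_pos c = length w + 1" | "0 < input_pos c" "input_pos c \<le> length w"
    using assms(1) by linarith
  then have "input_pos (perform a c) \<le> length w + 1 \<and>
    int (input_pos (perform a c)) = int (input_pos c) + shift (input_move a)"
    using assms by cases (cases "input_move a"; auto simp: perform_def stays_on_input_def scanned_def input_at_def)+
  then show "input_pos (perform a c) \<le> length w + 1"
    "int (input_pos (perform a c)) = int (input_pos c) + shift (input_move a)" by auto
qed

lemma perform_in_configs: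
  assumes "c \<in> configs M w" "a \<in> actions M" "stays_on_input (scanned w c) a"
  shows "perform a c \<in> configs M w"
proof -
  have "finite {i. ((work_tape c)(work_pos c := work_write a)) i \<noteq> 0}"
    by (rule finite_subset[of _ "insert (work_pos c) {i. work_tape c i \<noteq> 0}"])
       (use assms in \<open>auto simp: configs_def\<close>)
  moreover have "finite {i. ((wom_tape c)(wom_pos c := g)) i \<noteq> 0}" for g
    by (rule finite_subset[of _ "insert (wom_pos c) {i. wom_tape c i \<noteq> 0}"])
       (use assms in \<open>auto simp: configs_def\<close>)
  moreover have "input_pos (perform a c) \<le> length w + 1"
    using assms by (intro input_pos_perform_le) (auto simp: configs_def)
  ultimately show ?thesis using assms
    by (auto simp: configs_def perform_def actions_def image_subset_iff split: option.splits)
qed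

text \<open>If nothing is written on the WOM, a step forgets only the old state and the overwritten
  work symbol. Once these are fixed, all head moves and the tape change can be undone.\<close>

lemma perform_inj:
  assumes "wom_write a = None" "perform a c = perform a c'" "state c = state c'"
    "work_symbol c = work_symbol c'"
    "stays_on_input (scanned w c) a" "stays_on_input (scanned w c') a"
    "input_pos c \<le> length w + 1" "input_pos c' \<le> length w + 1"
  shows "c = c'"
proof -
  have "int (input_pos c) = int (input_pos c')"
    using input_pos_perform_le(2)[OF assms(7,5)] input_pos_perform_le(2)[OF assms(8,6)] assms(2)
    by simp
  moreover have wp: "work_pos c = work_pos c'" "wom_pos c = wom_pos c'" "wom_tape c = wom_tape c'"
    "(work_tape c)(work_pos c := work_write a) = (work_tape c')(work_pos c' := work_write a)"
    using assms(1,2) by (auto simp: perform_def)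
  moreover have "work_tape c = work_tape c'"
  proof
    fix i
    show "work_tape c i = work_tape c' i"
      using fun_cong[OF wp(4), of i] wp(1) assms(4) by (cases "i = work_pos c") (auto simp: work_symbol_def)
  qed
  ultimately show ?thesis using assms(3) by (cases c; cases c') auto
qed

definition amp :: "qtm_wom \<Rightarrow> nat list \<Rightarrow> nat \<Rightarrow> config \<Rightarrow> action \<Rightarrow> complex" where
  "amp M w r c a = ampl M (state c) (scanned w c) (work_symbol c) a r"

lemma evol_eq_amp:
  assumes "machine_ok M"
  shows "evol M w r d c = (\<Sum>a\<in>actions M. if perform a c = d then amp M w r c a else 0)"
  unfolding evol_def amp_def scanned_def work_symbol_def
  using finite_actions[OF assms] by (simp add: sum.inter_filter[symmetric])

text \<open>The contribution of one register symbol to the entry at \<open>c\<close>,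
  \<open>c'\<close> of the matrix that well-formedness requires to be the identity.\<close>

abbreviation gram :: "qtm_wom \<Rightarrow> nat list \<Rightarrow> nat \<Rightarrow> config \<Rightarrow> config \<Rightarrow> complex" where
  "gram M w r c c' \<equiv> \<Sum>\<^sub>\<infinity>d\<in>configs M w. cnj (evol M w r d c) * evol M w r d c'"

text \<open>Only the finitely many successors of \<open>c\<close> with nonzero amplitude contribute,
  which reduces the infinite sum to pairs of colliding actions. The assumption on \<open>c\<close>
  suffices: successors of \<open>c'\<close> elsewhere are multiplied by amplitude 0.\<close>

lemma evol_inner:
  assumes M: "machine_ok M"
    and c: "c \<in> configs M w" "\<And>a. a \<in> actions M \<Longrightarrow> amp M w r c a \<noteq> 0 \<Longrightarrow> stays_on_input (scanned w c) a"
  shows "gram M w r c c' =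
    (\<Sum>a\<in>actions M. \<Sum>a'\<in>actions M.
       if perform a c = perform a' c' then cnj (amp M w r c a) * amp M w r c' a' else 0)"
proof -
  let ?A = "actions M" and ?m = "amp M w r"
  define D where "D = (\<lambda>a. perform a c) ` {a \<in> ?A. ?m c a \<noteq> 0}"
  have fA: "finite ?A" by (rule finite_actions[OF M])
  then have fD: "finite D" by (auto simp: D_def)
  have DC: "D \<subseteq> configs M w" using perform_in_configs[OF c(1)] c(2) by (auto simp: D_def)
  have "gram M w r c c' =
    (\<Sum>\<^sub>\<infinity>d\<in>D. cnj (evol M w r d c) * evol M w r d c')"
  proof (rule infsum_cong_neutral)
    fix d assume "d \<in> configs M w - D"
    then have "evol M w r d c = 0" unfolding evol_eq_amp[OF M]
      by (intro sum.neutral) (auto simp: D_def)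
    then show "cnj (evol M w r d c) * evol M w r d c' = 0" by simp
  qed (use DC in auto)
  also have "\<dots> = (\<Sum>d\<in>D. cnj (evol M w r d c) * evol M w r d c')" using fD by simp
  also have "\<dots> = (\<Sum>d\<in>D. \<Sum>a\<in>?A. \<Sum>a'\<in>?A. if perform a c = d \<and> perform a' c' = d
      then cnj (?m c a) * ?m c' a' else 0)"
    unfolding evol_eq_amp[OF M] cnj_sum sum_product
    by (intro sum.cong) auto
  also have "\<dots> = (\<Sum>a\<in>?A. \<Sum>a'\<in>?A. \<Sum>d\<in>D. if perform a c = d \<and> perform a' c' = d
      then cnj (?m c a) * ?m c' a' else 0)"
    by (subst sum.swap) (intro sum.cong refl sum.swap)
  also have "\<dots> = (\<Sum>a\<in>?A. \<Sum>a'\<in>?A. if perform a c = perform a' c'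
      then cnj (?m c a) * ?m c' a' else 0)"
  proof (intro sum.cong refl)
    fix a a' assume a: "a \<in> ?A" "a' \<in> ?A"
    show "(\<Sum>d\<in>D. if perform a c = d \<and> perform a' c' = d then cnj (?m c a) * ?m c' a' else 0) =
      (if perform a c = perform a' c' then cnj (?m c a) * ?m c' a' else 0)"
    proof (cases "?m c a = 0 \<or> perform a c \<noteq> perform a' c'")
      case True
      then show ?thesis by (auto intro!: sum.neutral)
    next
      case False
      then have "perform a c \<in> D" unfolding D_def using a by (intro imageI) auto
      moreover have "(\<Sum>d\<in>D. if perform a c = d \<and> perform a' c' = d then cnj (?m c a) * ?m c' a' else 0)
        = (\<Sum>d\<in>D. if perform a c = d then cnj (?m c a) * ?m c' a' else 0)"
        using False by (intro sum.cong) auto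
      ultimately show ?thesis using fD False by simp
    qed
  qed
  finally show ?thesis .
qed

lemma evol_apply_finite:
  assumes "finite S" "S \<subseteq> configs M w" "\<And>c. c \<notin> S \<Longrightarrow> \<psi> c = 0"
  shows "evol_apply M w r \<psi> d = (\<Sum>c\<in>S. evol M w r d c * \<psi> c)"
proof -
  have "evol_apply M w r \<psi> d = (\<Sum>\<^sub>\<infinity>c\<in>S. evol M w r d c * \<psi> c)"
    unfolding evol_apply_def by (rule infsum_cong_neutral) (use assms in auto)
  then show ?thesis using assms by simp
qed

lemma evol_apply_scale: "evol_apply M w r (\<lambda>c. z * \<psi> c) = (\<lambda>c. z * evol_apply M w r \<psi> c)"
  unfolding evol_apply_def
  by (simp add: infsum_cmult_right'[symmetric] mult.left_commute)

lemma fold_evol_apply_scale: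
  "fold (evol_apply M w) rs (\<lambda>c. z * \<psi> c) = (\<lambda>c. z * fold (evol_apply M w) rs \<psi> c)"
  by (induction rs arbitrary: \<psi>) (simp_all add: evol_apply_scale)

definition sqnorm :: "qtm_wom \<Rightarrow> nat list \<Rightarrow> superposition \<Rightarrow> real" where
  "sqnorm M w \<psi> = (\<Sum>\<^sub>\<infinity>c\<in>configs M w. (cmod (\<psi> c))\<^sup>2)"

lemma sqnorm_finite:
  assumes "finite S" "S \<subseteq> configs M w" "\<And>c. c \<notin> S \<Longrightarrow> \<psi> c = 0"
  shows "sqnorm M w \<psi> = (\<Sum>c\<in>S. (cmod (\<psi> c))\<^sup>2)"
proof -
  have "sqnorm M w \<psi> = (\<Sum>\<^sub>\<infinity>c\<in>S. (cmod (\<psi> c))\<^sup>2)"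
    unfolding sqnorm_def by (rule infsum_cong_neutral) (use assms in auto)
  then show ?thesis using assms by simp
qed

lemma sqnorm_scale: "sqnorm M w (\<lambda>c. z * \<psi> c) = (cmod z)\<^sup>2 * sqnorm M w \<psi>"
  unfolding sqnorm_def by (simp add: infsum_cmult_right'[symmetric] norm_mult power_mult_distrib)

lemma sqnorm_zero: "sqnorm M w (\<lambda>d. 0) = 0"
  by (simp add: sqnorm_def)

definition basis :: "config \<Rightarrow> superposition" where
  "basis c = (\<lambda>d. if d = c then 1 else 0)"

text \<open>Probability of accepting in exactly \<open>t + 1\<close> steps from the superposition \<open>\<psi>\<close>.\<close>

definition accept_at :: "qtm_wom \<Rightarrow> nat list \<Rightarrow> nat \<Rightarrow> superposition \<Rightarrow> real" where
  "accept_at M w t \<psi> = (\<Sum>rs | length rs = t \<and> set rs \<subseteq> continue_symbols M.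
     \<Sum>r\<in>accept_symbols M. sqnorm M w (fold (evol_apply M w) (rs @ [r]) \<psi>))"

lemma qtm_accept_prob_eq: "qtm_accept_prob M w = (\<Sum>t. accept_at M w t (basis (init_config M)))"
  unfolding qtm_accept_prob_def accept_at_def observation_prob_def evolved_def sqnorm_def basis_def
  by simp

lemma accept_at_0: "accept_at M w 0 \<psi> = (\<Sum>r\<in>accept_symbols M. sqnorm M w (evol_apply M w r \<psi>))"
proof -
  have "{rs. length rs = 0 \<and> set rs \<subseteq> continue_symbols M} = {[]}" by auto
  then show ?thesis by (simp add: accept_at_def)
qed

lemma accept_at_Suc:
  assumes "finite (continue_symbols M)"
  shows "accept_at M w (Suc t) \<psi> = (\<Sum>k\<in>continue_symbols M. accept_at M w t (evol_apply M w k \<psi>))"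
proof -
  let ?C = "continue_symbols M"
  let ?L = "\<lambda>t. {rs. length rs = t \<and> set rs \<subseteq> ?C}"
  let ?f = "\<lambda>rs. \<Sum>r\<in>accept_symbols M. sqnorm M w (fold (evol_apply M w) (rs @ [r]) \<psi>)"
  have "bij_betw (\<lambda>(k, rs). k # rs) (?C \<times> ?L t) (?L (Suc t))"
    by (rule bij_betw_byWitness[where f' = "\<lambda>rs. (hd rs, tl rs)"]) (auto simp: length_Suc_conv)
  then have "accept_at M w (Suc t) \<psi> = (\<Sum>(k, rs)\<in>?C \<times> ?L t. ?f (k # rs))"
    unfolding accept_at_def by (subst sum.reindex_bij_betw[symmetric]) (auto simp: case_prod_unfold)
  also have "\<dots> = (\<Sum>k\<in>?C. \<Sum>rs\<in>?L t. ?f (k # rs))"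
    by (rule sum.cartesian_product[symmetric])
  finally show ?thesis by (simp add: accept_at_def)
qed

lemma accept_at_scale: "accept_at M w t (\<lambda>c. z * \<psi> c) = (cmod z)\<^sup>2 * accept_at M w t \<psi>"
  unfolding accept_at_def fold_evol_apply_scale sqnorm_scale by (simp add: sum_distrib_left)

lemma accept_at_zero: "accept_at M w t (\<lambda>d. 0) = 0"
  using accept_at_scale[of M w t 0 "\<lambda>d. 0"] by simp

lemma evol_apply_basis:
  assumes "c \<in> configs M w"
  shows "evol_apply M w r (basis c) = (\<lambda>d. evol M w r d c)"
proof
  fix d
  show "evol_apply M w r (basis c) d = evol M w r d c"
    using evol_apply_finite[of "{c}" M w "basis c" r d] assms by (simp add: basis_def)
qed


section \<open>Acceptance probabilities of probabilistic machines\<close>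

definition same_core :: "config \<Rightarrow> config \<Rightarrow> bool" where
  "same_core c d \<longleftrightarrow> state c = state d \<and> input_pos c = input_pos d \<and> work_pos c = work_pos d \<and>
     work_tape c = work_tape d"

definition erase :: "action \<Rightarrow> action" where
  "erase a = a\<lparr>wom_write := None, wom_move := Stay\<rparr>"

lemma erase_simps [simp]:
  "new_state (erase a) = new_state a" "input_move (erase a) = input_move a"
  "work_write (erase a) = work_write a" "work_move (erase a) = work_move a"
  "wom_write (erase a) = None" "wom_move (erase a) = Stay"
  "stays_on_input x (erase a) = stays_on_input x a"
  by (simp_all add: erase_def stays_on_input_def)

lemma erase_in_actions: "a \<in> actions M \<Longrightarrow> erase a \<in> actions M"
  by (simp add: actions_def)

lemma same_core_perform: "same_core c d \<Longrightarrow> same_core (perform a c) (perform a d)"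
  by (simp add: same_core_def perform_def)

lemma same_core_perform_erase: "same_core c d \<Longrightarrow> same_core (perform a c) (perform (erase a) d)"
  by (simp add: same_core_def perform_def)

definition accept_within :: "ptm_wom \<Rightarrow> nat list \<Rightarrow> nat \<Rightarrow> config \<Rightarrow> real" where
  "accept_within M w t c = measure_pmf.prob (((\<lambda>p. bind_pmf p (ptm_step M w)) ^^ t) (return_pmf c))
     {d. state d = accept_state M}"

lemma ptm_accept_prob_eq: "ptm_accept_prob M w = (SUP t. accept_within M w t (init_config M))"
  by (simp add: ptm_accept_prob_def accept_within_def ptm_run_def)

lemma accept_within_0: "accept_within M w 0 c = of_bool (state c = accept_state M)"
  by (simp add: accept_within_def)

text \<open>\<open>ptm_run\<close> appends steps at the end, whereas the recursion for acceptance
  probabilities conditions on the first step; this passes from one view to the other.\<close>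

lemma funpow_bind_pmf:
  fixes f :: "'a \<Rightarrow> 'a pmf"
  shows "((\<lambda>p. bind_pmf p f) ^^ t) p = bind_pmf p (\<lambda>c. ((\<lambda>p. bind_pmf p f) ^^ t) (return_pmf c))"
proof (induction t)
  case 0
  show ?case by (simp add: bind_return_pmf')
next
  case (Suc t)
  show ?case unfolding funpow.simps o_def by (subst Suc.IH) (rule bind_assoc_pmf)
qed

lemma measure_bind_pmf:
  "measure_pmf.prob (bind_pmf p f) A = measure_pmf.expectation p (\<lambda>x. measure_pmf.prob (f x) A)"
proof -
  have "ennreal (measure_pmf.prob (bind_pmf p f) A) = (\<integral>\<^sup>+x. ennreal (measure_pmf.prob (f x) A) \<partial>p)"
    by (simp add: measure_pmf.emeasure_eq_measure[symmetric])
  also have "\<dots> = ennreal (measure_pmf.expectation p (\<lambda>x. measure_pmf.prob (f x) A))"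
    by (intro nn_integral_eq_integral measure_pmf.integrable_const_bound[where B = 1]) auto
  finally show ?thesis by (subst (asm) ennreal_inj) auto
qed

lemma accept_within_Suc':
  "accept_within M w (Suc t) c = measure_pmf.expectation (ptm_step M w c) (accept_within M w t)"
proof -
  have "((\<lambda>p. bind_pmf p (ptm_step M w)) ^^ Suc t) (return_pmf c) =
    ((\<lambda>p. bind_pmf p (ptm_step M w)) ^^ t) (ptm_step M w c)"
    unfolding funpow_Suc_right by (simp add: bind_return_pmf)
  also have "\<dots> = bind_pmf (ptm_step M w c) (\<lambda>c. ((\<lambda>p. bind_pmf p (ptm_step M w)) ^^ t) (return_pmf c))"
    by (rule funpow_bind_pmf)
  finally show ?thesis by (simp only: accept_within_def[abs_def] measure_bind_pmf)
qed

definition live :: "ptm_wom \<Rightarrow> config \<Rightarrow> bool" where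
  "live M c \<longleftrightarrow> state c \<notin> {accept_state M, reject_state M}"

definition choices :: "ptm_wom \<Rightarrow> nat list \<Rightarrow> config \<Rightarrow> action pmf" where
  "choices M w c = trans M (state c) (scanned w c) (work_symbol c)"

lemma set_choices:
  assumes "ptm_wom M" "w \<in> lists (alphabet M)" "c \<in> configs M w"
  shows "set_pmf (choices M w c) \<subseteq> {a \<in> actions M. stays_on_input (scanned w c) a}"
  using assms input_at_in_input_symbols[OF assms(2), of "input_pos c"]
  unfolding ptm_wom_def choices_def scanned_def work_symbol_def
  by (auto simp: configs_def image_subset_iff)

lemma ptm_path_snoc:
  assumes "ptm_path M w cs" "d \<in> set_pmf (ptm_step M w (last cs))"
  shows "ptm_path M w (cs @ [d])"
  unfolding ptm_path_def
proof (intro conjI allI impI)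
  have ne: "cs \<noteq> []" using assms by (simp add: ptm_path_def)
  fix i assume i: "Suc i < length (cs @ [d])"
  show "(cs @ [d]) ! Suc i \<in> set_pmf (ptm_step M w ((cs @ [d]) ! i))"
  proof (cases "Suc i = length cs")
    case True
    then have "i = length cs - 1" by simp
    then show ?thesis using assms(2) ne True by (simp add: nth_append last_conv_nth)
  next
    case False
    then show ?thesis using i assms(1) by (simp add: nth_append ptm_path_def)
  qed
qed (use assms in \<open>auto simp: ptm_path_def\<close>)

lemma ptm_path_induct [consumes 1, case_names init step]:
  assumes "ptm_path M w cs" "P [init_config M]"
    "\<And>cs d. ptm_path M w cs \<Longrightarrow> P cs \<Longrightarrow> d \<in> set_pmf (ptm_step M w (last cs)) \<Longrightarrow> P (cs @ [d])"
  shows "P cs"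
  using assms(1)
proof (induction cs rule: rev_induct)
  case (snoc d cs)
  show ?case
  proof (cases "cs = []")
    case True
    then show ?thesis using snoc.prems assms(2) by (simp add: ptm_path_def)
  next
    case False
    have "ptm_path M w cs" unfolding ptm_path_def
    proof (intro conjI allI impI)
      fix i assume "Suc i < length cs"
      then show "cs ! Suc i \<in> set_pmf (ptm_step M w (cs ! i))"
        using snoc.prems unfolding ptm_path_def
        by (elim conjE allE[of _ i]) (simp add: nth_append)
    qed (use snoc.prems False in \<open>auto simp: ptm_path_def\<close>)
    moreover have "d \<in> set_pmf (ptm_step M w (last cs))"
      using snoc.prems False unfolding ptm_path_def
      by (elim conjE allE[of _ "length cs - 1"]) (simp add: nth_append last_conv_nth)
    ultimately show ?thesis using snoc.IH assms(3) by blast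
  qed
qed (simp add: ptm_path_def)

lemma ptm_path_last_in_configs:
  assumes "ptm_wom M" "w \<in> lists (alphabet M)" "ptm_path M w cs"
  shows "last cs \<in> configs M w"
  using assms(3)
proof (induction rule: ptm_path_induct)
  case init
  show ?case using assms(1) by (simp add: init_config_in_configs ptm_wom_def)
next
  case (step cs d)
  show ?case
  proof (cases "live M (last cs)")
    case True
    then obtain a where a: "a \<in> set_pmf (choices M w (last cs))" "d = perform a (last cs)"
      using step by (auto simp: ptm_step_def live_def choices_def scanned_def work_symbol_def)
    then show ?thesis using set_choices[OF assms(1,2) step.IH] step.IH by (auto intro: perform_in_configs)
  next
    case False
    then show ?thesis using step by (simp add: ptm_step_def live_def)
  qed
qed

lemma accept_within_halted:
  "\<not> live M c \<Longrightarrow> accept_within M w t c = of_bool (state c = accept_state M)"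
  by (induction t) (auto simp: accept_within_0 accept_within_Suc' ptm_step_def live_def)

lemma accept_within_Suc:
  assumes "ptm_wom M" "w \<in> lists (alphabet M)" "c \<in> configs M w" "live M c"
  shows "accept_within M w (Suc t) c =
    (\<Sum>a\<in>actions M. pmf (choices M w c) a * accept_within M w t (perform a c))"
proof -
  have fA: "finite (actions M)" using assms by (intro finite_actions) (simp add: ptm_wom_def)
  have "accept_within M w (Suc t) c =
    measure_pmf.expectation (choices M w c) (\<lambda>a. accept_within M w t (perform a c))"
    using assms(4) unfolding accept_within_Suc'
    by (simp add: ptm_step_def live_def choices_def scanned_def work_symbol_def)
  also have "\<dots> = (\<Sum>a\<in>actions M. pmf (choices M w c) a * accept_within M w t (perform a c))"
    using set_choices[OF assms(1-3)] by (subst integral_measure_pmf[OF fA]) auto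
  finally show ?thesis .
qed

lemma accept_within_range: "0 \<le> accept_within M w t c" "accept_within M w t c \<le> 1"
  by (simp_all add: accept_within_def)

lemma choices_same_core: "same_core c d \<Longrightarrow> choices M w c = choices M w d"
  by (simp add: same_core_def choices_def scanned_def work_symbol_def)

text \<open>Transitions read neither the WOM nor its head position, and equal actions keep the other
  components equal. This is the precise sense in which the WOM does not help a probabilistic
  machine.\<close>

lemma accept_within_same_core:
  assumes "ptm_wom M" "w \<in> lists (alphabet M)" "c \<in> configs M w" "d \<in> configs M w" "same_core c d"
  shows "accept_within M w t c = accept_within M w t d"
  using assms(3-5)
proof (induction t arbitrary: c d)
  case 0
  then show ?case by (simp add: accept_within_0 same_core_def)
next
  case (Suc t)
  show ?case
  proof (cases "live M c")
    case False
    then have "\<not> live M d" using Suc.prems by (simp add: live_def same_core_def)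
    then show ?thesis using False Suc.prems by (simp add: accept_within_halted same_core_def)
  next
    case True
    then have l: "live M d" using Suc.prems by (simp add: live_def same_core_def)
    have e: "choices M w c = choices M w d" "scanned w c = scanned w d"
      using Suc.prems(3) choices_same_core[OF Suc.prems(3)] by (auto simp: same_core_def scanned_def)
    show ?thesis
      unfolding accept_within_Suc[OF assms(1,2) Suc.prems(1) True]
        accept_within_Suc[OF assms(1,2) Suc.prems(2) l] e(1)
    proof (intro sum.cong refl)
      fix a assume a: "a \<in> actions M"
      show "pmf (choices M w d) a * accept_within M w t (perform a c) =
        pmf (choices M w d) a * accept_within M w t (perform a d)"
      proof (cases "a \<in> set_pmf (choices M w d)")
        case True
        then have "stays_on_input (scanned w d) a"
          using set_choices[OF assms(1,2) Suc.prems(2)] by auto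
        then have "accept_within M w t (perform a c) = accept_within M w t (perform a d)"
          using e(2) by (intro Suc.IH perform_in_configs same_core_perform Suc.prems a) simp_all
        then show ?thesis by simp
      qed (simp add: set_pmf_iff)
    qed
  qed
qed

lemma accept_within_mono_Suc:
  assumes "ptm_wom M" "w \<in> lists (alphabet M)" "c \<in> configs M w"
  shows "accept_within M w t c \<le> accept_within M w (Suc t) c"
  using assms(3)
proof (induction t arbitrary: c)
  case 0
  show ?case
    by (cases "live M c")
      (auto simp: accept_within_0 accept_within_halted accept_within_range live_def)
next
  case (Suc t)
  show ?case
  proof (cases "live M c")
    case True
    show ?thesis
      unfolding accept_within_Suc[OF assms(1,2) Suc.prems True]
    proof (intro sum_mono)
      fix a assume a: "a \<in> actions M"
      show "pmf (choices M w c) a * accept_within M w t (perform a c) \<le>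
        pmf (choices M w c) a * accept_within M w (Suc t) (perform a c)"
      proof (cases "a \<in> set_pmf (choices M w c)")
        case True
        then have "perform a c \<in> configs M w"
          using set_choices[OF assms(1,2) Suc.prems] Suc.prems a by (intro perform_in_configs) auto
        then show ?thesis by (intro mult_left_mono Suc.IH) auto
      qed (simp add: set_pmf_iff)
    qed
  qed (simp add: accept_within_halted)
qed

section \<open>The quantum machine that simulates a probabilistic one\<close>

definition halting_choice :: "nat \<Rightarrow> nat \<Rightarrow> action" where
  "halting_choice q g = \<lparr>new_state = q, input_move = Stay, work_write = g, work_move = Stay,
     wom_write = None, wom_move = Stay\<rparr>"

text \<open>The quantum machine makes one more step after reaching a halting state, in order to
  announce the verdict in the register. With the dummy action this step leaves the core in place and
  uses no further space.\<close>

definition total_choices :: "ptm_wom \<Rightarrow> nat \<Rightarrow> input_symbol \<Rightarrow> nat \<Rightarrow> action pmf" where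
  "total_choices M q x g =
     (if q \<in> {accept_state M, reject_state M} then return_pmf (halting_choice q g) else trans M q x g)"

definition records :: "ptm_wom \<Rightarrow> (nat \<times> nat \<times> action) set" where
  "records M = states M \<times> work_symbols M \<times> actions M"

text \<open>
  The register records the old state, the overwritten work symbol and the action, which makes
  the evolution reversible; \<open>h\<close> encodes these records as numbers. The WOM is left untouched,
  since what is written on it could not be recovered.
\<close>

definition simulation :: "ptm_wom \<Rightarrow> (nat \<times> nat \<times> action \<Rightarrow> nat) \<Rightarrow> qtm_wom" where
  "simulation M h = \<lparr>alphabet = alphabet M, states = states M, init_state = init_state M,
     work_symbols = work_symbols M, wom_symbols = wom_symbols M,
     accept_symbols = h ` {z \<in> records M. fst z = accept_state M},
     reject_symbols = h ` {z \<in> records M. fst z = reject_state M},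
     continue_symbols = h ` {z \<in> records M. fst z \<notin> {accept_state M, reject_state M}},
     ampl = (\<lambda>q x g a r. \<Sum>b\<in>actions M. if r = h (q, g, b) \<and> a = erase b
       then complex_of_real (sqrt (pmf (total_choices M q x g) b)) else 0)\<rparr>"

locale ptm_simulation =
  fixes M :: ptm_wom and h :: "nat \<times> nat \<times> action \<Rightarrow> nat"
  assumes ptm: "ptm_wom M" and inj_h: "inj_on h (records M)"
begin

abbreviation "Q \<equiv> simulation M h"

abbreviation "all_choices w c \<equiv> total_choices M (state c) (scanned w c) (work_symbol c)"

abbreviation "weight q g b x \<equiv> complex_of_real (sqrt (pmf (total_choices M q x g) b))"

lemma machine_ok_M: "machine_ok M"
  using ptm by (simp add: ptm_wom_def)

lemma fin_act: "finite (actions M)"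
  by (rule finite_actions[OF machine_ok_M])

lemma machine_ok_Q: "machine_ok Q"
  using machine_ok_M by (simp add: machine_ok_def simulation_def)

lemma same_components [simp]: "actions Q = actions M" "configs Q w = configs M w"
  "init_config Q = init_config M" "input_symbols Q = input_symbols M" "alphabet Q = alphabet M"
  "states Q = states M" "work_symbols Q = work_symbols M"
  by (simp_all add: simulation_def actions_def configs_def init_config_def input_symbols_def)

lemma register_Q: "register Q = h ` records M"
  unfolding register_def by (auto simp: simulation_def)

lemma finite_records: "finite (records M)"
  unfolding records_def using machine_ok_M fin_act
  by (intro finite_cartesian_product) (auto simp: machine_ok_def)

lemma set_total_choices:
  assumes "q \<in> states M" "x \<in> input_symbols M" "g \<in> work_symbols M"
  shows "set_pmf (total_choices M q x g) \<subseteq> {a \<in> actions M. stays_on_input x a}"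
  using assms ptm by (auto simp: total_choices_def ptm_wom_def actions_def halting_choice_def stays_on_input_def)

lemma ampl_Q:
  assumes "(q, g, b) \<in> records M" "q' \<in> states M" "g' \<in> work_symbols M"
  shows "ampl Q q' x g' a (h (q, g, b)) = (if q' = q \<and> g' = g \<and> a = erase b
    then weight q g b x else 0)"
proof -
  have "h (q, g, b) = h (q', g', b') \<longleftrightarrow> q = q' \<and> g = g' \<and> b = b'" if "b' \<in> actions M" for b'
    using that assms inj_on_eq_iff[OF inj_h assms(1), of "(q', g', b')"] by (auto simp: records_def)
  then have "ampl Q q' x g' a (h (q, g, b)) = (\<Sum>b'\<in>actions M. if b = b' then
    (if q' = q \<and> g' = g \<and> a = erase b
    then weight q g b x else 0) else 0)"
    unfolding simulation_def qtm_wom.simps by (intro sum.cong refl) auto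
  then show ?thesis using assms(1) fin_act by (simp add: records_def)
qed

lemma amp_Q:
  assumes "(q, g, b) \<in> records M" "c \<in> configs M w"
  shows "amp Q w (h (q, g, b)) c a = (if state c = q \<and> work_symbol c = g \<and> a = erase b
    then weight q g b (scanned w c) else 0)"
  using assms unfolding amp_def by (subst ampl_Q) (auto simp: configs_def work_symbol_def)

context
  fixes w assumes w: "w \<in> lists (alphabet M)"
begin

lemma total_choices_config:
  assumes "c \<in> configs M w"
  shows "set_pmf (all_choices w c) \<subseteq>
    {a \<in> actions M. stays_on_input (scanned w c) a}"
  using assms input_at_in_input_symbols[OF w, of "input_pos c"]
  by (intro set_total_choices) (auto simp: configs_def scanned_def work_symbol_def)

lemma sum_total_choices:
  assumes "c \<in> configs M w"
  shows "(\<Sum>b\<in>actions M. pmf (all_choices w c) b) = 1"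
  using total_choices_config[OF assms] fin_act by (intro sum_pmf_eq_1) auto

text \<open>A register symbol fixes the old state, the old work symbol and the action. By
  \<open>perform_inj\<close> no two configurations that fit it have the same successor, so the
  matrix is diagonal, with transition probabilities as squares of the amplitudes.\<close>

lemma evol_inner_Q:
  assumes z: "(q, g, b) \<in> records M" and c: "c \<in> configs M w" "c' \<in> configs M w"
  shows "gram Q w (h (q, g, b)) c c' =
    (if c = c' \<and> state c = q \<and> work_symbol c = g
     then complex_of_real (pmf (total_choices M q (scanned w c) g) b) else 0)"
proof -
  let ?p = "\<lambda>c. weight q g b (scanned w c)"
  have st: "stays_on_input (scanned w c) a" if "c \<in> configs M w" "amp Q w (h (q, g, b)) c a \<noteq> 0" for a c
  proof -
    have "state c = q" "work_symbol c = g" "a = erase b" "?p c \<noteq> 0"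
      using that unfolding amp_Q[OF z that(1)] by (auto split: if_splits)
    then show ?thesis using total_choices_config[OF that(1)] by (auto simp: pmf_eq_0_set_pmf)
  qed
  have b: "erase b \<in> actions M" using z by (auto simp: records_def intro: erase_in_actions)
  have "gram Q w (h (q, g, b)) c c' =
    (\<Sum>a\<in>actions M. \<Sum>a'\<in>actions M. if perform a c = perform a' c'
      then cnj (amp Q w (h (q, g, b)) c a) * amp Q w (h (q, g, b)) c' a' else 0)"
    using evol_inner[OF machine_ok_Q, of c w "h (q, g, b)" c'] c st by simp
  also have "\<dots> = (\<Sum>a\<in>actions M. \<Sum>a'\<in>actions M. if a = erase b \<and> a' = erase b \<and>
      perform (erase b) c = perform (erase b) c' \<and> state c = q \<and> work_symbol c = g \<and>
      state c' = q \<and> work_symbol c' = g then ?p c * ?p c' else 0)"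
    unfolding amp_Q[OF z c(1)] amp_Q[OF z c(2)] by (intro sum.cong) auto
  also have "\<dots> = (if perform (erase b) c = perform (erase b) c' \<and> state c = q \<and> work_symbol c = g \<and>
      state c' = q \<and> work_symbol c' = g then ?p c * ?p c' else 0)"
    (is "?l = (if ?P then ?z else 0)")
  proof -
    have "?l = (\<Sum>a\<in>actions M. if a = erase b then
        (\<Sum>a'\<in>actions M. if a' = erase b then (if ?P then ?z else 0) else 0) else 0)"
      by (intro sum.cong refl) (auto intro: sum.neutral)
    then show ?thesis using b fin_act by simp
  qed
  also have "\<dots> = (if c = c' \<and> state c = q \<and> work_symbol c = g
     then complex_of_real (pmf (total_choices M q (scanned w c) g) b) else 0)"
  proof (cases "c = c'")
    case True
    then show ?thesis by (auto simp flip: of_real_mult)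
  next
    case False
    have "?p c * ?p c' = 0" if e: "perform (erase b) c = perform (erase b) c'" "state c = q"
      "work_symbol c = g" "state c' = q" "work_symbol c' = g"
    proof (rule ccontr)
      assume "?p c * ?p c' \<noteq> 0"
      then have "stays_on_input (scanned w c) (erase b)" "stays_on_input (scanned w c') (erase b)"
        using st[OF c(1), of "erase b"] st[OF c(2), of "erase b"] e
        unfolding amp_Q[OF z c(1)] amp_Q[OF z c(2)] by auto
      then show False using perform_inj[of "erase b" c c' w] e c False by (auto simp: configs_def)
    qed
    then show ?thesis using False by auto
  qed
  finally show ?thesis .
qed

lemma evol_Q:
  assumes "(q, g, b) \<in> records M" "c \<in> configs M w"
  shows "evol Q w (h (q, g, b)) d c = (if state c = q \<and> work_symbol c = g \<and> d = perform (erase b) c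
    then weight q g b (scanned w c) else 0)"
proof -
  have "evol Q w (h (q, g, b)) d c = (\<Sum>a\<in>actions M. if a = erase b then
    (if state c = q \<and> work_symbol c = g \<and> d = perform (erase b) c
    then weight q g b (scanned w c) else 0) else 0)"
    unfolding evol_eq_amp[OF machine_ok_Q] amp_Q[OF assms] same_components(1) by (intro sum.cong refl) auto
  then show ?thesis using assms(1) fin_act erase_in_actions by (auto simp: records_def)
qed

text \<open>Observing the register leaves a multiple of a single basis vector, so there is no
  interference and probabilities evolve classically.\<close>

lemma evol_apply_Q:
  assumes "(q, g, b) \<in> records M" "c \<in> configs M w"
  shows "evol_apply Q w (h (q, g, b)) (basis c) = (\<lambda>d. (if state c = q \<and> work_symbol c = g
    then weight q g b (scanned w c) else 0) *
    basis (perform (erase b) c) d)"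
  using assms by (simp add: evol_apply_basis evol_Q) (auto simp: basis_def fun_eq_iff)

lemma sum_records:
  fixes f :: "nat \<Rightarrow> nat \<Rightarrow> action \<Rightarrow> 'a::comm_monoid_add"
  assumes "c \<in> configs M w"
  shows "(\<Sum>(q, g, b)\<in>{z \<in> records M. P (fst z)}. if state c = q \<and> work_symbol c = g then f q g b else 0) =
    (if P (state c) then \<Sum>b\<in>actions M. f (state c) (work_symbol c) b else 0)"
proof -
  have mem: "(state c, work_symbol c, b) \<in> records M \<longleftrightarrow> b \<in> actions M" for b
    using assms by (auto simp: records_def configs_def work_symbol_def)
  let ?S = "{z \<in> records M. P (fst z)}"
  let ?T = "(\<lambda>b. (state c, work_symbol c, b)) ` (if P (state c) then actions M else {})"
  have "(\<Sum>(q, g, b)\<in>?S. if state c = q \<and> work_symbol c = g then f q g b else 0) =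
    (\<Sum>(q, g, b)\<in>?T. f q g b)"
    by (rule sum.mono_neutral_cong_right) (use finite_records mem in \<open>auto split: if_splits\<close>)
  also have "\<dots> = (\<Sum>b\<in>(if P (state c) then actions M else {}). f (state c) (work_symbol c) b)"
    by (subst sum.reindex) (auto simp: inj_on_def)
  finally show ?thesis by simp
qed

lemma sqnorm_basis: "c \<in> configs M w \<Longrightarrow> sqnorm Q w (basis c) = 1"
  by (subst sqnorm_finite[of "{c}"]) (auto simp: basis_def)

lemma perform_erase_in_configs:
  assumes "c \<in> configs M w" "b \<in> actions M"
    "pmf (all_choices w c) b \<noteq> 0"
  shows "perform (erase b) c \<in> configs M w"
  using assms total_choices_config[OF assms(1)]
  by (intro perform_in_configs erase_in_actions) (auto simp: set_pmf_iff)

text \<open>An accept symbol records a step out of the accept state, so acceptance is announced one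
  step after this state has been entered. The probabilities of all such steps add up to 1.\<close>

lemma accept_at_Q_0:
  assumes "c \<in> configs M w"
  shows "accept_at Q w 0 (basis c) = of_bool (state c = accept_state M)"
proof -
  let ?S = "{z \<in> records M. fst z = accept_state M}"
  have "accept_at Q w 0 (basis c) = (\<Sum>z\<in>?S. sqnorm Q w (evol_apply Q w (h z) (basis c)))"
    unfolding accept_at_0
    by (simp add: simulation_def sum.reindex inj_on_subset[OF inj_h])
  also have "\<dots> = (\<Sum>(q, g, b)\<in>?S. if state c = q \<and> work_symbol c = g then
    pmf (total_choices M q (scanned w c) g) b * sqnorm Q w (basis (perform (erase b) c)) else 0)"
    by (intro sum.cong refl) (auto simp: evol_apply_Q assms sqnorm_scale sqnorm_zero)
  also have "\<dots> = (if state c = accept_state M then \<Sum>b\<in>actions M.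
    pmf (all_choices w c) b * sqnorm Q w (basis (perform (erase b) c)) else 0)"
    by (rule sum_records[OF assms, where P = "\<lambda>q. q = accept_state M" and f = "\<lambda>q g b.
      pmf (total_choices M q (scanned w c) g) b * sqnorm Q w (basis (perform (erase b) c))"])
  also have "(\<Sum>b\<in>actions M. pmf (all_choices w c) b *
      sqnorm Q w (basis (perform (erase b) c))) =
    (\<Sum>b\<in>actions M. pmf (all_choices w c) b)"
  proof (intro sum.cong refl)
    fix b assume b: "b \<in> actions M"
    let ?p = "pmf (all_choices w c) b"
    show "?p * sqnorm Q w (basis (perform (erase b) c)) = ?p"
      using sqnorm_basis[OF perform_erase_in_configs[OF assms b]] by (cases "?p = 0") auto
  qed
  finally show ?thesis unfolding sum_total_choices[OF assms] by simp
qed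

lemma accept_at_Q_Suc:
  assumes "c \<in> configs M w"
  shows "accept_at Q w (Suc t) (basis c) = (if live M c then
    \<Sum>b\<in>actions M. pmf (choices M w c) b * accept_at Q w t (basis (perform (erase b) c)) else 0)"
proof -
  let ?S = "{z \<in> records M. fst z \<notin> {accept_state M, reject_state M}}"
  have fin: "finite (continue_symbols Q)" using finite_records by (simp add: simulation_def)
  have "accept_at Q w (Suc t) (basis c) = (\<Sum>z\<in>?S. accept_at Q w t (evol_apply Q w (h z) (basis c)))"
    unfolding accept_at_Suc[OF fin]
    by (simp add: simulation_def sum.reindex inj_on_subset[OF inj_h])
  also have "\<dots> = (\<Sum>(q, g, b)\<in>?S. if state c = q \<and> work_symbol c = g then
    pmf (total_choices M q (scanned w c) g) b * accept_at Q w t (basis (perform (erase b) c)) else 0)"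
    by (intro sum.cong refl) (auto simp: evol_apply_Q assms accept_at_scale accept_at_zero)
  also have "\<dots> = (if state c \<notin> {accept_state M, reject_state M} then \<Sum>b\<in>actions M.
    pmf (all_choices w c) b *
      accept_at Q w t (basis (perform (erase b) c)) else 0)"
    by (rule sum_records[OF assms, where P = "\<lambda>q. q \<notin> {accept_state M, reject_state M}" and
      f = "\<lambda>q g b. pmf (total_choices M q (scanned w c) g) b *
        accept_at Q w t (basis (perform (erase b) c))"])
  finally show ?thesis by (auto simp: live_def choices_def total_choices_def)
qed

text \<open>Due to the announcing step, \<open>t\<close> steps of the probabilistic machine
  correspond to \<open>t + 1\<close> quantum steps, that is, to the indices \<open>i \<le> t\<close>
  of \<open>accept_at\<close>. The simulation performs \<open>erase b\<close> in place of
  \<open>b\<close>; the values agree because the WOM does not influence acceptance.\<close>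

lemma accept_within_eq_sum:
  assumes "c \<in> configs M w"
  shows "(\<Sum>i\<le>t. accept_at Q w i (basis c)) = accept_within M w t c"
  using assms
proof (induction t arbitrary: c)
  case 0
  then show ?case by (simp add: accept_at_Q_0 accept_within_0)
next
  case (Suc t)
  show ?case
  proof (cases "live M c")
    case False
    then have "accept_at Q w (Suc i) (basis c) = 0" for i using Suc.prems by (simp add: accept_at_Q_Suc)
    then show ?thesis using False Suc.prems
      by (simp add: sum.atMost_Suc_shift accept_at_Q_0 accept_within_halted del: sum.atMost_Suc)
  next
    case True
    have "(\<Sum>i\<le>Suc t. accept_at Q w i (basis c)) = (\<Sum>i\<le>t. accept_at Q w (Suc i) (basis c))"
      using True Suc.prems
      by (simp add: sum.atMost_Suc_shift accept_at_Q_0 live_def del: sum.atMost_Suc)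
    also have "\<dots> = (\<Sum>b\<in>actions M. pmf (choices M w c) b *
        (\<Sum>i\<le>t. accept_at Q w i (basis (perform (erase b) c))))"
      using True Suc.prems
      by (simp add: accept_at_Q_Suc sum_distrib_left sum.swap[of _ "actions M"])
    also have "\<dots> = (\<Sum>b\<in>actions M. pmf (choices M w c) b * accept_within M w t (perform b c))"
    proof (intro sum.cong refl)
      fix b assume b: "b \<in> actions M"
      show "pmf (choices M w c) b * (\<Sum>i\<le>t. accept_at Q w i (basis (perform (erase b) c))) =
        pmf (choices M w c) b * accept_within M w t (perform b c)"
      proof (cases "b \<in> set_pmf (choices M w c)")
        case True
        then have s: "stays_on_input (scanned w c) b" using set_choices[OF ptm w Suc.prems] by auto
        have *: "perform b c \<in> configs M w" "perform (erase b) c \<in> configs M w"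
          using s b Suc.prems by (auto intro: perform_in_configs erase_in_actions)
        have "same_core (perform (erase b) c) (perform b c)" by (simp add: same_core_def perform_def)
        then have "accept_within M w t (perform (erase b) c) = accept_within M w t (perform b c)"
          using * by (intro accept_within_same_core[OF ptm w])
        then show ?thesis using Suc.IH[OF *(2)] by simp
      qed (simp add: set_pmf_iff)
    qed
    also have "\<dots> = accept_within M w (Suc t) c"
      using accept_within_Suc[OF ptm w Suc.prems True] by simp
    finally show ?thesis .
  qed
qed

lemma qtm_accept_prob_Q: "qtm_accept_prob Q w = ptm_accept_prob M w"
proof -
  let ?c = "init_config M"
  have c: "?c \<in> configs M w" by (rule init_config_in_configs[OF machine_ok_M])
  have "(\<lambda>t. accept_within M w t ?c) \<longlonglongrightarrow> (SUP t. accept_within M w t ?c)"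
    using accept_within_mono_Suc[OF ptm w c] accept_within_range
    by (intro LIMSEQ_incseq_SUP incseq_SucI bdd_aboveI[of _ 1]) auto
  then have "(\<lambda>t. accept_at Q w t (basis ?c)) sums (SUP t. accept_within M w t ?c)"
    unfolding sums_def_le accept_within_eq_sum[OF c] .
  then show ?thesis by (simp add: qtm_accept_prob_eq ptm_accept_prob_eq sums_iff)
qed

lemma evol_Q_step:
  assumes "r \<in> register Q" "evol Q w r d c \<noteq> 0" "same_core c' c" "c \<in> configs M w" "c' \<in> configs M w"
  shows "\<exists>d'\<in>set_pmf (ptm_step M w c'). same_core d' d \<and> d \<in> configs M w \<and> d' \<in> configs M w"
proof -
  obtain q g b where z: "(q, g, b) \<in> records M" "r = h (q, g, b)" using assms(1) register_Q by auto
  have e: "state c = q" "work_symbol c = g" "d = perform (erase b) c"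
    "pmf (total_choices M q (scanned w c) g) b \<noteq> 0"
    using assms(2) unfolding z(2) evol_Q[OF z(1) assms(4)] by (auto split: if_splits)
  have b: "b \<in> actions M" using z by (simp add: records_def)
  have d: "d \<in> configs M w" using perform_erase_in_configs[OF assms(4) b] e by simp
  have c: "choices M w c' = choices M w c" "scanned w c' = scanned w c"
    using assms(3) choices_same_core[OF assms(3)] by (auto simp: same_core_def scanned_def)
  show ?thesis
  proof (cases "live M c")
    case True
    then have "b \<in> set_pmf (choices M w c')"
      using e unfolding c by (auto simp: live_def total_choices_def choices_def set_pmf_iff)
    moreover have "live M c'" using True assms(3) by (simp add: live_def same_core_def)
    ultimately have "perform b c' \<in> set_pmf (ptm_step M w c')"
      by (simp add: ptm_step_def live_def choices_def scanned_def work_symbol_def)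
    moreover have "perform b c' \<in> configs M w"
      using set_choices[OF ptm w assms(5)] \<open>b \<in> set_pmf (choices M w c')\<close> b assms(5)
      by (intro perform_in_configs) auto
    moreover have "same_core (perform b c') d" using assms(3) e by (auto intro: same_core_perform_erase)
    ultimately show ?thesis using d by blast
  next
    case False
    \<comment> \<open>The announcing step is matched by the probabilistic machine staying in its
      halted configuration.\<close>
    then have "b = halting_choice q g"
      using e by (auto simp: live_def total_choices_def indicator_def split: if_splits)
    then have "same_core c' d"
      using e assms(3) by (auto simp: same_core_def halting_choice_def perform_def work_symbol_def)
    moreover have "ptm_step M w c' = return_pmf c'"
      using False assms(3) by (simp add: ptm_step_def live_def same_core_def)
    ultimately show ?thesis using d assms by auto
  qed
qed

text \<open>The two paths run in lockstep and differ at most on the WOM; since their work head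
  positions agree, so does the space used.\<close>

lemma ptm_path_of_qtm_path:
  assumes "successively (\<lambda>c d. \<exists>r\<in>register Q. evol Q w r d c \<noteq> 0) cs" "cs \<noteq> []"
    "hd cs = init_config M"
  shows "\<exists>cs'. ptm_path M w cs' \<and> list_all2 same_core cs' cs \<and> last cs \<in> configs M w \<and>
    last cs' \<in> configs M w"
  using assms
proof (induction cs rule: rev_induct)
  case (snoc d cs)
  show ?case
  proof (cases "cs = []")
    case True
    then show ?thesis using snoc.prems init_config_in_configs[OF machine_ok_M]
      by (intro exI[of _ "[init_config M]"]) (auto simp: ptm_path_def same_core_def)
  next
    case False
    have s: "successively (\<lambda>c d. \<exists>r\<in>register Q. evol Q w r d c \<noteq> 0) cs"
      "\<exists>r\<in>register Q. evol Q w r d (last cs) \<noteq> 0"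
      using snoc.prems(1) False by (auto simp: successively_append_iff)
    then obtain cs' where cs': "ptm_path M w cs'" "list_all2 same_core cs' cs"
      "last cs \<in> configs M w" "last cs' \<in> configs M w"
      using snoc.IH snoc.prems False by auto
    have ne: "cs' \<noteq> []" using cs'(1) by (simp add: ptm_path_def)
    have "same_core (last cs') (last cs)"
      using cs'(2) ne False list_all2_nthD[OF cs'(2), of "length cs' - 1"]
      by (simp add: last_conv_nth list_all2_lengthD)
    then obtain d' where d': "d' \<in> set_pmf (ptm_step M w (last cs'))" "same_core d' d"
      "d \<in> configs M w" "d' \<in> configs M w"
      using s(2) evol_Q_step cs'(3,4) by blast
    have "ptm_path M w (cs' @ [d'])" using cs'(1) d'(1) by (rule ptm_path_snoc)
    then show ?thesis using d' cs'(2)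
      by (intro exI[of _ "cs' @ [d']"]) (auto intro: list_all2_appendI)
  qed
qed simp

lemma space_Q:
  assumes "qtm_path Q w cs"
  shows "\<exists>cs'. ptm_path M w cs' \<and> work_pos ` set cs' = work_pos ` set cs"
proof -
  have "successively (\<lambda>c d. \<exists>r\<in>register Q. evol Q w r d c \<noteq> 0) cs"
    unfolding successively_conv_nth
  proof (intro allI impI)
    fix i assume "Suc i < length cs"
    then obtain r where "r \<in> (if Suc (Suc i) < length cs then continue_symbols Q else register Q)"
      "evol Q w r (cs ! Suc i) (cs ! i) \<noteq> 0"
      using assms unfolding qtm_path_def by blast
    then show "\<exists>r\<in>register Q. evol Q w r (cs ! Suc i) (cs ! i) \<noteq> 0"
      by (auto simp: register_def split: if_splits)
  qed
  then obtain cs' where "ptm_path M w cs'" "list_all2 same_core cs' cs"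
    using ptm_path_of_qtm_path[of cs] assms by (auto simp: qtm_path_def)
  moreover from this(2) have "map work_pos cs' = map work_pos cs"
    by (induction rule: list_all2_induct) (auto simp: same_core_def)
  then have "work_pos ` set cs' = work_pos ` set cs" by (metis list.set_map)
  ultimately show ?thesis by blast
qed

end

lemma well_formed_Q: "well_formed Q"
  unfolding well_formed_def
proof (intro ballI)
  fix w c c' assume "w \<in> lists (alphabet Q)" "c \<in> configs Q w" "c' \<in> configs Q w"
  then have w: "w \<in> lists (alphabet M)" and c: "c \<in> configs M w" "c' \<in> configs M w" by auto
  have "(\<Sum>r\<in>register Q. gram Q w r c c') =
    (\<Sum>z\<in>records M. gram Q w (h z) c c')"
    unfolding register_Q by (simp add: sum.reindex[OF inj_h])
  also have "\<dots> = (\<Sum>(q, g, b)\<in>{z \<in> records M. True}. if state c = q \<and> work_symbol c = g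
     then if c = c' then complex_of_real (pmf (total_choices M q (scanned w c) g) b) else 0 else 0)"
    by (intro sum.cong) (auto simp: evol_inner_Q[OF w _ c, unfolded same_components])
  also have "\<dots> = (if True then \<Sum>b\<in>actions M. if c = c' then complex_of_real
      (pmf (all_choices w c) b) else 0 else 0)"
    by (rule sum_records[OF w c(1), where P = "\<lambda>_. True"
      and f = "\<lambda>q g b. if c = c' then complex_of_real (pmf (total_choices M q (scanned w c) g) b) else 0"])
  also have "\<dots> = (if c = c' then 1 else 0)"
  proof (cases "c = c'")
    case True
    have "(\<Sum>b\<in>actions M. complex_of_real (pmf (all_choices w c) b)) = 1"
      unfolding of_real_sum[symmetric] sum_total_choices[OF w c(1)] by simp
    then show ?thesis unfolding True by simp
  qed simp
  finally show "(\<Sum>r\<in>register Q. gram Q w r c c') =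
    (if c = c' then 1 else 0)" .
qed

lemma qtm_wom_Q: "qtm_wom Q"
proof -
  have eff: "eff_computable (ampl Q q x g a r) \<and> (\<not> stays_on_input x a \<longrightarrow> ampl Q q x g a r = 0)"
    if qxg: "q \<in> states M" "x \<in> input_symbols M" "g \<in> work_symbols M" and r: "r \<in> register Q" for q x g a r
  proof -
    obtain q' g' b where z: "(q', g', b) \<in> records M" "r = h (q', g', b)" using r register_Q by auto
    have z0: "eff_computable_real 0" using eff_computable_real_rat[of 1 0 0] by simp
    have z1: "eff_computable_real 1" using eff_computable_real_rat[of 1 1 0] by simp
    have "eff_computable_real (pmf (total_choices M q x g) b)"
    proof (cases "q \<in> {accept_state M, reject_state M}")
      case True
      then show ?thesis using z0 z1 by (simp add: total_choices_def pmf_return indicator_def)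
    next
      case False
      then show ?thesis using ptm qxg by (simp add: total_choices_def ptm_wom_def)
    qed
    then have "eff_computable_real (sqrt (pmf (total_choices M q x g) b))"
      by (rule eff_computable_real_sqrt) (auto simp: pmf_le_1)
    then have "eff_computable (ampl Q q x g a r)"
      unfolding z(2) ampl_Q[OF z(1) qxg(1,3)] using z0 by (auto simp: eff_computable_def)
    moreover have "ampl Q q x g a r = 0" if "\<not> stays_on_input x a"
      using that set_total_choices[OF qxg] unfolding z(2) ampl_Q[OF z(1) qxg(1,3)]
      by (auto simp: pmf_eq_0_set_pmf)
    ultimately show ?thesis by blast
  qed
  have disj: "h ` A \<inter> h ` B = {}" if "A \<subseteq> records M" "B \<subseteq> records M" "A \<inter> B = {}" for A B
    using inj_on_image_Int[OF inj_h that(1,2)] that(3) by simp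
  have "finite (register Q)" using finite_records register_Q by simp
  moreover have "accept_state M \<noteq> reject_state M" using ptm by (simp add: ptm_wom_def)
  then have "accept_symbols Q \<inter> reject_symbols Q = {}" "accept_symbols Q \<inter> continue_symbols Q = {}"
    "reject_symbols Q \<inter> continue_symbols Q = {}"
    unfolding simulation_def qtm_wom.simps by (intro disj; auto)+
  ultimately show ?thesis
    using machine_ok_Q well_formed_Q eff by (simp add: qtm_wom_def)
qed

end

theorem ptm_wom_recognizable_imp_qtm:
  assumes "ptm_wom_recognizable s A L"
  shows "qtm_wom_recognizable s A L"
proof -
  obtain M where M: "ptm_wom M" "alphabet M = A" "uses_space A (ptm_path M) s"
    "recognizes_unbounded A (ptm_accept_prob M) L"
    using assms by (auto simp: ptm_wom_recognizable_def)
  have ok: "machine_ok M" using M by (simp add: ptm_wom_def)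
  then have fin: "finite (records M)" unfolding records_def
    using finite_actions[OF ok] by (intro finite_cartesian_product) (auto simp: machine_ok_def)
  from finite_imp_inj_to_nat_seg[OF fin]
  obtain h :: "nat \<times> nat \<times> action \<Rightarrow> nat" where h: "inj_on h (records M)"
    by (elim exE conjE)
  interpret ptm_simulation M h by unfold_locales (use M h in auto)
  have "uses_space A (qtm_path Q) s"
    unfolding uses_space_def
  proof (intro ballI allI impI)
    fix w cs assume w: "w \<in> lists A" and "qtm_path Q w cs"
    then obtain cs' where "ptm_path M w cs'" "work_pos ` set cs' = work_pos ` set cs"
      using space_Q[of w cs] M(2) by auto
    then show "real (card (work_pos ` set cs)) \<le> max 1 (s (length w))"
      using M(3) w unfolding uses_space_def by metis
  qed
  moreover have "recognizes_unbounded A (qtm_accept_prob Q) L"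
  proof -
    have "{w \<in> lists A. qtm_accept_prob Q w > cut} = {w \<in> lists A. ptm_accept_prob M w > cut}"
      "{w \<in> lists A. qtm_accept_prob Q w \<ge> cut} = {w \<in> lists A. ptm_accept_prob M w \<ge> cut}" for cut
      by (intro Collect_cong conj_cong refl; simp add: qtm_accept_prob_Q M(2)[symmetric])+
    then show ?thesis using M(4) by (simp add: recognizes_unbounded_def)
  qed
  ultimately show ?thesis using qtm_wom_Q M(2) unfolding qtm_wom_recognizable_def by auto
qed

section \<open>A language recognized by interference\<close>

text \<open>\<open>d\<close> is the number of 0s minus the number of 1s read so far; every letter 2
  is a checkpoint, and a single checkpoint with \<open>d = 0\<close> suffices.\<close>

fun balanced_check :: "nat list \<Rightarrow> int \<Rightarrow> bool" where
  "balanced_check [] d = False"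
| "balanced_check (x # w) d = (if x = 0 then balanced_check w (d + 1)
     else if x = 1 then balanced_check w (d - 1) else d = 0 \<or> balanced_check w d)"

text \<open>The WOM head counts the 0s on the path of state 1 and the 1s on that of state 2. Nothing
  is written: the head position alone distinguishes the configurations.\<close>

definition wom_step :: "nat \<Rightarrow> input_symbol \<Rightarrow> move" where
  "wom_step q x = (if q = 1 \<and> x = Letter 0 \<or> q = 2 \<and> x = Letter 1 then Rgt else Stay)"

definition branch :: "nat \<Rightarrow> input_symbol \<Rightarrow> nat \<Rightarrow> action" where
  "branch q x q' = \<lparr>new_state = q', input_move = (if x = RightEnd then Stay else Rgt), work_write = 0,
     work_move = Stay, wom_write = None, wom_move = wom_step q x\<rparr>"

text \<open>
  State 0 branches into the states 1 and 2. When these scan a 2, they enter the same configuration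
  with opposite relative signs for the symbols 2 (accept) and 3 (reject), so that equal counters
  turn rejection into acceptance. Otherwise the symbols are doubled only to avoid the amplitude
  \<open>1 / sqrt 2\<close>. The symbols \<open>10 + q\<close> and \<open>20 + q\<close> decide with probability 1/2 at the end.
\<close>

definition coef :: "nat \<Rightarrow> input_symbol \<Rightarrow> nat \<Rightarrow> nat \<Rightarrow> real" where
  "coef q x q' r =
     (if x = RightEnd then (if q' \<in> {1, 2} \<and> r \<in> {10 + q, 20 + q} then 1 / 2 else 0)
      else if q = 0 then (if q' \<in> {1, 2} \<and> r \<in> {4, 5} then 1 / 2 else 0)
      else if x = Letter 2 then
        (if r \<in> {0, 1} \<and> q' = q \<or> r = 2 \<and> q' = 1 then 1 / 2
         else if r = 3 \<and> q' = 1 then (if q = 1 then 1 / 2 else - 1 / 2) else 0)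
      else (if r = 0 \<and> q' = q then 1 else 0))"

text \<open>Well-formedness concerns all configurations, including those that no run reaches.
  Therefore state 0 has amplitudes on every input symbol and its own symbols 10 and 20 at the right
  end-marker.\<close>

definition comparer :: qtm_wom where
  "comparer = \<lparr>alphabet = {0, 1, 2}, states = {0, 1, 2}, init_state = 0, work_symbols = {0},
     wom_symbols = {0}, accept_symbols = {2, 10, 11, 12}, reject_symbols = {3, 20, 21, 22},
     continue_symbols = {0, 1, 4, 5},
     ampl = (\<lambda>q x g a r. if a = branch q x (new_state a)
       then of_real (coef q x (new_state a) r) else 0)\<rparr>"

lemma comparer_simps [simp]:
  "alphabet comparer = {0, 1, 2}" "states comparer = {0, 1, 2}" "init_state comparer = 0"
  "work_symbols comparer = {0}" "wom_symbols comparer = {0}"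
  "accept_symbols comparer = {2, 10, 11, 12}" "reject_symbols comparer = {3, 20, 21, 22}"
  "continue_symbols comparer = {0, 1, 4, 5}"
  by (simp_all add: comparer_def)

lemma machine_ok_comparer: "machine_ok comparer"
  by (simp add: machine_ok_def)

lemma branch_simps [simp]:
  "new_state (branch q x q') = q'" "work_write (branch q x q') = 0" "work_move (branch q x q') = Stay"
  "wom_write (branch q x q') = None" "wom_move (branch q x q') = wom_step q x"
  "input_move (branch q x q') = (if x = RightEnd then Stay else Rgt)"
  by (simp_all add: branch_def)

lemma stays_branch: "stays_on_input x (branch q x q')"
  by (simp add: stays_on_input_def)

lemma amp_comparer: "amp comparer w r c a = (if a = branch (state c) (scanned w c) (new_state a)
  then of_real (coef (state c) (scanned w c) (new_state a) r) else 0)"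
  by (simp add: amp_def comparer_def)

lemma sum_actions_branch:
  assumes "\<And>a. a \<in> actions comparer \<Longrightarrow> a \<noteq> branch q x (new_state a) \<Longrightarrow> f a = 0"
  shows "(\<Sum>a\<in>actions comparer. f a) = (\<Sum>q'\<in>{0, 1, 2}. f (branch q x q'))"
proof -
  have "(\<Sum>a\<in>actions comparer. f a) = (\<Sum>a\<in>branch q x ` {0, 1, 2}. f a)"
  proof (rule sum.mono_neutral_right[OF finite_actions[OF machine_ok_comparer]])
    show "branch q x ` {0, 1, 2} \<subseteq> actions comparer" by (auto simp: actions_def)
    show "\<forall>a\<in>actions comparer - branch q x ` {0, 1, 2}. f a = 0"
    proof
      fix a assume a: "a \<in> actions comparer - branch q x ` {0, 1, 2}"
      then have "new_state a \<in> {0, 1, 2}" by (simp add: actions_def)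
      then have "a \<noteq> branch q x (new_state a)" using a by blast
      then show "f a = 0" using a assms by blast
    qed
  qed
  also have "\<dots> = (\<Sum>q'\<in>{0, 1, 2}. f (branch q x q'))"
    by (rule sum.reindex_cong[of "branch q x"]) (auto intro!: inj_onI dest: arg_cong[where f = new_state])
  finally show ?thesis .
qed

definition follow :: "nat list \<Rightarrow> config \<Rightarrow> nat \<Rightarrow> config" where
  "follow w c q' = perform (branch (state c) (scanned w c) q') c"

text \<open>The new state 0 stands for an arbitrary one: successors with the same new state collide
  for all choices of it or for none.\<close>

definition aligned :: "nat list \<Rightarrow> config \<Rightarrow> config \<Rightarrow> bool" where
  "aligned w c c' \<longleftrightarrow> follow w c 0 = follow w c' 0"

lemma follow_eq_iff: "follow w c q = follow w c' q' \<longleftrightarrow> q = q' \<and> aligned w c c'"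
  by (auto simp: aligned_def follow_def perform_def)

lemma work_pos_follow: "work_pos (follow w c q) = work_pos c"
  by (simp add: follow_def perform_def)

lemma evol_comparer:
  "evol comparer w r d c = (\<Sum>q'\<in>{0, 1, 2}. of_real (coef (state c) (scanned w c) q' r) *
     basis (follow w c q') d)"
proof -
  have "evol comparer w r d c = (\<Sum>q'\<in>{0, 1, 2}.
    if perform (branch (state c) (scanned w c) q') c = d
    then amp comparer w r c (branch (state c) (scanned w c) q') else 0)"
    unfolding evol_eq_amp[OF machine_ok_comparer]
    by (rule sum_actions_branch) (auto simp: amp_comparer)
  then show ?thesis by (auto simp: amp_comparer follow_def basis_def intro!: sum.cong)
qed

lemma evol_inner_comparer:
  assumes "c \<in> configs comparer w"
  shows "gram comparer w r c c' =
    (if aligned w c c' then of_real (\<Sum>q'\<in>{0, 1, 2}.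
       coef (state c) (scanned w c) q' r * coef (state c') (scanned w c') q' r) else 0)"
proof -
  let ?b = "\<lambda>c. branch (state c) (scanned w c)" and ?A = "actions comparer"
  let ?m = "amp comparer w r"
  have "gram comparer w r c c' =
    (\<Sum>a\<in>?A. \<Sum>a'\<in>?A. if perform a c = perform a' c' then cnj (?m c a) * ?m c' a' else 0)"
  proof (rule evol_inner[OF machine_ok_comparer assms])
    fix a assume "?m c a \<noteq> 0"
    then have "a = ?b c (new_state a)" unfolding amp_comparer by (auto split: if_splits)
    then show "stays_on_input (scanned w c) a" using stays_branch by metis
  qed
  also have "\<dots> = (\<Sum>q\<in>{0, 1, 2}. \<Sum>a'\<in>?A. if perform (?b c q) c = perform a' c'
      then cnj (?m c (?b c q)) * ?m c' a' else 0)"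
    by (rule sum_actions_branch) (auto simp: amp_comparer intro!: sum.neutral)
  also have "\<dots> = (\<Sum>q\<in>{0, 1, 2}. \<Sum>q'\<in>{0, 1, 2}. if perform (?b c q) c = perform (?b c' q') c'
      then cnj (?m c (?b c q)) * ?m c' (?b c' q') else 0)"
    by (intro sum.cong refl sum_actions_branch) (auto simp: amp_comparer)
  also have "\<dots> = (\<Sum>q\<in>{0, 1, 2}. \<Sum>q'\<in>{0, 1, 2}. if q = q' then
      (if aligned w c c' then of_real
        (coef (state c) (scanned w c) q r * coef (state c') (scanned w c') q r) else 0) else 0)"
    unfolding follow_def[symmetric] amp_comparer
    by (intro sum.cong refl) (auto simp: follow_eq_iff)
  also have "\<dots> = (\<Sum>q\<in>{0, 1, 2}. if aligned w c c' then of_real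
        (coef (state c) (scanned w c) q r * coef (state c') (scanned w c') q r) else 0)"
    by (intro sum.cong refl) auto
  finally show ?thesis by simp
qed

text \<open>Most pairs are orthogonal since they use different register symbols or different new
  states. The exception is the states 1 and 2 scanning a 2: there the symbols 2 and 3 contribute 1/4
  and -1/4, which cancel. A configuration at the right end-marker can collide with one scanning
  another symbol, but the two share no register symbol.\<close>

lemma coef_orthonormal:
  assumes "q \<in> {0, 1, 2}" "q' \<in> {0, 1, 2}" "x = x' \<or> x = RightEnd \<or> x' = RightEnd"
  shows "(\<Sum>r\<in>{2, 10, 11, 12} \<union> {3, 20, 21, 22} \<union> {0, 1, 4, 5}. \<Sum>p\<in>{0, 1, 2}.
    coef q x p r * coef q' x' p r) = (if q = q' \<and> x = x' then 1 else 0)"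
proof -
  consider "x = RightEnd" "x' = RightEnd" | "x = RightEnd" "x' \<noteq> RightEnd" | "x \<noteq> RightEnd" "x' = RightEnd"
    | "x = Letter 2" "x' = Letter 2" | "x \<noteq> RightEnd" "x \<noteq> Letter 2" "x' = x" using assms(3) by blast
  then show ?thesis
    using assms(1,2) by cases (elim insertE emptyE; simp add: coef_def)+
qed

lemma well_formed_comparer: "well_formed comparer"
  unfolding well_formed_def
proof (intro ballI)
  fix w c c' assume w: "w \<in> lists (alphabet comparer)" and c: "c \<in> configs comparer w" "c' \<in> configs comparer w"
  let ?x = "scanned w c" and ?x' = "scanned w c'"
  have q: "state c \<in> {0, 1, 2}" "state c' \<in> {0, 1, 2}" using c by (auto simp: configs_def)
  have p: "input_pos c \<le> length w + 1" "input_pos c' \<le> length w + 1" using c by (auto simp: configs_def)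
  have e: "(\<Sum>r\<in>register comparer. gram comparer w r c c') =
    (if aligned w c c' then of_real (\<Sum>r\<in>{2, 10, 11, 12} \<union> {3, 20, 21, 22} \<union> {0, 1, 4, 5}.
      \<Sum>q'\<in>{0, 1, 2}. coef (state c) ?x q' r * coef (state c') ?x' q' r) else 0)"
    unfolding evol_inner_comparer[OF c(1)] register_def comparer_simps
    by (cases "aligned w c c'") (simp_all only: if_True if_False of_real_sum sum.neutral_const)
  show "(\<Sum>r\<in>register comparer. gram comparer w r c c') = (if c = c' then 1 else 0)"
  proof (cases "aligned w c c'")
    case True
    \<comment> \<open>Away from the right end-marker the head always moves right, so equal new
      positions come from equal old ones. At the marker the head stays, and its position is also
      entered from the last square before it.\<close>
    have "?x = ?x' \<or> ?x = RightEnd \<or> ?x' = RightEnd"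
    proof (rule ccontr)
      assume *: "\<not> ?thesis"
      have "input_pos c = input_pos c'"
        using arg_cong[OF True[unfolded aligned_def], of input_pos] * by (simp add: follow_def perform_def nat_add_distrib)
      then show False using * by (simp add: scanned_def)
    qed
    note S = coef_orthonormal[OF q this]
    have "c = c'" if "state c = state c'" "?x = ?x'"
    proof (rule perform_inj)
      show "perform (branch (state c) ?x 0) c = perform (branch (state c) ?x 0) c'"
        using True that by (simp add: aligned_def follow_def)
      show "work_symbol c = work_symbol c'" using c by (auto simp: work_symbol_def configs_def image_subset_iff)
      show "stays_on_input (scanned w c) (branch (state c) ?x 0)"
        "stays_on_input (scanned w c') (branch (state c) ?x 0)" using stays_branch that by metis+
    qed (use p that in auto)
    then show ?thesis unfolding e S using True by auto
  next
    case False
    then have "c \<noteq> c'" by (auto simp: aligned_def)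
    then show ?thesis unfolding e using False by simp
  qed
qed

lemma qtm_wom_comparer: "qtm_wom comparer"
proof -
  have "eff_computable_real 0" "eff_computable_real 1" "eff_computable_real (1 / 2)"
    "eff_computable_real (- 1 / 2)"
    using eff_computable_real_rat[of 2 0 0] eff_computable_real_rat[of 2 2 0]
      eff_computable_real_rat[of 2 1 0] eff_computable_real_rat[of 2 0 1] by simp_all
  then have "eff_computable (ampl comparer q x g a r)" for q x g a r
    by (simp add: comparer_def eff_computable_def coef_def)
  moreover have "ampl comparer q x g a r = 0" if "\<not> stays_on_input x a" for q x g a r
    using that stays_branch[of x q "new_state a"] by (auto simp: comparer_def)
  ultimately show ?thesis
    using well_formed_comparer machine_ok_comparer by (simp add: qtm_wom_def register_def)
qed

text \<open>The work head never leaves its starting square, and one square is allowed under every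
  bound \<open>s\<close>.\<close>

lemma space_comparer: "uses_space {0, 1, 2} (qtm_path comparer) s"
  unfolding uses_space_def
proof (intro ballI allI impI)
  fix w cs assume p: "qtm_path comparer w cs"
  have "work_pos (cs ! i) = 0" if "i < length cs" for i
    using that
  proof (induction i)
    case 0
    then show ?case using p by (auto simp: qtm_path_def hd_conv_nth init_config_def)
  next
    case (Suc i)
    then obtain r where "evol comparer w r (cs ! Suc i) (cs ! i) \<noteq> 0"
      using p unfolding qtm_path_def by blast
    then obtain q where "follow w (cs ! i) q = cs ! Suc i"
      unfolding evol_comparer basis_def by (auto split: if_splits)
    then have "work_pos (cs ! Suc i) = work_pos (cs ! i)"
      by (metis work_pos_follow)
    then show ?case using Suc by simp
  qed
  then have "work_pos ` set cs \<subseteq> {0}" by (auto simp: set_conv_nth)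
  then have "card (work_pos ` set cs) \<le> card {0::int}" by (intro card_mono) auto
  then show "real (card (work_pos ` set cs)) \<le> max 1 (s (length w))" by simp
qed


section \<open>Acceptance probability of the interfering paths\<close>

definition path_config :: "nat \<Rightarrow> nat \<Rightarrow> int \<Rightarrow> config" where
  "path_config q p k = \<lparr>state = q, input_pos = p, work_pos = 0, work_tape = (\<lambda>_. 0), wom_pos = k,
     wom_tape = (\<lambda>_. 0)\<rparr>"

lemma path_config_eq_iff [simp]:
  "path_config q p k = path_config q' p' k' \<longleftrightarrow> q = q' \<and> p = p' \<and> k = k'"
  by (simp add: path_config_def)

lemma path_config_simps [simp]: "state (path_config q p k) = q" "input_pos (path_config q p k) = p"
  "scanned w (path_config q p k) = input_at w p"
  by (simp_all add: path_config_def scanned_def)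

lemma path_config_in_configs:
  "path_config q p k \<in> configs comparer w \<longleftrightarrow> q \<in> {0, 1, 2} \<and> p \<le> length w + 1"
  by (auto simp: path_config_def configs_def)

lemma follow_path_config:
  "follow w (path_config q p k) q' = path_config q' (if input_at w p = RightEnd then p else p + 1)
     (k + shift (wom_step q (input_at w p)))"
  by (auto simp: follow_def perform_def path_config_def scanned_def nat_add_distrib)

lemma sqnorm_basis_add:
  assumes "a \<in> configs M w" "b \<in> configs M w"
  shows "sqnorm M w (\<lambda>d. basis a d + basis b d) = (if a = b then 4 else 2)"
  using assms by (subst sqnorm_finite[of "{a, b}"]) (auto simp: basis_def)

text \<open>Both paths in superposition, with counters \<open>k\<close> and \<open>l\<close>.
  Without normalization the squared norm is 2, so acceptance values computed from it are twice the
  probabilities and the amplitudes remain rational.\<close>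

definition pair :: "nat \<Rightarrow> int \<Rightarrow> int \<Rightarrow> superposition" where
  "pair p k l = (\<lambda>d. basis (path_config 1 p k) d + basis (path_config 2 p l) d)"

definition next_pos :: "nat list \<Rightarrow> nat \<Rightarrow> nat" where
  "next_pos w p = (if input_at w p = RightEnd then p else p + 1)"

definition moved :: "nat \<Rightarrow> nat list \<Rightarrow> nat \<Rightarrow> int \<Rightarrow> int" where
  "moved q w p k = k + shift (wom_step q (input_at w p))"

lemma evol_apply_pair:
  assumes "p \<le> length w + 1"
  shows "evol_apply comparer w r (pair p k l) d = (\<Sum>q'\<in>{1, 2}.
    of_real (coef 1 (input_at w p) q' r) *
      basis (path_config q' (next_pos w p) (moved 1 w p k)) d +
    of_real (coef 2 (input_at w p) q' r) *
      basis (path_config q' (next_pos w p) (moved 2 w p l)) d)"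
proof -
  let ?a = "path_config 1 p k" and ?b = "path_config 2 p l"
  have "evol_apply comparer w r (pair p k l) d = (\<Sum>c\<in>{?a, ?b}. evol comparer w r d c * pair p k l c)"
    by (rule evol_apply_finite) (use assms in \<open>auto simp: path_config_in_configs pair_def basis_def\<close>)
  also have "\<dots> = evol comparer w r d ?a + evol comparer w r d ?b"
    by (simp add: pair_def basis_def)
  also have "\<dots> = (\<Sum>q'\<in>{1, 2}.
    of_real (coef 1 (input_at w p) q' r) *
      basis (path_config q' (next_pos w p) (moved 1 w p k)) d +
    of_real (coef 2 (input_at w p) q' r) *
      basis (path_config q' (next_pos w p) (moved 2 w p l)) d)"
    unfolding evol_comparer follow_path_config
    by (simp add: next_pos_def moved_def coef_def)
  finally show ?thesis .
qed

lemma finite_continue_comparer: "finite (continue_symbols comparer)"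
  by simp

lemma accept_at_pair_plain:
  assumes "p \<le> length w" "input_at w p \<noteq> Letter 2"
  shows "accept_at comparer w 0 (pair p k l) = 0"
    "accept_at comparer w (Suc t) (pair p k l) =
       accept_at comparer w t (pair (p + 1) (moved 1 w p k) (moved 2 w p l))"
proof -
  have x: "input_at w p \<noteq> RightEnd" using assms by (auto simp: input_at_def)
  then have n: "next_pos w p = p + 1" by (simp add: next_pos_def)
  have le: "p \<le> length w + 1" using assms by simp
  have e: "evol_apply comparer w r (pair p k l) =
    (if r = 0 then pair (p + 1) (moved 1 w p k) (moved 2 w p l) else (\<lambda>d. 0))" for r
    using x assms(2) by (auto simp: evol_apply_pair[OF le] coef_def n fun_eq_iff) (simp_all add: pair_def)
  show "accept_at comparer w 0 (pair p k l) = 0"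
    by (simp add: accept_at_0 e sqnorm_zero)
  show "accept_at comparer w (Suc t) (pair p k l) =
       accept_at comparer w t (pair (p + 1) (moved 1 w p k) (moved 2 w p l))"
    unfolding accept_at_Suc[OF finite_continue_comparer] e by (simp add: accept_at_zero)
qed

text \<open>Of the squared norm 2, half continues with the symbols 0 and 1. The other half falls on
  the symbols 2 and 3: evenly if the counters differ, but entirely on the accept symbol 2 if they
  agree, where the two paths add up for 2 and cancel for 3.\<close>

lemma accept_at_pair_check:
  assumes "p \<le> length w" "input_at w p = Letter 2"
  shows "accept_at comparer w 0 (pair p k l) = (if k = l then 1 else 1 / 2)"
    "accept_at comparer w (Suc t) (pair p k l) = 1 / 2 * accept_at comparer w t (pair (p + 1) k l)"
proof -
  have le: "p \<le> length w + 1" using assms by simp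
  define h where "h = (1 / 2 :: complex)"
  have h: "(cmod h)\<^sup>2 = 1 / 4" by (simp add: h_def power2_eq_square)
  have n: "next_pos w p = p + 1" "moved 1 w p k = k" "moved 2 w p l = l"
    using assms by (simp_all add: next_pos_def moved_def wom_step_def)
  have e: "evol_apply comparer w r (pair p k l) =
    (if r \<in> {0, 1} then (\<lambda>d. h * pair (p + 1) k l d)
     else if r = 2 then (\<lambda>d. h * (basis (path_config 1 (p + 1) k) d + basis (path_config 1 (p + 1) l) d))
     else if r = 3 then (\<lambda>d. h * (basis (path_config 1 (p + 1) k) d - basis (path_config 1 (p + 1) l) d))
     else (\<lambda>d. 0))" for r
    using assms(2) by (auto simp: evol_apply_pair[OF le] coef_def n n[simplified] fun_eq_iff algebra_simps h_def)
      (simp_all add: pair_def algebra_simps)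
  show "accept_at comparer w 0 (pair p k l) = (if k = l then 1 else 1 / 2)"
    using assms by (simp add: accept_at_0 e sqnorm_zero sqnorm_scale sqnorm_basis_add
        path_config_in_configs h)
  show "accept_at comparer w (Suc t) (pair p k l) = 1 / 2 * accept_at comparer w t (pair (p + 1) k l)"
    unfolding accept_at_Suc[OF finite_continue_comparer] e
    by (simp add: accept_at_zero accept_at_scale h)
qed

text \<open>The two paths write different symbols and do not interfere; each of them accepts with
  half of its weight.\<close>

lemma accept_at_pair_end:
  assumes "p = length w + 1"
  shows "accept_at comparer w 0 (pair p k l) = 1"
    "accept_at comparer w (Suc t) (pair p k l) = 0"
proof -
  have le: "p \<le> length w + 1" using assms by simp
  define h where "h = (1 / 2 :: complex)"
  have h: "(cmod h)\<^sup>2 = 1 / 4" by (simp add: h_def power2_eq_square)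
  have x: "input_at w p = RightEnd" using assms by (simp add: input_at_def)
  have n: "next_pos w p = p" "moved 1 w p k = k" "moved 2 w p l = l"
    using x by (simp_all add: next_pos_def moved_def wom_step_def)
  have e: "evol_apply comparer w r (pair p k l) =
    (if r \<in> {11, 21} then (\<lambda>d. h * (basis (path_config 1 p k) d + basis (path_config 2 p k) d))
     else if r \<in> {12, 22} then (\<lambda>d. h * (basis (path_config 1 p l) d + basis (path_config 2 p l) d))
     else (\<lambda>d. 0))" for r
    using x by (auto simp: evol_apply_pair[OF le] coef_def n n[simplified] fun_eq_iff algebra_simps h_def)
  show "accept_at comparer w 0 (pair p k l) = 1"
    using le by (simp add: accept_at_0 e sqnorm_zero sqnorm_scale sqnorm_basis_add
        path_config_in_configs h)
  show "accept_at comparer w (Suc t) (pair p k l) = 0"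
    unfolding accept_at_Suc[OF finite_continue_comparer] e by (simp add: accept_at_zero)
qed

text \<open>Twice the acceptance probability when the counters differ by \<open>d\<close>. A
  checkpoint with \<open>d\<close> other than \<open>0\<close> averages the remaining value with the
  neutral value 1, so only a checkpoint with \<open>d = 0\<close> can lift the value above
  1.\<close>

fun check_value :: "nat list \<Rightarrow> int \<Rightarrow> real" where
  "check_value [] d = 1"
| "check_value (x # w) d = (if x = 0 then check_value w (d + 1) else if x = 1 then check_value w (d - 1)
     else (if d = 0 then 1 else 1 / 2) + 1 / 2 * check_value w d)"

lemma check_value_ge_1: "1 \<le> check_value w d"
proof (induction w arbitrary: d)
  case (Cons x w)
  show ?case using Cons.IH[of "d + 1"] Cons.IH[of "d - 1"] Cons.IH[of d] by auto
qed simp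

lemma check_value_gt_1_iff: "1 < check_value w d \<longleftrightarrow> balanced_check w d"
proof (induction w arbitrary: d)
  case (Cons x w)
  then show ?case using check_value_ge_1[of w d] by (auto simp: field_simps)
qed simp

lemma accept_at_pair_sums:
  assumes "w = u @ v" "set v \<subseteq> {0, 1, 2}"
  shows "(\<lambda>t. accept_at comparer w t (pair (length u + 1) k l)) sums check_value v (k - l)"
  using assms
proof (induction v arbitrary: u k l)
  case Nil
  have "(\<lambda>t. accept_at comparer w (Suc t) (pair (length u + 1) k l)) sums 0"
    using accept_at_pair_end[of "length u + 1" w] Nil by simp
  from sums_Suc[OF this] show ?case using accept_at_pair_end[of "length u + 1" w] Nil by simp
next
  case (Cons x v)
  let ?p = "length u + 1"
  have x: "input_at w ?p = Letter x" using Cons.prems by (simp add: input_at_def)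
  have p: "?p \<le> length w" using Cons.prems by simp
  have IH: "(\<lambda>t. accept_at comparer w t (pair (?p + 1) k l)) sums check_value v (k - l)" for k l
    using Cons.IH[of "u @ [x]" k l] Cons.prems by simp
  show ?case
  proof (cases "x = 2")
    case True
    then have c: "input_at w ?p = Letter 2" using x by simp
    have "(\<lambda>t. accept_at comparer w (Suc t) (pair ?p k l)) sums (1 / 2 * check_value v (k - l))"
      unfolding accept_at_pair_check(2)[OF p c] by (rule sums_mult[OF IH])
    from sums_Suc[OF this] have "(\<lambda>t. accept_at comparer w t (pair ?p k l)) sums
        (1 / 2 * check_value v (k - l) + (if k = l then 1 else 1 / 2))"
      unfolding accept_at_pair_check(1)[OF p c] .
    moreover have "1 / 2 * check_value v (k - l) + (if k = l then 1 else 1 / 2) = check_value (x # v) (k - l)"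
      using True by simp
    ultimately show ?thesis by simp
  next
    case False
    then have c: "input_at w ?p \<noteq> Letter 2" using x by simp
    have "(\<lambda>t. accept_at comparer w (Suc t) (pair ?p k l)) sums
        check_value v (moved 1 w ?p k - moved 2 w ?p l)"
      unfolding accept_at_pair_plain(2)[OF p c] by (rule IH)
    from sums_Suc[OF this] have "(\<lambda>t. accept_at comparer w t (pair ?p k l)) sums
        check_value v (moved 1 w ?p k - moved 2 w ?p l)"
      unfolding accept_at_pair_plain(1)[OF p c] add_0_right .
    moreover have "check_value v (moved 1 w ?p k - moved 2 w ?p l) = check_value (x # v) (k - l)"
      using False Cons.prems(2) unfolding moved_def x
      by (auto simp: wom_step_def algebra_simps)
    ultimately show ?thesis by simp
  qed
qed

lemma qtm_accept_prob_comparer: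
  assumes "set w \<subseteq> {0, 1, 2}"
  shows "qtm_accept_prob comparer w = 1 / 2 * check_value w 0"
proof -
  let ?c = "path_config 0 0 0"
  define h where "h = (1 / 2 :: complex)"
  have h: "(cmod h)\<^sup>2 = 1 / 4" by (simp add: h_def power2_eq_square)
  have i: "init_config comparer = ?c" by (simp add: init_config_def path_config_def)
  have c: "?c \<in> configs comparer w" by (simp add: path_config_in_configs)
  have e: "evol_apply comparer w r (basis ?c) = (if r \<in> {4, 5} then (\<lambda>d. h * pair 1 0 0 d) else (\<lambda>d. 0))" for r
    unfolding evol_apply_basis[OF c] evol_comparer follow_path_config
    by (auto simp: coef_def input_at_def wom_step_def pair_def fun_eq_iff algebra_simps h_def)
  have 0: "accept_at comparer w 0 (basis ?c) = 0"
    by (simp add: accept_at_0 e sqnorm_zero)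
  have "accept_at comparer w (Suc t) (basis ?c) = 1 / 2 * accept_at comparer w t (pair 1 0 0)" for t
    unfolding accept_at_Suc[OF finite_continue_comparer] e
    by (simp add: accept_at_zero accept_at_scale h)
  moreover have "(\<lambda>t. 1 / 2 * accept_at comparer w t (pair 1 0 0)) sums (1 / 2 * check_value w 0)"
    using accept_at_pair_sums[of w "[]" w 0 0] assms by (intro sums_mult) simp
  ultimately have "(\<lambda>t. accept_at comparer w (Suc t) (basis ?c)) sums (1 / 2 * check_value w 0)" by (simp only:)
  from sums_Suc[OF this] show ?thesis
    unfolding qtm_accept_prob_eq i by (simp add: 0 sums_iff)
qed

definition balanced_language :: "nat list set" where
  "balanced_language = {w \<in> lists {0, 1, 2}. balanced_check w 0}"

lemma qtm_recognizes_balanced_language: "qtm_wom_recognizable s {0, 1, 2} balanced_language"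
  unfolding qtm_wom_recognizable_def
proof (intro exI[of _ comparer] conjI)
  have "balanced_language = {w \<in> lists {0, 1, 2}. qtm_accept_prob comparer w > 1 / 2}"
    unfolding balanced_language_def
  proof (intro Collect_cong conj_cong refl)
    fix w :: "nat list" assume "w \<in> lists {0, 1, 2}"
    then have "set w \<subseteq> {0, 1, 2}" by (simp add: lists_eq_set)
    then show "balanced_check w 0 \<longleftrightarrow> qtm_accept_prob comparer w > 1 / 2"
      using check_value_gt_1_iff[of w 0] by (simp add: qtm_accept_prob_comparer)
  qed
  then show "recognizes_unbounded {0, 1, 2} (qtm_accept_prob comparer) balanced_language"
    unfolding recognizes_unbounded_def by blast
qed (rule qtm_wom_comparer space_comparer comparer_simps)+

section \<open>Linear systems and functions of bounded rank\<close>

text \<open>Gaussian elimination, one interior unknown at a time: the induction hypothesis treats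
  \<open>x0\<close> as a boundary point, and the equation of \<open>x0\<close> is then solved. The
  result depends on the coefficients only and serves every solution \<open>g\<close>, whatever its
  boundary values. Probabilistically, \<open>N\<close> holds discounted exit weights, which is why
  the row bound \<open>z\<close> survives.\<close>

lemma eliminate_interior:
  fixes m :: "'a \<Rightarrow> 'a \<Rightarrow> real"
  assumes "finite X" "finite Y" "X \<inter> Y = {}" "\<And>x y. 0 \<le> m x y"
    "\<And>x. x \<in> X \<Longrightarrow> (\<Sum>y\<in>X \<union> Y. m x y) \<le> z" "0 \<le> z" "z < 1"
  shows "\<exists>a N. (\<forall>x\<in>X. \<forall>y\<in>Y. 0 \<le> N x y) \<and> (\<forall>x\<in>X. (\<Sum>y\<in>Y. N x y) \<le> z) \<and>
    (\<forall>g. (\<forall>x\<in>X. g x = b x + (\<Sum>y\<in>X \<union> Y. m x y * g y)) \<longrightarrow>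
       (\<forall>x\<in>X. g x = a x + (\<Sum>y\<in>Y. N x y * g y)))"
  using assms(1-3,5)
proof (induction X arbitrary: Y rule: finite_induct)
  case empty
  then show ?case by auto
next
  case (insert x0 X)
  let ?Y = "insert x0 Y"
  have x0Y: "x0 \<notin> Y" using insert.prems by auto
  have un: "X \<union> ?Y = insert x0 X \<union> Y" by auto
  have "\<exists>a N. (\<forall>x\<in>X. \<forall>y\<in>?Y. 0 \<le> N x y) \<and> (\<forall>x\<in>X. (\<Sum>y\<in>?Y. N x y) \<le> z) \<and>
    (\<forall>g. (\<forall>x\<in>X. g x = b x + (\<Sum>y\<in>X \<union> ?Y. m x y * g y)) \<longrightarrow>
       (\<forall>x\<in>X. g x = a x + (\<Sum>y\<in>?Y. N x y * g y)))"
    using insert.prems insert.hyps by (intro insert.IH) auto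
  then obtain a N where N: "\<forall>x\<in>X. \<forall>y\<in>?Y. 0 \<le> N x y" "\<forall>x\<in>X. (\<Sum>y\<in>?Y. N x y) \<le> z"
    "\<forall>g. (\<forall>x\<in>X. g x = b x + (\<Sum>y\<in>X \<union> ?Y. m x y * g y)) \<longrightarrow>
       (\<forall>x\<in>X. g x = a x + (\<Sum>y\<in>?Y. N x y * g y))"
    by (elim exE conjE)
  have N0: "0 \<le> N x y" if "x \<in> X" "y \<in> ?Y" for x y using N(1) that by blast
  have Nz: "(\<Sum>y\<in>?Y. N x y) \<le> z" if "x \<in> X" for x using N(2) that by blast
  have sol: "g x = a x + (\<Sum>y\<in>?Y. N x y * g y)"
    if "\<forall>x\<in>X. g x = b x + (\<Sum>y\<in>X \<union> ?Y. m x y * g y)" "x \<in> X" for g x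
    using N(3)[THEN spec, THEN mp, OF that(1)] that(2) by (rule bspec)
  have Nz': "N x x0 + (\<Sum>y\<in>Y. N x y) \<le> z" if "x \<in> X" for x
    using Nz[OF that] insert.prems x0Y by simp
  let ?q = "\<lambda>y. \<Sum>x\<in>X. m x0 x * N x y"
  \<comment> \<open>\<open>p\<close> is the weight of returning to \<open>x0\<close>, directly or
    through \<open>X\<close>. It is below 1 by the discount, so the pivot \<open>1 - p\<close> is
    positive.\<close>
  define p where "p = m x0 x0 + ?q x0"
  define a0 where "a0 = (b x0 + (\<Sum>x\<in>X. m x0 x * a x)) / (1 - p)"
  define n0 where "n0 y = (m x0 y + ?q y) / (1 - p)" for y
  have row: "m x0 x0 + (\<Sum>x\<in>X. m x0 x) + (\<Sum>y\<in>Y. m x0 y) \<le> z"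
  proof -
    have "(\<Sum>y\<in>insert x0 X \<union> Y. m x0 y) = (\<Sum>y\<in>insert x0 X. m x0 y) + (\<Sum>y\<in>Y. m x0 y)"
      using insert.hyps insert.prems(1,2) by (intro sum.union_disjoint) auto
    then show ?thesis using insert.prems(3)[of x0] insert.hyps by simp
  qed
  have total: "p + (\<Sum>y\<in>Y. m x0 y + ?q y) \<le> z"
  proof -
    have "p + (\<Sum>y\<in>Y. m x0 y + ?q y) =
      m x0 x0 + (\<Sum>y\<in>Y. m x0 y) + (\<Sum>x\<in>X. m x0 x * (N x x0 + (\<Sum>y\<in>Y. N x y)))"
      by (simp add: p_def sum.distrib sum.swap[of _ X Y] distrib_left sum_distrib_left)
    also have "(\<Sum>x\<in>X. m x0 x * (N x x0 + (\<Sum>y\<in>Y. N x y))) \<le> (\<Sum>x\<in>X. m x0 x * 1)"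
      using order_trans[OF Nz' less_imp_le[OF assms(7)]] assms(4) by (intro sum_mono mult_left_mono)
    finally show ?thesis using row by simp
  qed
  have num: "0 \<le> m x0 y + ?q y" if "y \<in> Y" for y
    using that assms(4) N0 by (intro add_nonneg_nonneg sum_nonneg mult_nonneg_nonneg) auto
  have p0: "0 \<le> p" unfolding p_def
    using assms(4) N0 by (intro add_nonneg_nonneg sum_nonneg mult_nonneg_nonneg) auto
  have "0 \<le> (\<Sum>y\<in>Y. m x0 y + ?q y)" using num by (rule sum_nonneg)
  then have p1: "p < 1" using total assms(7) by linarith
  have n0: "0 \<le> n0 y" if "y \<in> Y" for y using num[OF that] p1 by (simp add: n0_def)
  have n0z: "(\<Sum>y\<in>Y. n0 y) \<le> z"
  proof -
    have "(\<Sum>y\<in>Y. n0 y) = (\<Sum>y\<in>Y. m x0 y + ?q y) / (1 - p)"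
      by (simp add: n0_def sum_divide_distrib)
    also have "\<dots> \<le> (z - p) / (1 - p)" using total p1 by (intro divide_right_mono) auto
    also have "\<dots> \<le> z" using p0 p1 assms(7) mult_left_mono[of z 1 p]
      by (simp add: pos_divide_le_eq algebra_simps)
    finally show ?thesis .
  qed
  define a' where "a' x = (if x = x0 then a0 else a x + N x x0 * a0)" for x
  define N' where "N' x y = (if x = x0 then n0 y else N x y + N x x0 * n0 y)" for x y
  have "0 \<le> N' x y" if "x \<in> insert x0 X" "y \<in> Y" for x y
    using that n0 N0 by (auto simp: N'_def)
  moreover have "(\<Sum>y\<in>Y. N' x y) \<le> z" if "x \<in> insert x0 X" for x
  proof (cases "x = x0")
    case True
    then show ?thesis using n0z by (simp add: N'_def)
  next
    case False
    then have x: "x \<in> X" using that by simp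
    have "(\<Sum>y\<in>Y. N' x y) = (\<Sum>y\<in>Y. N x y) + N x x0 * (\<Sum>y\<in>Y. n0 y)"
      using False by (simp add: N'_def sum.distrib sum_distrib_left)
    also have "N x x0 * (\<Sum>y\<in>Y. n0 y) \<le> N x x0 * 1"
      using N0[OF x, of x0] n0z assms(7) by (intro mult_left_mono) auto
    finally show ?thesis using Nz'[OF x] by simp
  qed
  moreover have "g x = a' x + (\<Sum>y\<in>Y. N' x y * g y)"
    if g: "\<forall>x\<in>insert x0 X. g x = b x + (\<Sum>y\<in>insert x0 X \<union> Y. m x y * g y)" and x: "x \<in> insert x0 X" for g x
  proof -
    have gX: "g x = a x + N x x0 * g x0 + (\<Sum>y\<in>Y. N x y * g y)" if "x \<in> X" for x
      using sol[of g x] g that insert.prems(1) x0Y unfolding un by simp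
    have "g x0 = b x0 + (m x0 x0 * g x0 + (\<Sum>x\<in>X. m x0 x * g x) + (\<Sum>y\<in>Y. m x0 y * g y))"
    proof -
      have "g x0 = b x0 + (\<Sum>y\<in>insert x0 X \<union> Y. m x0 y * g y)" using g by simp
      also have "(\<Sum>y\<in>insert x0 X \<union> Y. m x0 y * g y) =
        m x0 x0 * g x0 + (\<Sum>x\<in>X. m x0 x * g x) + (\<Sum>y\<in>Y. m x0 y * g y)"
        using insert.hyps insert.prems(1,2) by (subst sum.union_disjoint) auto
      finally show ?thesis .
    qed
    also have "(\<Sum>x\<in>X. m x0 x * g x) =
      (\<Sum>x\<in>X. m x0 x * a x) + ?q x0 * g x0 +
      (\<Sum>y\<in>Y. ?q y * g y)"
    proof -
      have "(\<Sum>x\<in>X. m x0 x * g x) = (\<Sum>x\<in>X. m x0 x * a x + m x0 x * N x x0 * g x0 +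
        (\<Sum>y\<in>Y. m x0 x * N x y * g y))"
        by (intro sum.cong refl) (simp add: gX algebra_simps sum_distrib_left)
      also have "\<dots> = (\<Sum>x\<in>X. m x0 x * a x) + ?q x0 * g x0 +
        (\<Sum>x\<in>X. \<Sum>y\<in>Y. m x0 x * N x y * g y)"
        by (simp add: sum.distrib sum_distrib_right)
      also have "(\<Sum>x\<in>X. \<Sum>y\<in>Y. m x0 x * N x y * g y) = (\<Sum>y\<in>Y. ?q y * g y)"
        by (subst sum.swap) (simp add: sum_distrib_right)
      finally show ?thesis .
    qed
    finally have "(1 - p) * g x0 = (b x0 + (\<Sum>x\<in>X. m x0 x * a x)) +
      (\<Sum>y\<in>Y. (m x0 y + ?q y) * g y)"
      by (simp add: p_def algebra_simps sum.distrib)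
    then have g0: "g x0 = a0 + (\<Sum>y\<in>Y. n0 y * g y)"
    proof -
      assume *: "(1 - p) * g x0 = (b x0 + (\<Sum>x\<in>X. m x0 x * a x)) +
        (\<Sum>y\<in>Y. (m x0 y + ?q y) * g y)"
      have "(\<Sum>y\<in>Y. n0 y * g y) = (\<Sum>y\<in>Y. (m x0 y + ?q y) * g y) / (1 - p)"
        by (simp add: n0_def sum_divide_distrib)
      then have "a0 + (\<Sum>y\<in>Y. n0 y * g y) = ((1 - p) * g x0) / (1 - p)"
        unfolding * a0_def by (simp add: add_divide_distrib)
      then show ?thesis using p1 by simp
    qed
    show ?thesis
    proof (cases "x = x0")
      case True
      then show ?thesis using g0 by (simp add: a'_def N'_def)
    next
      case False
      then have "x \<in> X" using x by simp
      then have "g x = a x + N x x0 * (a0 + (\<Sum>y\<in>Y. n0 y * g y)) + (\<Sum>y\<in>Y. N x y * g y)"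
        using gX g0 by simp
      then show ?thesis using False
        by (simp add: a'_def N'_def algebra_simps sum.distrib sum_distrib_left)
    qed
  qed
  ultimately show ?case by blast
qed

text \<open>The iterates increase and are bounded by 1, so they converge; passing to the limit in
  the recursion yields the linear equations.\<close>

lemma damped_fixpoint:
  fixes v :: "nat \<Rightarrow> 'a \<Rightarrow> real"
  assumes "finite X" "\<And>x y. 0 \<le> k x y" "\<And>x. 0 \<le> b x" "\<And>x. x \<in> X \<Longrightarrow> b x + (\<Sum>y\<in>X. k x y) \<le> 1"
    "v 0 = b" "\<And>t x. v (Suc t) x = b x + (\<Sum>y\<in>X. k x y * v t y)"
  shows "\<exists>g. (\<forall>x\<in>X. (\<lambda>t. v t x) \<longlonglongrightarrow> g x) \<and> (\<forall>x\<in>X. \<forall>t. v t x \<le> g x) \<and>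
    (\<forall>x\<in>X. g x = b x + (\<Sum>y\<in>X. k x y * g y))"
proof -
  have inc: "v t x \<le> v (Suc t) x" for t x
  proof (induction t arbitrary: x)
    case 0
    then show ?case using assms(2,3) unfolding assms(5,6) by (simp add: sum_nonneg)
  next
    case (Suc t)
    have "(\<Sum>y\<in>X. k x y * v t y) \<le> (\<Sum>y\<in>X. k x y * v (Suc t) y)"
      using Suc assms(2) by (intro sum_mono mult_left_mono) auto
    then show ?case using assms(6) by simp
  qed
  have ub: "v t x \<le> 1" if "x \<in> X" for t x
    using that
  proof (induction t arbitrary: x)
    case 0
    have "0 \<le> (\<Sum>y\<in>X. k x y)" using assms(2) by (simp add: sum_nonneg)
    then show ?case using assms(4)[OF 0] assms(5) by simp
  next
    case (Suc t)
    have "(\<Sum>y\<in>X. k x y * v t y) \<le> (\<Sum>y\<in>X. k x y * 1)"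
      using Suc assms(2) by (intro sum_mono mult_left_mono) auto
    then show ?case using assms(4)[OF Suc.prems] assms(6)[of t x] by simp
  qed
  define g where "g x = (SUP t. v t x)" for x
  have lim: "(\<lambda>t. v t x) \<longlonglongrightarrow> g x" if "x \<in> X" for x
    unfolding g_def
  proof (rule LIMSEQ_incseq_SUP)
    show "bdd_above (range (\<lambda>t. v t x))" using ub[OF that] by (intro bdd_aboveI[of _ 1]) auto
    show "incseq (\<lambda>t. v t x)" by (rule incseq_SucI) (rule inc)
  qed
  have le: "v t x \<le> g x" if "x \<in> X" for t x
  proof (rule incseq_le[OF _ lim[OF that]])
    show "incseq (\<lambda>t. v t x)" by (rule incseq_SucI) (rule inc)
  qed
  have "g x = b x + (\<Sum>y\<in>X. k x y * g y)" if "x \<in> X" for x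
  proof (rule LIMSEQ_unique)
    show "(\<lambda>t. v (Suc t) x) \<longlonglongrightarrow> g x" using lim[OF that] by (rule LIMSEQ_Suc)
    show "(\<lambda>t. v (Suc t) x) \<longlonglongrightarrow> b x + (\<Sum>y\<in>X. k x y * g y)"
      unfolding assms(6) by (intro tendsto_intros lim)
  qed
  then show ?thesis using lim le by blast
qed

section \<open>Functions of two variables of bounded rank\<close>

definition sep_sum :: "(('u \<Rightarrow> real) \<times> ('v \<Rightarrow> real)) list \<Rightarrow> 'u \<Rightarrow> 'v \<Rightarrow> real" where
  "sep_sum xs u v = (\<Sum>x\<leftarrow>xs. fst x u * snd x v)"

lemma sep_sum_simps:
  "sep_sum [] u v = 0" "sep_sum (x # xs) u v = fst x u * snd x v + sep_sum xs u v"
  "sep_sum (xs @ ys) u v = sep_sum xs u v + sep_sum ys u v"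
  by (simp_all add: sep_sum_def)

text \<open>The rank of \<open>F\<close> as an infinite matrix, stated as a decomposition into
  products. In this form sums, entrywise products and thus determinants can be bounded
  directly.\<close>

definition rank_le :: "nat \<Rightarrow> ('u \<Rightarrow> 'v \<Rightarrow> real) \<Rightarrow> bool" where
  "rank_le D F \<longleftrightarrow> (\<exists>xs. length xs \<le> D \<and> F = sep_sum xs)"

lemma rank_le_left: "rank_le 1 (\<lambda>u v. f u)"
  unfolding rank_le_def by (intro exI[of _ "[(f, \<lambda>_. 1)]"]) (auto simp: sep_sum_def fun_eq_iff)

lemma rank_le_right: "rank_le 1 (\<lambda>u v. f v)"
  unfolding rank_le_def by (intro exI[of _ "[(\<lambda>_. 1, f)]"]) (auto simp: sep_sum_def fun_eq_iff)

lemma rank_le_zero: "rank_le 0 (\<lambda>u v. 0)"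
  unfolding rank_le_def by (intro exI[of _ "[]"]) (auto simp: sep_sum_def fun_eq_iff)

lemma rank_le_add:
  assumes "rank_le D F" "rank_le D' F'"
  shows "rank_le (D + D') (\<lambda>u v. F u v + F' u v)"
proof -
  obtain xs ys where "length xs \<le> D" "F = sep_sum xs" "length ys \<le> D'" "F' = sep_sum ys"
    using assms unfolding rank_le_def by blast
  then show ?thesis unfolding rank_le_def
    by (intro exI[of _ "xs @ ys"]) (auto simp: sep_sum_def fun_eq_iff)
qed

lemma rank_le_mult:
  assumes "rank_le D F" "rank_le D' F'"
  shows "rank_le (D * D') (\<lambda>u v. F u v * F' u v)"
proof -
  obtain xs ys where xs: "length xs \<le> D" "F = sep_sum xs" and ys: "length ys \<le> D'" "F' = sep_sum ys"
    using assms unfolding rank_le_def by blast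
  let ?p = "\<lambda>x y. (\<lambda>u. fst x u * fst y u, \<lambda>v. snd x v * snd y v)"
  let ?zs = "concat (map (\<lambda>x. map (?p x) ys) xs)"
  have *: "sep_sum (map (?p x) ys) u v = fst x u * snd x v * sep_sum ys u v"
    for x :: "('a \<Rightarrow> real) \<times> ('b \<Rightarrow> real)" and u v
    by (induction ys) (auto simp: sep_sum_simps algebra_simps)
  have "sep_sum (concat (map (\<lambda>x. map (?p x) ys) xs)) u v = sep_sum xs u v * sep_sum ys u v" for u v
  proof (induction xs)
    case (Cons x xs)
    have "sep_sum (concat (map (\<lambda>x. map (?p x) ys) (x # xs))) u v =
      sep_sum (map (?p x) ys) u v + sep_sum (concat (map (\<lambda>x. map (?p x) ys) xs)) u v"
      by (simp add: sep_sum_simps)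
    then show ?case by (simp only: Cons.IH * sep_sum_simps distrib_right)
  qed (simp add: sep_sum_simps)
  moreover have "length ?zs = length xs * length ys" by (induction xs) auto
  then have "length ?zs \<le> D * D'" using xs(1) ys(1) by (simp add: mult_le_mono)
  ultimately show ?thesis unfolding rank_le_def using xs(2) ys(2) by (intro exI[of _ ?zs]) (auto simp: fun_eq_iff)
qed

lemma rank_le_const_mult:
  assumes "rank_le D F"
  shows "rank_le D (\<lambda>u v. c * F u v)"
  using rank_le_mult[OF rank_le_left[of "\<lambda>_. c"] assms] by simp

lemma rank_le_sum:
  assumes "finite I" "\<And>i. i \<in> I \<Longrightarrow> rank_le D (F i)"
  shows "rank_le (card I * D) (\<lambda>u v. \<Sum>i\<in>I. F i u v)"
  using assms
proof (induction rule: finite_induct)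
  case (insert i I)
  then have "rank_le (D + card I * D) (\<lambda>u v. F i u v + (\<Sum>i\<in>I. F i u v))"
    by (intro rank_le_add) auto
  then show ?case using insert by simp
qed (simp add: rank_le_zero)

lemma rank_le_prod:
  assumes "finite I" "\<And>i. i \<in> I \<Longrightarrow> rank_le D (F i)"
  shows "rank_le (D ^ card I) (\<lambda>u v. \<Prod>i\<in>I. F i u v)"
  using assms
proof (induction rule: finite_induct)
  case empty
  show ?case using rank_le_left[of "\<lambda>_. 1"] by simp
next
  case (insert i I)
  then have "rank_le (D * D ^ card I) (\<lambda>u v. F i u v * (\<Prod>i\<in>I. F i u v))"
    by (intro rank_le_mult) auto
  then show ?case using insert by simp
qed

text \<open>A homogeneous system with more unknowns than equations has a nontrivial solution; the
  unknown at a point where the first function does not vanish is eliminated.\<close>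

lemma ex_annihilating_weights:
  fixes fs :: "('u \<Rightarrow> real) list"
  assumes "finite U" "length fs < card U"
  shows "\<exists>c. (\<exists>u\<in>U. c u \<noteq> 0) \<and> (\<forall>f\<in>set fs. (\<Sum>u\<in>U. c u * f u) = 0)"
  using assms
proof (induction "length fs" arbitrary: fs U)
  case 0
  then have "U \<noteq> {}" by auto
  then show ?case using 0 by (intro exI[of _ "\<lambda>_. 1"]) auto
next
  case (Suc n)
  then obtain f fs' where fs: "fs = f # fs'" "length fs' = n" by (metis length_Suc_conv)
  show ?case
  proof (cases "\<forall>u\<in>U. f u = 0")
    case True
    then show ?thesis using Suc.hyps(1)[of fs' U] Suc.prems fs by auto
  next
    case False
    then obtain u0 where u0: "u0 \<in> U" "f u0 \<noteq> 0" by blast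
    \<comment> \<open>Subtracting a multiple of \<open>f\<close> makes \<open>h\<close> vanish at
      \<open>u0\<close>, so that the weight of \<open>u0\<close> does not matter for it.\<close>
    let ?r = "\<lambda>h u. h u - h u0 / f u0 * f u"
    have "card (U - {u0}) = card U - 1" using u0 Suc.prems by simp
    then have "\<exists>c. (\<exists>u\<in>U - {u0}. c u \<noteq> 0) \<and> (\<forall>h\<in>set (map ?r fs'). (\<Sum>u\<in>U - {u0}. c u * h u) = 0)"
      using Suc.prems fs by (intro Suc.hyps(1)) auto
    then obtain c where c: "\<exists>u\<in>U - {u0}. c u \<noteq> 0"
      "\<And>h. h \<in> set fs' \<Longrightarrow> (\<Sum>u\<in>U - {u0}. c u * ?r h u) = 0" by auto
    \<comment> \<open>The weight at \<open>u0\<close> is determined by the requirement that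
      \<open>f\<close> be annihilated; each \<open>h\<close> then follows, being \<open>?r h\<close>
      plus a multiple of \<open>f\<close>.\<close>
    define c' where "c' = c(u0 := - (\<Sum>u\<in>U - {u0}. c u * f u) / f u0)"
    have split: "(\<Sum>u\<in>U. c' u * h u) = c' u0 * h u0 + (\<Sum>u\<in>U - {u0}. c u * h u)" for h
    proof -
      have "(\<Sum>u\<in>U. c' u * h u) = c' u0 * h u0 + (\<Sum>u\<in>U - {u0}. c' u * h u)"
        using Suc.prems u0 by (simp add: sum.remove)
      also have "(\<Sum>u\<in>U - {u0}. c' u * h u) = (\<Sum>u\<in>U - {u0}. c u * h u)"
        by (intro sum.cong) (auto simp: c'_def)
      finally show ?thesis .
    qed
    have f0: "(\<Sum>u\<in>U. c' u * f u) = 0" unfolding split using u0 by (simp add: c'_def)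
    have "(\<Sum>u\<in>U. c' u * h u) = 0" if "h \<in> set fs'" for h
    proof -
      have "(\<Sum>u\<in>U. c' u * ?r h u) = 0" unfolding split[of "?r h"] using c(2)[OF that] u0 by simp
      moreover have "(\<Sum>u\<in>U. c' u * ?r h u) = (\<Sum>u\<in>U. c' u * h u) - h u0 / f u0 * (\<Sum>u\<in>U. c' u * f u)"
        by (simp add: algebra_simps sum_subtractf sum_distrib_left)
      ultimately show ?thesis using f0 by simp
    qed
    moreover have "\<exists>u\<in>U. c' u \<noteq> 0" using c(1) by (auto simp: c'_def)
    ultimately show ?thesis using f0 fs(1) by (intro exI[of _ c']) auto
  qed
qed

text \<open>
  Weights on \<open>U\<close> that annihilate the left factors annihilate \<open>F\<close>, which is impossible for a \<open>v\<close>
  that makes \<open>F\<close> positive exactly where the weights are positive.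
\<close>

lemma card_shattered_le_rank:
  assumes "rank_le D F" "finite U"
    "\<And>S. S \<subseteq> U \<Longrightarrow> \<exists>v. \<forall>u\<in>U. if u \<in> S then F u v > 0 else F u v \<le> 0"
  shows "card U \<le> D"
proof (rule ccontr)
  assume "\<not> card U \<le> D"
  obtain xs where xs: "length xs \<le> D" "F = sep_sum xs" using assms(1) by (auto simp: rank_le_def)
  then have "length (map fst xs) < card U" using \<open>\<not> card U \<le> D\<close> by simp
  from ex_annihilating_weights[OF assms(2) this]
  obtain c0 where c0: "\<exists>u\<in>U. c0 u \<noteq> 0" "\<forall>f\<in>set (map fst xs). (\<Sum>u\<in>U. c0 u * f u) = 0" by blast
  \<comment> \<open>At least one weight has to be positive for the final sum to be strictly
    positive; if none is, all weights change sign.\<close>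
  obtain c where c: "\<exists>u\<in>U. c u > 0" "\<forall>f\<in>set (map fst xs). (\<Sum>u\<in>U. c u * f u) = 0"
  proof (cases "\<exists>u\<in>U. c0 u > 0")
    case True
    then show ?thesis using c0 that by blast
  next
    case False
    then have "\<exists>u\<in>U. - c0 u > 0" using c0(1) by (metis linorder_neqE neg_0_less_iff_less)
    then show ?thesis using c0(2) by (intro that[of "\<lambda>u. - c0 u"]) (auto simp: sum_negf)
  qed
  have z: "(\<Sum>u\<in>U. c u * F u v) = 0" for v
  proof -
    have "(\<Sum>u\<in>U. c u * sep_sum ys u v) = 0"
      if "\<forall>f\<in>set (map fst ys). (\<Sum>u\<in>U. c u * f u) = 0" for ys :: "(('a \<Rightarrow> real) \<times> ('b \<Rightarrow> real)) list"
      using that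
    proof (induction ys)
      case (Cons y ys)
      have "(\<Sum>u\<in>U. c u * sep_sum (y # ys) u v) =
        (\<Sum>u\<in>U. c u * fst y u) * snd y v + (\<Sum>u\<in>U. c u * sep_sum ys u v)"
        by (simp add: sep_sum_simps distrib_left sum.distrib sum_distrib_right mult.assoc)
      then show ?case using Cons by simp
    qed (simp add: sep_sum_def)
    then show ?thesis using c(2) xs(2) by simp
  qed
  obtain v where v: "\<forall>u\<in>U. if u \<in> {u \<in> U. c u > 0} then F u v > 0 else F u v \<le> 0"
    using assms(3)[of "{u \<in> U. c u > 0}"] by auto
  have nn: "0 \<le> c u * F u v" if "u \<in> U" for u
    using v that by (cases "c u > 0") (auto simp: mult_nonpos_nonpos)
  obtain u where "u \<in> U" "c u > 0" using c(1) by blast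
  then have "c u * F u v > 0" using v by auto
  then have "(\<Sum>u\<in>U. c u * F u v) > 0" using nn \<open>u \<in> U\<close> assms(2) by (intro sum_pos2[of _ u])
  then show False using z by simp
qed

text \<open>The Leibniz formula is a signed sum of \<open>fact n\<close> products of
  \<open>n\<close> entries, and each such product has rank at most \<open>D ^ n\<close>.\<close>

lemma rank_le_det:
  fixes a :: "'u \<Rightarrow> 'v \<Rightarrow> nat \<Rightarrow> nat \<Rightarrow> real"
  assumes "\<And>i j. i < n \<Longrightarrow> j < n \<Longrightarrow> rank_le D (\<lambda>u v. a u v i j)"
  shows "rank_le (fact n * D ^ n) (\<lambda>u v. Determinant.det (mat n n (\<lambda>(i, j). a u v i j)))"
proof -
  have e: "Determinant.det (mat n n (\<lambda>(i, j). a u v i j)) =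
    (\<Sum>p\<in>{p. p permutes {0..<n}}. signof p * (\<Prod>i\<in>{0..<n}. a u v i (p i)))" for u v
    by (subst det_def'[of _ n]) (auto intro!: sum.cong prod.cong simp: dest: permutes_in_image)
  have "rank_le (card {p. p permutes {0..<n}} * D ^ card {0..<n})
    (\<lambda>u v. \<Sum>p\<in>{p. p permutes {0..<n}}. signof p * (\<Prod>i\<in>{0..<n}. a u v i (p i)))"
    using assms
    by (intro rank_le_sum rank_le_const_mult rank_le_prod) (auto simp: finite_permutations dest: permutes_in_image)
  then show ?thesis unfolding e by (simp add: card_permutations[OF refl])
qed

text \<open>A vector in the kernel is a fixed point of \<open>c\<close>, but \<open>c\<close>
  shrinks the largest absolute value of its entries at least by the factor
  \<open>z < 1\<close>.\<close>

lemma contraction_det_nonzero: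
  fixes c :: "nat \<Rightarrow> nat \<Rightarrow> real"
  assumes "\<And>i j. i < n \<Longrightarrow> j < n \<Longrightarrow> 0 \<le> c i j" "\<And>i. i < n \<Longrightarrow> (\<Sum>j<n. c i j) \<le> z" "z < 1"
  shows "Determinant.det (mat n n (\<lambda>(i, j). (if i = j then 1 else 0) - c i j)) \<noteq> 0"
proof
  let ?A = "mat n n (\<lambda>(i, j). (if i = j then 1 else 0) - c i j)"
  assume "Determinant.det ?A = 0"
  then obtain x where x: "x \<in> carrier_vec n" "x \<noteq> 0\<^sub>v n" "?A *\<^sub>v x = 0\<^sub>v n"
    using det_0_iff_vec_prod_zero[of ?A n] by auto
  have fix_x: "x $ i = (\<Sum>j<n. c i j * x $ j)" if "i < n" for i
  proof -
    have "0 = (?A *\<^sub>v x) $ i" using x that by simp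
    also have "\<dots> = (\<Sum>j<n. ((if i = j then 1 else 0) - c i j) * x $ j)"
      using that x(1) by (auto simp: scalar_prod_def atLeast0LessThan intro!: sum.cong)
    also have "\<dots> = (\<Sum>j<n. (if i = j then x $ j else 0)) - (\<Sum>j<n. c i j * x $ j)"
      by (subst sum_subtractf[symmetric]) (auto intro!: sum.cong simp: algebra_simps)
    also have "(\<Sum>j<n. (if i = j then x $ j else 0)) = x $ i" using that by simp
    finally show ?thesis by simp
  qed
  obtain i0 where i0: "i0 < n" "x $ i0 \<noteq> 0"
    using x(1,2) by (metis carrier_vecD eq_vecI index_zero_vec(1) index_zero_vec(2))
  define m where "m = Max ((\<lambda>i. \<bar>x $ i\<bar>) ` {..<n})"
  have le: "\<bar>x $ i\<bar> \<le> m" if "i < n" for i using that by (auto simp: m_def)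
  have "m \<in> (\<lambda>i. \<bar>x $ i\<bar>) ` {..<n}" unfolding m_def using i0 by (intro Max_in) auto
  then obtain i where i: "i < n" "m = \<bar>x $ i\<bar>" by auto
  have m0: "m > 0" using le[OF i0(1)] i0(2) by linarith
  have "m = \<bar>\<Sum>j<n. c i j * x $ j\<bar>" using i fix_x by simp
  also have "\<dots> \<le> (\<Sum>j<n. \<bar>c i j * x $ j\<bar>)" by (rule sum_abs)
  also have "\<dots> \<le> (\<Sum>j<n. c i j * m)"
    using le assms(1) i(1) by (intro sum_mono) (auto simp: abs_mult intro!: mult_mono)
  also have "\<dots> = (\<Sum>j<n. c i j) * m" by (simp add: sum_distrib_right)
  also have "\<dots> \<le> z * m" using assms(2)[OF i(1)] m0 by (intro mult_right_mono) auto
  also have "\<dots> < 1 * m" using assms(3) m0 by (intro mult_strict_right_mono)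
  finally show False by simp
qed

text \<open>Substituting the equations of one side into the other leaves a system with matrix
  \<open>I - B A\<close> for the \<open>n\<close> border values, whose entries have rank at most
  \<open>n + 1\<close>. By Cramer's rule each border value is a quotient with denominator
  \<open>d\<close>. Multiplying \<open>F\<close> by the square of \<open>d\<close> clears the
  denominators without changing the sign of \<open>F\<close>, whatever the sign of
  \<open>d\<close>.\<close>

lemma rank_le_coupled_solution:
  fixes A :: "'u \<Rightarrow> nat \<Rightarrow> nat \<Rightarrow> real" and B :: "'v \<Rightarrow> nat \<Rightarrow> nat \<Rightarrow> real"
  assumes z: "0 \<le> z" "z < 1"
    and A: "\<And>u i j. i < n \<Longrightarrow> j < n \<Longrightarrow> 0 \<le> A u i j" "\<And>u i. i < n \<Longrightarrow> (\<Sum>j<n. A u i j) \<le> z"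
    and B: "\<And>v i j. i < n \<Longrightarrow> j < n \<Longrightarrow> 0 \<le> B v i j" "\<And>v i. i < n \<Longrightarrow> (\<Sum>j<n. B v i j) \<le> z"
    and g: "\<And>u v i. i < n \<Longrightarrow> g u v i = b v i + (\<Sum>k<n. B v i k * (a u k + (\<Sum>j<n. A u k j * g u v j)))"
    and F: "\<And>u v. F u v = a' u + (\<Sum>j<n. A' u j * g u v j)"
  shows "\<exists>d. (\<forall>u v. d u v \<noteq> 0) \<and>
    rank_le ((n + 1) * (fact n * (n + 1) ^ n)\<^sup>2) (\<lambda>u v. F u v * (d u v)\<^sup>2)"
proof -
  define c where "c u v i j = (\<Sum>k<n. B v i k * A u k j)" for u v i j
  define e where "e u v i = b v i + (\<Sum>k<n. B v i k * a u k)" for u v i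
  define M where "M u v = mat n n (\<lambda>(i, j). (if i = j then 1 else 0) - c u v i j)" for u v
  define d where "d u v = Determinant.det (M u v)" for u v
  define d' where "d' k u v = Determinant.det (mat n n (\<lambda>(i, j). if j = k then e u v i
      else (if i = j then 1 else 0) - c u v i j))" for k u v
  have "d u v \<noteq> 0" for u v
    unfolding d_def M_def
  proof (rule contraction_det_nonzero[OF _ _ z(2)])
    show "0 \<le> c u v i j" if "i < n" "j < n" for i j
      using that A B by (auto simp: c_def intro!: sum_nonneg)
    show "(\<Sum>j<n. c u v i j) \<le> z" if "i < n" for i
    proof -
      have "(\<Sum>j<n. c u v i j) = (\<Sum>k<n. B v i k * (\<Sum>j<n. A u k j))"
        unfolding c_def by (subst sum.swap) (simp add: sum_distrib_left)
      also have "\<dots> \<le> (\<Sum>k<n. B v i k * 1)"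
      proof (intro sum_mono mult_left_mono)
        fix k assume k: "k \<in> {..<n}"
        then show "(\<Sum>j<n. A u k j) \<le> 1" using A(2)[of k u] z(2) by simp
        show "0 \<le> B v i k" using k that B(1) by simp
      qed
      finally show ?thesis using B(2)[OF that, of v] by simp
    qed
  qed
  moreover have cramer: "g u v k * d u v = d' k u v" if k: "k < n" for u v k
  proof -
    let ?x = "vec n (g u v)"
    have M: "M u v \<in> carrier_mat n n" by (simp add: M_def)
    have "M u v *\<^sub>v ?x = vec n (e u v)"
    proof (rule eq_vecI)
      fix i assume "i < dim_vec (vec n (e u v))"
      then have i: "i < n" by simp
      have "(M u v *\<^sub>v ?x) $ i = (\<Sum>j<n. ((if i = j then 1 else 0) - c u v i j) * g u v j)"
        using i by (auto simp: M_def scalar_prod_def atLeast0LessThan intro!: sum.cong)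
      also have "\<dots> = (\<Sum>j<n. (if i = j then g u v j else 0)) - (\<Sum>j<n. c u v i j * g u v j)"
        by (subst sum_subtractf[symmetric]) (auto intro!: sum.cong simp: algebra_simps)
      also have "(\<Sum>j<n. (if i = j then g u v j else 0)) = g u v i" using i by simp
      also have "(\<Sum>j<n. c u v i j * g u v j) = (\<Sum>k<n. B v i k * (\<Sum>j<n. A u k j * g u v j))"
        unfolding c_def sum_distrib_right sum_distrib_left by (subst sum.swap) (simp add: mult.assoc)
      also have "g u v i = e u v i + (\<Sum>k<n. B v i k * (\<Sum>j<n. A u k j * g u v j))"
        unfolding g[OF i] e_def by (simp add: distrib_left sum.distrib)
      finally show "(M u v *\<^sub>v ?x) $ i = vec n (e u v) $ i" using i by simp
    qed (simp add: M_def)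
    then have "?x $ k * d u v = Determinant.det (replace_col (M u v) (vec n (e u v)) k)"
      using cramer_lemma_mat[OF M _ k, of ?x] by (simp add: d_def)
    also have "replace_col (M u v) (vec n (e u v)) k = mat n n (\<lambda>(i, j). if j = k then e u v i
      else (if i = j then 1 else 0) - c u v i j)"
      by (rule eq_matI) (auto simp: replace_col_def M_def)
    finally show ?thesis using k by (simp add: d'_def)
  qed
  have prod1: "rank_le 1 (\<lambda>u v. B v i k * h u k)" for i k and h :: "'u \<Rightarrow> nat \<Rightarrow> real"
    using rank_le_mult[OF rank_le_right[of "\<lambda>v. B v i k"] rank_le_left[of "\<lambda>u. h u k"]] by simp
  have sums: "rank_le n (\<lambda>u v. \<Sum>k<n. B v i k * h u k)" for i and h :: "'u \<Rightarrow> nat \<Rightarrow> real"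
    using rank_le_sum[of "{..<n}" 1 "\<lambda>k u v. B v i k * h u k"] prod1 by simp
  have re: "rank_le (n + 1) (\<lambda>u v. e u v i)" for i
    unfolding e_def using rank_le_add[OF rank_le_right[of "\<lambda>v. b v i"] sums[of i a]] by simp
  have rc: "rank_le (n + 1) (\<lambda>u v. (if i = j then 1 else 0) - c u v i j)" for i j :: nat
    unfolding c_def
    using rank_le_add[OF rank_le_left[of "\<lambda>_. if i = j then 1 else 0"]
        rank_le_const_mult[OF sums[of i "\<lambda>u k. A u k j"], of "- 1"]] by simp
  let ?D = "fact n * (n + 1) ^ n"
  have rd: "rank_le ?D d" unfolding d_def M_def using rc by (rule rank_le_det)
  have rd': "rank_le ?D (d' k)" for k
    unfolding d'_def
  proof (rule rank_le_det)
    show "rank_le (n + 1) (\<lambda>u v. if j = k then e u v i else (if i = j then 1 else 0) - c u v i j)" for i j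
      using re[of i] rc[of i j] by (cases "j = k") simp_all
  qed
  have "rank_le (?D * (1 * ?D + n * (1 * ?D)))
    (\<lambda>u v. d u v * (a' u * d u v + (\<Sum>k<n. A' u k * d' k u v)))"
    using rank_le_sum[of "{..<n}" "1 * ?D" "\<lambda>k u v. A' u k * d' k u v"]
      rank_le_mult[OF rank_le_left rd'] 
    by (intro rank_le_mult[OF rd] rank_le_add rank_le_mult[OF rank_le_left rd]) auto
  moreover have "d u v * (a' u * d u v + (\<Sum>k<n. A' u k * d' k u v)) = F u v * (d u v)\<^sup>2" for u v
  proof -
    have "(\<Sum>k<n. A' u k * d' k u v) = (\<Sum>k<n. A' u k * g u v k) * d u v"
      unfolding sum_distrib_right by (intro sum.cong refl) (simp flip: cramer)
    then show ?thesis unfolding F by (simp add: power2_eq_square algebra_simps)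
  qed
  moreover have "?D * (1 * ?D + n * (1 * ?D)) = (n + 1) * ?D\<^sup>2"
    by (simp add: power2_eq_square algebra_simps)
  ultimately show ?thesis by (intro exI[of _ d]) simp
qed

section \<open>Probabilistic machines in small space\<close>

text \<open>A configuration without its input position and its WOM. Under a space bound there are
  only finitely many cores, and together with an input position a core determines the acceptance
  probability.\<close>

type_synonym core = "nat \<times> int \<times> (int \<Rightarrow> nat)"

definition core_of :: "config \<Rightarrow> core" where
  "core_of c = (state c, work_pos c, work_tape c)"

definition core_symbol :: "core \<Rightarrow> nat" where
  "core_symbol i = snd (snd i) (fst (snd i))"

definition core_next :: "action \<Rightarrow> core \<Rightarrow> core" where
  "core_next a i = (new_state a, fst (snd i) + Defs.shift (work_move a),
     (snd (snd i))(fst (snd i) := work_write a))"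

definition pos_next :: "action \<Rightarrow> nat \<Rightarrow> nat" where
  "pos_next a p = nat (int p + Defs.shift (input_move a))"

lemma core_perform: "core_of (perform a c) = core_next a (core_of c)"
  "input_pos (perform a c) = pos_next a (input_pos c)"
  by (simp_all add: core_of_def core_next_def pos_next_def perform_def)

lemma pos_next_bounds: "pos_next a p \<le> p + 1" "p \<le> pos_next a p + 1"
  by (cases "input_move a"; simp add: pos_next_def)+

lemma pos_next_add: "p \<ge> 1 \<Longrightarrow> pos_next a (p + k) = pos_next a p + k"
  by (cases "input_move a"; simp add: pos_next_def)

definition core_choices :: "ptm_wom \<Rightarrow> nat list \<Rightarrow> core \<times> nat \<Rightarrow> action pmf" where
  "core_choices M w x = trans M (fst (fst x)) (input_at w (snd x)) (core_symbol (fst x))"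

definition target :: "action \<Rightarrow> core \<times> nat \<Rightarrow> core \<times> nat" where
  "target a x = (core_next a (fst x), pos_next a (snd x))"

text \<open>Rows of halting cores are zero, so an accepting core is counted once, through
  \<open>accepting\<close>, and this value plus the row sum stays at most 1.\<close>

definition transition :: "ptm_wom \<Rightarrow> nat list \<Rightarrow> core \<times> nat \<Rightarrow> core \<times> nat \<Rightarrow> real" where
  "transition M w x y = (if fst (fst x) \<in> {accept_state M, reject_state M} then 0
     else \<Sum>a\<in>actions M. if target a x = y then pmf (core_choices M w x) a else 0)"

definition accepting :: "ptm_wom \<Rightarrow> core \<times> nat \<Rightarrow> real" where
  "accepting M x = of_bool (fst (fst x) = accept_state M)"

lemma transition_nonneg: "0 \<le> transition M w x y"
  by (auto simp: transition_def intro!: sum_nonneg)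

lemma transition_cong:
  assumes "fst x = fst x'" "input_at w (snd x) = input_at w' (snd x')"
    "\<And>a. target a x = y \<longleftrightarrow> target a x' = y'"
  shows "transition M w x y = transition M w' x' y'"
proof -
  have "core_choices M w x = core_choices M w' x'"
    using assms(1,2) by (simp add: core_choices_def)
  then show ?thesis unfolding transition_def assms(3) by (simp add: assms(1) cong: if_cong)
qed

lemma transition_far: "snd y > snd x + 1 \<or> snd y + 1 < snd x \<Longrightarrow> transition M w x y = 0"
  using pos_next_bounds[where p = "snd x"]
  by (force simp: transition_def target_def not_le intro!: sum.neutral dest: leD)

lemma sum_transition:
  assumes "finite Y" "fst (fst x) \<notin> {accept_state M, reject_state M}"
  shows "(\<Sum>y\<in>Y. transition M w x y * f y) =
    (\<Sum>a\<in>actions M. if target a x \<in> Y then pmf (core_choices M w x) a * f (target a x) else 0)"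
proof -
  have "(\<Sum>y\<in>Y. transition M w x y * f y) =
    (\<Sum>y\<in>Y. \<Sum>a\<in>actions M. if target a x = y then pmf (core_choices M w x) a * f y else 0)"
    using assms(2) by (auto simp: transition_def sum_distrib_right intro!: sum.cong)
  also have "\<dots> = (\<Sum>a\<in>actions M. \<Sum>y\<in>Y. if target a x = y then pmf (core_choices M w x) a * f y else 0)"
    by (rule sum.swap)
  finally show ?thesis using assms(1) by simp
qed

lemma sum_transition_le_1:
  assumes "finite Y" "finite (actions M)"
  shows "(\<Sum>y\<in>Y. transition M w x y) \<le> 1"
proof (cases "fst (fst x) \<in> {accept_state M, reject_state M}")
  case True
  then show ?thesis by (simp add: transition_def)
next
  case False
  have "(\<Sum>y\<in>Y. transition M w x y) =
    (\<Sum>a\<in>actions M. if target a x \<in> Y then pmf (core_choices M w x) a else 0)"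
    using sum_transition[OF assms(1) False, of w "\<lambda>_. 1"] by (simp cong: if_cong)
  also have "\<dots> \<le> (\<Sum>a\<in>actions M. pmf (core_choices M w x) a)"
    by (intro sum_mono) auto
  also have "\<dots> = measure_pmf.prob (core_choices M w x) (actions M)"
    using assms(2) by (simp add: measure_measure_pmf_finite)
  finally show ?thesis using measure_pmf.prob_le_1 order_trans by blast
qed

text \<open>
  Probability of acceptance within \<open>t\<close> steps, discounted by \<open>z\<close> per step, on runs whose
  cores stay in \<open>J\<close>. The discount makes the associated linear systems nonsingular.
\<close>

fun damped :: "ptm_wom \<Rightarrow> core set \<Rightarrow> real \<Rightarrow> nat list \<Rightarrow> nat \<Rightarrow> core \<times> nat \<Rightarrow> real" where
  "damped M J z w 0 x = accepting M x"
| "damped M J z w (Suc t) x = accepting M x +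
     (\<Sum>y\<in>J \<times> {..length w + 1}. z * transition M w x y * damped M J z w t y)"

definition damped_value :: "ptm_wom \<Rightarrow> core set \<Rightarrow> real \<Rightarrow> nat list \<Rightarrow> core \<times> nat \<Rightarrow> real" where
  "damped_value M J z w x = lim (\<lambda>t. damped M J z w t x)"

lemma damped_value:
  assumes "finite J" "finite (actions M)" "0 \<le> z" "z \<le> 1" "x \<in> J \<times> {..length w + 1}"
  shows "(\<lambda>t. damped M J z w t x) \<longlonglongrightarrow> damped_value M J z w x"
    "damped M J z w t x \<le> damped_value M J z w x"
    "damped_value M J z w x = accepting M x +
       (\<Sum>y\<in>J \<times> {..length w + 1}. z * transition M w x y * damped_value M J z w y)"
proof -
  let ?X = "J \<times> {..length w + 1}"
  have "\<exists>g. (\<forall>x\<in>?X. (\<lambda>t. damped M J z w t x) \<longlonglongrightarrow> g x) \<and> (\<forall>x\<in>?X. \<forall>t. damped M J z w t x \<le> g x) \<and>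
    (\<forall>x\<in>?X. g x = accepting M x + (\<Sum>y\<in>?X. z * transition M w x y * g y))"
  proof (rule damped_fixpoint)
    show "finite ?X" using assms(1) by simp
    show "accepting M x + (\<Sum>y\<in>?X. z * transition M w x y) \<le> 1" for x
    proof (cases "fst (fst x) \<in> {accept_state M, reject_state M}")
      case True
      then show ?thesis by (auto simp: transition_def accepting_def)
    next
      case False
      have "(\<Sum>y\<in>?X. z * transition M w x y) \<le> (\<Sum>y\<in>?X. transition M w x y)"
        using assms(4) transition_nonneg by (intro sum_mono mult_left_le_one_le) (auto simp: assms(3))
      also have "\<dots> \<le> 1" using assms(1,2) by (intro sum_transition_le_1) auto
      finally show ?thesis using False by (simp add: accepting_def)
    qed
  qed (use assms transition_nonneg in \<open>auto simp: accepting_def fun_eq_iff\<close>)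
  then obtain g where g: "\<forall>x\<in>?X. (\<lambda>t. damped M J z w t x) \<longlonglongrightarrow> g x"
    "\<forall>x\<in>?X. \<forall>t. damped M J z w t x \<le> g x"
    "\<forall>x\<in>?X. g x = accepting M x + (\<Sum>y\<in>?X. z * transition M w x y * g y)"
    by (elim exE conjE)
  have e: "damped_value M J z w x = g x" if "x \<in> ?X" for x
    unfolding damped_value_def using g(1) that by (intro limI) blast
  show "(\<lambda>t. damped M J z w t x) \<longlonglongrightarrow> damped_value M J z w x"
    unfolding e[OF assms(5)] using g(1) assms(5) by blast
  show "damped M J z w t x \<le> damped_value M J z w x"
    unfolding e[OF assms(5)] using g(2) assms(5) by blast
  have "g x = accepting M x + (\<Sum>y\<in>?X. z * transition M w x y * g y)" using g(3) assms(5) by blast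
  also have "(\<Sum>y\<in>?X. z * transition M w x y * g y) = (\<Sum>y\<in>?X. z * transition M w x y * damped_value M J z w y)"
    by (intro sum.cong refl) (simp add: e)
  finally show "damped_value M J z w x = accepting M x +
       (\<Sum>y\<in>?X. z * transition M w x y * damped_value M J z w y)" using e[OF assms(5)] by simp
qed

text \<open>\<open>N\<close> holds the discounted probabilities of leaving the positions \<open>P\<close> at position \<open>q\<close>.\<close>

definition response :: "ptm_wom \<Rightarrow> core set \<Rightarrow> real \<Rightarrow> nat list \<Rightarrow> nat set \<Rightarrow> nat \<Rightarrow>
    (core \<times> nat \<Rightarrow> real) \<Rightarrow> (core \<times> nat \<Rightarrow> core \<times> nat \<Rightarrow> real) \<Rightarrow> bool" where
  "response M J z w P q a N \<longleftrightarrow>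
    (\<forall>x\<in>J \<times> P. \<forall>y\<in>J \<times> {q}. 0 \<le> N x y) \<and> (\<forall>x\<in>J \<times> P. (\<Sum>y\<in>J \<times> {q}. N x y) \<le> z) \<and>
    (\<forall>g. (\<forall>x\<in>J \<times> P. g x = accepting M x + (\<Sum>y\<in>J \<times> P \<union> J \<times> {q}. z * transition M w x y * g y)) \<longrightarrow>
       (\<forall>x\<in>J \<times> P. g x = a x + (\<Sum>y\<in>J \<times> {q}. N x y * g y)))"

lemma ex_response:
  assumes "finite J" "finite (actions M)" "0 \<le> z" "z < 1" "finite P" "q \<notin> P"
  shows "\<exists>a N. response M J z w P q a N"
  unfolding response_def
proof (rule eliminate_interior)
  show "(\<Sum>y\<in>J \<times> P \<union> J \<times> {q}. z * transition M w x y) \<le> z" for x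
    using sum_transition_le_1[of "J \<times> P \<union> J \<times> {q}" M w x] assms
    by (simp add: sum_distrib_left[symmetric] mult_left_le)
qed (use assms transition_nonneg in auto)

text \<open>A step from a position up to \<open>length u\<close> reads a symbol that
  \<open>u\<close> determines. Position \<open>length u + 1\<close>, which holds a different symbol
  in \<open>u\<close> alone, occurs only as the target of a step.\<close>

lemma damped_value_left:
  assumes "finite J" "finite (actions M)" "0 \<le> z" "z \<le> 1" "x \<in> J \<times> {..length u}"
  shows "damped_value M J z (u @ v) x = accepting M x +
    (\<Sum>y\<in>J \<times> {..length u} \<union> J \<times> {length u + 1}. z * transition M u x y * damped_value M J z (u @ v) y)"
proof -
  let ?w = "u @ v" let ?g = "damped_value M J z ?w" let ?Y = "J \<times> {..length u} \<union> J \<times> {length u + 1}"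
  let ?f = "\<lambda>y. z * transition M ?w x y * ?g y"
  let ?X = "J \<times> {..length ?w + 1}"
  have "?g x = accepting M x + (\<Sum>y\<in>?X. ?f y)"
    using assms by (intro damped_value) auto
  also have "(\<Sum>y\<in>?X. ?f y) =
    (\<Sum>y\<in>?Y. z * transition M u x y * ?g y)"
  proof (rule sum.mono_neutral_cong_right)
    have "transition M ?w x y = transition M u x y" for y
      using assms(5) by (intro transition_cong) (auto simp: input_at_def nth_append)
    then show "?f y = z * transition M u x y * ?g y" for y
      by simp
    show "\<forall>y\<in>?X - (?Y). ?f y = 0"
    proof
      fix y assume "y \<in> ?X - (?Y)"
      then have "snd y > snd x + 1" using assms(5) by auto
      then show "?f y = 0" by (simp add: transition_far)
    qed
  qed (use assms in auto)
  finally show ?thesis .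
qed

text \<open>Positions are shifted by \<open>length u\<close>, so that position 0 of
  \<open>v\<close>, its left end-marker, stands for the last position of the left part. It occurs
  only as the target of a step; from position 1 on, both the scanned symbols and the moves commute
  with the shift.\<close>

lemma damped_value_right:
  fixes M :: ptm_wom and J :: "core set" and z :: real and u v :: "nat list"
  defines "h \<equiv> \<lambda>x. damped_value M J z (u @ v) (fst x, snd x + length u)"
  assumes "finite J" "finite (actions M)" "0 \<le> z" "z \<le> 1" "x \<in> J \<times> {1..length v + 1}"
  shows "h x = accepting M x +
    (\<Sum>y\<in>J \<times> {1..length v + 1} \<union> J \<times> {0}. z * transition M v x y * h y)"
proof -
  let ?w = "u @ v" let ?g = "damped_value M J z ?w"
  let ?X = "J \<times> {..length ?w + 1}" let ?Y = "J \<times> {1..length v + 1} \<union> J \<times> {0}"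
  let ?s = "\<lambda>x :: core \<times> nat. (fst x, snd x + length u)"
  let ?f = "\<lambda>y. z * transition M ?w (?s x) y * ?g y"
  have "h x = accepting M (?s x) + (\<Sum>y\<in>?X. ?f y)"
    unfolding h_def using assms by (intro damped_value) auto
  also have "(\<Sum>y\<in>?X. ?f y) =
    (\<Sum>y\<in>?s ` ?Y. ?f y)"
  proof (rule sum.mono_neutral_right)
    show "\<forall>y\<in>?X - ?s ` ?Y. ?f y = 0"
    proof
      fix y assume y: "y \<in> ?X - ?s ` ?Y"
      have "snd y < length u"
      proof (rule ccontr)
        assume *: "\<not> ?thesis"
        have "y = ?s (fst y, snd y - length u)" using * by (cases y) auto
        moreover have "(fst y, snd y - length u) \<in> ?Y" using y * by (cases y) auto
        ultimately show False using y by blast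
      qed
      then have "snd y + 1 < snd (?s x)" using assms(6) by auto
      then show "?f y = 0" by (simp add: transition_far)
    qed
  qed (use assms in auto)
  also have "\<dots> = (\<Sum>y\<in>?Y. z * transition M ?w (?s x) (?s y) * h y)"
    unfolding h_def by (subst sum.reindex) (auto simp: inj_on_def prod_eq_iff)
  also have "\<dots> = (\<Sum>y\<in>?Y. z * transition M v x y * h y)"
  proof (intro sum.cong refl)
    fix y
    have "transition M ?w (?s x) (?s y) = transition M v x y"
    proof (rule transition_cong)
      show "input_at ?w (snd (?s x)) = input_at v (snd x)"
        using assms(6) by (auto simp: input_at_def nth_append)
      show "target a (?s x) = ?s y \<longleftrightarrow> target a x = y" for a
        using assms(6) by (auto simp: target_def pos_next_add prod_eq_iff)
    qed simp
    then show "z * transition M ?w (?s x) (?s y) * h y = z * transition M v x y * h y" by simp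
  qed
  finally show ?thesis by (simp add: accepting_def)
qed

text \<open>The input is cut between the positions \<open>length u\<close> and
  \<open>length u + 1\<close>. The matrix \<open>A\<close> leads from the former to the latter
  through the left part, \<open>B\<close> back through the right part, and \<open>g\<close> holds
  the values at \<open>length u + 1\<close>. The threshold is absorbed into the term that depends on
  \<open>u\<close> only.\<close>

lemma rank_le_damped_value:
  assumes J: "finite J" "i0 \<in> J" and M: "finite (actions M)" and z: "0 \<le> z" "z < 1"
  shows "\<exists>d. (\<forall>u v. d u v \<noteq> 0) \<and>
    rank_le ((card J + 1) * (fact (card J) * (card J + 1) ^ card J)\<^sup>2)
      (\<lambda>u v. (damped_value M J z (u @ v) (i0, 0) - \<theta>) * (d u v)\<^sup>2)"
proof -
  let ?g = "damped_value M J z"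
  define n where "n = card J"
  obtain e where e: "bij_betw e {..<n} J"
    using ex_bij_betw_nat_finite[OF J(1)] by (auto simp: n_def atLeast0LessThan)
  have eJ: "e k \<in> J" if "k < n" for k using bij_betwE[OF e] that by auto
  have reindex: "(\<Sum>y\<in>J \<times> {q}. f y) = (\<Sum>k<n. f (e k, q))" for f :: "core \<times> nat \<Rightarrow> real" and q
  proof -
    have "bij_betw (\<lambda>k. (e k, q)) {..<n} (J \<times> {q})"
      using e by (auto simp: bij_betw_def inj_on_def)
    then show ?thesis by (rule sum.reindex_bij_betw[symmetric])
  qed
  have "\<forall>u. \<exists>p. response M J z u {..length u} (length u + 1) (fst p) (snd p)"
    using ex_response[OF J(1) M z] by simp
  from choice[OF this] obtain L where L: "\<And>u. response M J z u {..length u} (length u + 1) (fst (L u)) (snd (L u))"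
    by blast
  have "\<forall>v. \<exists>p. response M J z v {1..length v + 1} 0 (fst p) (snd p)"
    using ex_response[OF J(1) M z] by simp
  from choice[OF this] obtain R where R: "\<And>v. response M J z v {1..length v + 1} 0 (fst (R v)) (snd (R v))"
    by blast
  define g where "g u v i = ?g (u @ v) (e i, length u + 1)" for u v i
  have left: "?g (u @ v) (i, p) = fst (L u) (i, p) +
    (\<Sum>j<n. snd (L u) (i, p) (e j, length u + 1) * g u v j)" if "i \<in> J" "p \<le> length u" for u v i p
  proof -
    have "\<forall>x\<in>J \<times> {..length u}. ?g (u @ v) x = fst (L u) x +
      (\<Sum>y\<in>J \<times> {length u + 1}. snd (L u) x y * ?g (u @ v) y)"
      using L[of u] damped_value_left[OF J(1) M z(1) less_imp_le[OF z(2)]]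
      unfolding response_def by blast
    then show ?thesis using that unfolding reindex g_def by auto
  qed
  have right: "g u v i = fst (R v) (e i, 1) + (\<Sum>k<n. snd (R v) (e i, 1) (e k, 0) *
      ?g (u @ v) (e k, length u))" if "i < n" for u v i
  proof -
    let ?h = "\<lambda>x. ?g (u @ v) (fst x, snd x + length u)"
    have "\<forall>x\<in>J \<times> {1..length v + 1}. ?h x = fst (R v) x + (\<Sum>y\<in>J \<times> {0}. snd (R v) x y * ?h y)"
      using R[of v] damped_value_right[OF J(1) M z(1) less_imp_le[OF z(2)]]
      unfolding response_def by (elim conjE allE[of _ ?h] impE) blast+
    then have "?h (e i, 1) = fst (R v) (e i, 1) + (\<Sum>y\<in>J \<times> {0}. snd (R v) (e i, 1) y * ?h y)"
      using eJ[OF that] by (elim ballE[of _ _ "(e i, 1)"]) auto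
    then show ?thesis unfolding reindex g_def by (simp add: add.commute)
  qed
  have "\<exists>d. (\<forall>u v. d u v \<noteq> 0) \<and>
    rank_le ((n + 1) * (fact n * (n + 1) ^ n)\<^sup>2)
      (\<lambda>u v. (?g (u @ v) (i0, 0) - \<theta>) * (d u v)\<^sup>2)"
  proof (rule rank_le_coupled_solution[where g = g and A = "\<lambda>u k j. snd (L u) (e k, length u) (e j, length u + 1)"
      and a = "\<lambda>u k. fst (L u) (e k, length u)" and B = "\<lambda>v i k. snd (R v) (e i, 1) (e k, 0)"
      and b = "\<lambda>v i. fst (R v) (e i, 1)" and a' = "\<lambda>u. fst (L u) (i0, 0) - \<theta>"
      and A' = "\<lambda>u j. snd (L u) (i0, 0) (e j, length u + 1)", OF z])
    fix u v i j
    show "0 \<le> snd (L u) (e i, length u) (e j, length u + 1)" if "i < n" "j < n"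
      using L[of u] eJ that unfolding response_def by blast
    show "(\<Sum>j<n. snd (L u) (e i, length u) (e j, length u + 1)) \<le> z" if "i < n"
      using L[of u] eJ that unfolding response_def reindex by auto
    show "0 \<le> snd (R v) (e i, 1) (e j, 0)" if "i < n" "j < n"
    proof -
      have "(e i, 1) \<in> J \<times> {1..length v + 1}" "(e j, 0) \<in> J \<times> {0}" using eJ that by auto
      then show ?thesis using R[of v] unfolding response_def by blast
    qed
    show "(\<Sum>j<n. snd (R v) (e i, 1) (e j, 0)) \<le> z" if "i < n"
    proof -
      have "(e i, 1) \<in> J \<times> {1..length v + 1}" using eJ that by auto
      then show ?thesis using R[of v] unfolding response_def reindex by blast
    qed
    show "g u v i = fst (R v) (e i, 1) + (\<Sum>k<n. snd (R v) (e i, 1) (e k, 0) *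
      (fst (L u) (e k, length u) + (\<Sum>j<n. snd (L u) (e k, length u) (e j, length u + 1) * g u v j)))"
      if "i < n"
      using right[OF that, of u v] eJ by (simp add: left)
    show "?g (u @ v) (i0, 0) - \<theta> = fst (L u) (i0, 0) - \<theta> +
      (\<Sum>j<n. snd (L u) (i0, 0) (e j, length u + 1) * g u v j)"
      using left[OF J(2), of 0 u v] by simp
  qed
  then show ?thesis by (simp add: n_def)
qed

text \<open>The induction is over ends of paths because only reachable cores are known to lie in
  \<open>J\<close>. For them the restriction of the sum to \<open>J\<close> loses nothing, and each
  step costs at most a factor \<open>z\<close>.\<close>

lemma damped_bounds:
  assumes M: "ptm_wom M" "w \<in> lists (alphabet M)" and J: "finite J" and z: "0 \<le> z" "z \<le> 1"
    and reach: "\<And>cs. ptm_path M w cs \<Longrightarrow> core_of (last cs) \<in> J"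
    and cs: "ptm_path M w cs"
  shows "z ^ t * accept_within M w t (last cs) \<le> damped M J z w t (core_of (last cs), input_pos (last cs)) \<and>
    damped M J z w t (core_of (last cs), input_pos (last cs)) \<le> accept_within M w t (last cs)"
  using cs
proof (induction t arbitrary: cs)
  case 0
  then show ?case by (simp add: accept_within_0 accepting_def core_of_def)
next
  case (Suc t)
  let ?c = "last cs" let ?x = "(core_of ?c, input_pos ?c)" and ?X = "J \<times> {..length w + 1}"
  let ?p = "\<lambda>a. pmf (choices M w ?c) a" and ?D = "\<lambda>a. damped M J z w t (target a ?x)"
    and ?A = "\<lambda>a. accept_within M w t (perform a ?c)"
  have c: "?c \<in> configs M w" by (rule ptm_path_last_in_configs[OF M Suc.prems])
  show ?case
  proof (cases "live M ?c")
    case False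
    then have "damped M J z w (Suc t) ?x = of_bool (state ?c = accept_state M)"
      by (auto simp: accepting_def core_of_def transition_def live_def)
    then show ?thesis using False z by (simp add: accept_within_halted mult_le_one power_le_one)
  next
    case True
    have h: "fst (fst ?x) \<notin> {accept_state M, reject_state M}" using True by (simp add: live_def core_of_def)
    have fX: "finite ?X" using J by simp
    have ch: "core_choices M w ?x = choices M w ?c"
      by (simp add: core_choices_def choices_def core_of_def core_symbol_def scanned_def work_symbol_def)
    have tg: "target a ?x = (core_of (perform a ?c), input_pos (perform a ?c))" for a
      by (simp add: target_def core_perform)
    have "damped M J z w (Suc t) ?x = z * (\<Sum>y\<in>?X. transition M w ?x y * damped M J z w t y)"
      using h by (simp add: accepting_def sum_distrib_left mult.assoc del: fst_conv)
    also have "\<dots> = z * (\<Sum>a\<in>actions M. if target a ?x \<in> ?X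
        then ?p a * ?D a else 0)"
      unfolding sum_transition[OF fX h] ch ..
    finally have d: "damped M J z w (Suc t) ?x = (\<Sum>a\<in>actions M. z * (if target a ?x \<in> ?X
        then ?p a * ?D a else 0))"
      by (simp only: sum_distrib_left)
    have acc: "accept_within M w (Suc t) ?c =
      (\<Sum>a\<in>actions M. ?p a * ?A a)"
      by (rule accept_within_Suc[OF M c True])
    have each: "z ^ Suc t * (?p a * ?A a) \<le>
        z * (if target a ?x \<in> ?X then ?p a * ?D a else 0) \<and>
      z * (if target a ?x \<in> ?X then ?p a * ?D a else 0) \<le>
        ?p a * ?A a" for a
    proof (cases "a \<in> set_pmf (choices M w ?c)")
      case False
      then show ?thesis by (simp add: set_pmf_iff)
    next
      case a: True
      then have "perform a ?c \<in> set_pmf (ptm_step M w ?c)"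
        using True by (simp add: ptm_step_def live_def choices_def scanned_def work_symbol_def)
      then have p: "ptm_path M w (cs @ [perform a ?c])" using Suc.prems by (intro ptm_path_snoc)
      have "target a ?x \<in> ?X"
        using reach[OF p] ptm_path_last_in_configs[OF M p] by (auto simp: tg configs_def)
      moreover have "z ^ t * ?A a \<le> ?D a"
        "?D a \<le> ?A a"
        using Suc.IH[OF p] by (simp_all add: tg)
      moreover have "z * (?p a * ?D a) \<le>
        1 * (?p a * ?A a)"
        using calculation(3) accept_within_range z
        by (intro order_trans[OF mult_left_mono[OF mult_left_mono[OF calculation(3)]] mult_right_mono]) auto
      moreover have "z ^ Suc t * (?p a * ?A a) =
        z * (?p a * (z ^ t * ?A a))" by simp
      moreover have "z * (?p a * (z ^ t * ?A a)) \<le>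
        z * (?p a * ?D a)"
        using calculation(2) z by (intro mult_left_mono) auto
      ultimately show ?thesis by (simp only: if_True mult_1_left simp_thms)
    qed
    show ?thesis
      unfolding d acc sum_distrib_left using each by (auto intro: sum_mono)
  qed
qed

lemma damped_value_bounds:
  assumes M: "ptm_wom M" "w \<in> lists (alphabet M)" and J: "finite J" and z: "0 \<le> z" "z \<le> 1"
    and reach: "\<And>cs. ptm_path M w cs \<Longrightarrow> core_of (last cs) \<in> J"
  shows "z ^ t * accept_within M w t (init_config M) \<le> damped_value M J z w (core_of (init_config M), 0)"
    "damped_value M J z w (core_of (init_config M), 0) \<le> ptm_accept_prob M w"
proof -
  let ?c = "init_config M" and ?x = "(core_of (init_config M), 0 :: nat)"
  have p: "ptm_path M w [?c]" by (simp add: ptm_path_def)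
  have fA: "finite (actions M)" using M by (intro finite_actions) (simp add: ptm_wom_def)
  have x: "?x \<in> J \<times> {..length w + 1}" using reach[OF p] by simp
  have i: "input_pos ?c = 0" by (simp add: init_config_def)
  have b: "z ^ t * accept_within M w t ?c \<le> damped M J z w t ?x"
    "damped M J z w t ?x \<le> accept_within M w t ?c" for t
    using damped_bounds[OF M J z reach p, of t] i by simp_all
  show "z ^ t * accept_within M w t ?c \<le> damped_value M J z w ?x"
    using b(1)[of t] damped_value(2)[OF J fA z x] order_trans by blast
  have "accept_within M w t ?c \<le> ptm_accept_prob M w" for t
    unfolding ptm_accept_prob_eq
    by (rule cSUP_upper) (auto intro: bdd_aboveI[of _ 1] accept_within_range)
  then have "damped M J z w t ?x \<le> ptm_accept_prob M w" for t using b(2) order_trans by blast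
  then show "damped_value M J z w ?x \<le> ptm_accept_prob M w"
    by (intro LIMSEQ_le_const2[OF damped_value(1)[OF J fA z x]]) auto
qed

text \<open>Some fixed \<open>t\<close> already brings acceptance above the threshold, and
  \<open>z ^ t\<close> tends to 1.\<close>

lemma eventually_damped_value_greater:
  assumes M: "ptm_wom M" "w \<in> lists (alphabet M)" and J: "finite J"
    and reach: "\<And>cs. ptm_path M w cs \<Longrightarrow> core_of (last cs) \<in> J"
    and gt: "\<theta> < ptm_accept_prob M w"
  shows "eventually (\<lambda>z. \<theta> < damped_value M J z w (core_of (init_config M), 0)) (at_left 1)"
proof -
  let ?c = "init_config M"
  have "\<exists>t\<in>UNIV. \<theta> < accept_within M w t ?c"
    using gt unfolding ptm_accept_prob_eq
    by (subst (asm) less_cSUP_iff) (auto intro: bdd_aboveI[of _ 1] accept_within_range)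
  then obtain t where t: "\<theta> < accept_within M w t ?c" by blast
  have "((\<lambda>z. z ^ t * accept_within M w t ?c) \<longlongrightarrow> 1 ^ t * accept_within M w t ?c) (at_left 1)"
    by (intro tendsto_intros)
  then have "eventually (\<lambda>z. \<theta> < z ^ t * accept_within M w t ?c) (at_left 1)"
    using t by (intro order_tendstoD) auto
  moreover have "eventually (\<lambda>z::real. z \<in> {0<..<1}) (at_left 1)" by (rule eventually_at_left_real) simp
  ultimately show ?thesis
  proof eventually_elim
    case (elim z)
    then show ?case using damped_value_bounds(1)[OF M J _ _ reach, of z t] by auto
  qed
qed

section \<open>Counting the cores reachable in bounded space\<close>

definition window_cores :: "ptm_wom \<Rightarrow> nat \<Rightarrow> core set" where
  "window_cores M S = states M \<times> {- int S..int S} \<times> PiE_dflt {- int S..int S} 0 (\<lambda>_. work_symbols M)"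

lemma window_cores_finite:
  assumes "machine_ok M"
  shows "finite (window_cores M S)"
    "card (window_cores M S) = card (states M) * ((2 * S + 1) * card (work_symbols M) ^ (2 * S + 1))"
proof -
  have c: "card {- int S..int S} = 2 * S + 1" by simp
  show "finite (window_cores M S)" unfolding window_cores_def
    using assms by (intro finite_cartesian_product finite_PiE_dflt) (auto simp: machine_ok_def)
  show "card (window_cores M S) = card (states M) * ((2 * S + 1) * card (work_symbols M) ^ (2 * S + 1))"
    unfolding window_cores_def card_cartesian_product c
    using assms by (subst card_PiE_dflt) (auto simp: machine_ok_def nat_add_distrib nat_mult_distrib)
qed

lemma ptm_step_work:
  assumes "d \<in> set_pmf (ptm_step M w c)"
  shows "\<bar>work_pos d - work_pos c\<bar> \<le> 1" "work_tape d i \<noteq> 0 \<Longrightarrow> work_tape c i \<noteq> 0 \<or> i = work_pos c"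
proof -
  have "d = c \<or> (\<exists>a. d = perform a c)" using assms by (auto simp: ptm_step_def split: if_splits)
  moreover have "\<bar>Defs.shift m\<bar> \<le> 1" for m by (cases m) auto
  ultimately show "\<bar>work_pos d - work_pos c\<bar> \<le> 1" "work_tape d i \<noteq> 0 \<Longrightarrow> work_tape c i \<noteq> 0 \<or> i = work_pos c"
    by (auto simp: perform_def split: if_splits)
qed

text \<open>The head starts at 0 and moves by at most one square, so it visits every square between
  0 and any visited one.\<close>

lemma path_work_pos_interval:
  assumes "ptm_path M w cs" "k \<in> work_pos ` set cs"
  shows "{min 0 k..max 0 k} \<subseteq> work_pos ` set cs"
  using assms
proof (induction arbitrary: k rule: ptm_path_induct)
  case init
  then show ?case by (simp add: init_config_def)
next
  case (step cs d)
  have ne: "cs \<noteq> []" using step.hyps(1) by (simp add: ptm_path_def)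
  show ?case
  proof (cases "k \<in> work_pos ` set cs")
    case True
    then show ?thesis using step.IH by auto
  next
    case False
    then have k: "k = work_pos d" using step.prems by auto
    let ?k = "work_pos (last cs)"
    have "{min 0 ?k..max 0 ?k} \<subseteq> work_pos ` set cs" using ne by (intro step.IH) auto
    moreover have "{min 0 k..max 0 k} \<subseteq> insert k {min 0 ?k..max 0 ?k}"
      using ptm_step_work(1)[OF step.hyps(2)] unfolding k by auto
    ultimately show ?thesis using k by auto
  qed
qed

lemma path_tape_support:
  assumes "ptm_path M w cs" "work_tape (last cs) i \<noteq> 0"
  shows "i \<in> work_pos ` set cs"
  using assms
proof (induction rule: ptm_path_induct)
  case init
  then show ?case by (simp add: init_config_def)
next
  case (step cs d)
  have "cs \<noteq> []" using step.hyps(1) by (simp add: ptm_path_def)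
  then show ?case using ptm_step_work(2)[OF step.hyps(2), of i] step.IH step.prems by auto
qed

text \<open>At most \<open>S\<close> visited squares that form an interval around 0 stay within
  distance \<open>S\<close> of 0, and all other squares are blank. The direction of the excursion is
  unknown, hence a window of \<open>2 * S + 1\<close> squares.\<close>

lemma path_core_in_window:
  assumes M: "ptm_wom M" "w \<in> lists (alphabet M)" and sp: "uses_space (alphabet M) (ptm_path M) s"
    and S: "max 1 (s (length w)) \<le> real S" and p: "ptm_path M w cs"
  shows "core_of (last cs) \<in> window_cores M S"
proof -
  have le: "\<bar>k\<bar> \<le> int S" if "k \<in> work_pos ` set cs" for k
  proof -
    have "card {min 0 k..max 0 k} \<le> card (work_pos ` set cs)"
      using path_work_pos_interval[OF p that] by (intro card_mono) auto
    then have "nat (\<bar>k\<bar> + 1) \<le> card (work_pos ` set cs)" by (simp add: max_def min_def abs_if split: if_splits)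
    moreover have "real (card (work_pos ` set cs)) \<le> real S"
      using sp M(2) p S unfolding uses_space_def by (meson order_trans)
    ultimately show ?thesis by linarith
  qed
  have c: "last cs \<in> configs M w" by (rule ptm_path_last_in_configs[OF M p])
  have ne: "cs \<noteq> []" using p by (simp add: ptm_path_def)
  have "work_tape (last cs) \<in> PiE_dflt {- int S..int S} 0 (\<lambda>_. work_symbols M)"
    unfolding PiE_dflt_def
  proof (intro CollectI allI conjI impI)
    fix i
    show "work_tape (last cs) i \<in> work_symbols M" using c by (auto simp: configs_def image_subset_iff)
    show "work_tape (last cs) i = 0" if "i \<notin> {- int S..int S}"
    proof (rule ccontr)
      assume "work_tape (last cs) i \<noteq> 0"
      from le[OF path_tape_support[OF p this]] show False using that by auto
    qed
  qed
  moreover have "work_pos (last cs) \<in> {- int S..int S}"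
    using le[of "work_pos (last cs)"] ne by (auto simp: abs_le_iff)
  moreover have "state (last cs) \<in> states M" using c by (simp add: configs_def)
  ultimately show ?thesis by (simp add: window_cores_def core_of_def)
qed

text \<open>Only the finitely many words in \<open>W\<close> matter. Their acceptance probabilities
  are separated by a threshold attained by nonmembers, which treats both kinds of cutpoint alike,
  and a single discount close to 1 keeps all members above it. Nonmembers stay at or below it since
  discounting only lowers values.\<close>

lemma ptm_card_shattered_le:
  assumes M: "ptm_wom M" and sp: "uses_space (alphabet M) (ptm_path M) s"
    and L: "recognizes_unbounded (alphabet M) (ptm_accept_prob M) L"
    and fin: "finite U" "finite V"
    and UV: "\<And>u v. u \<in> U \<Longrightarrow> v \<in> V \<Longrightarrow> u @ v \<in> lists (alphabet M) \<and> max 1 (s (length (u @ v))) \<le> real S"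
    and shatter: "\<And>T. T \<subseteq> U \<Longrightarrow> \<exists>v\<in>V. \<forall>u\<in>U. u @ v \<in> L \<longleftrightarrow> u \<in> T"
    and K: "K = card (window_cores M S)"
  shows "card U \<le> (K + 1) * (fact K * (K + 1) ^ K)\<^sup>2"
proof (cases "U = {}")
  case False
  let ?f = "ptm_accept_prob M" and ?J = "window_cores M S" and ?i = "core_of (init_config M)"
  let ?g = "\<lambda>z w. damped_value M ?J z w (?i, 0)"
  define W where "W = (\<lambda>(u, v). u @ v) ` (U \<times> V)"
  have fW: "finite W" using fin by (simp add: W_def)
  have W: "w \<in> lists (alphabet M)" "max 1 (s (length w)) \<le> real S" if w: "w \<in> W" for w
  proof -
    obtain u v where "u \<in> U" "v \<in> V" "w = u @ v" using w by (auto simp: W_def)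
    then show "w \<in> lists (alphabet M)" "max 1 (s (length w)) \<le> real S" using UV by blast+
  qed
  obtain \<theta>0 where \<theta>0: "L = {w \<in> lists (alphabet M). ?f w > \<theta>0} \<or> L = {w \<in> lists (alphabet M). ?f w \<ge> \<theta>0}"
    using L by (auto simp: recognizes_unbounded_def)
  \<comment> \<open>\<open>\<theta>0 - 1\<close> keeps the set nonempty and lies below the
    acceptance probability of every member.\<close>
  define \<theta> where "\<theta> = Max (insert (\<theta>0 - 1) (?f ` (W - L)))"
  have \<theta>: "?f w \<le> \<theta>" if "w \<in> W - L" for w unfolding \<theta>_def using that fW by (intro Max_ge) auto
  have \<theta>': "\<theta> < ?f w" if "w \<in> W \<inter> L" for w
  proof -
    have "y < ?f w" if y: "y \<in> insert (\<theta>0 - 1) (?f ` (W - L))" for y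
    proof (cases "y = \<theta>0 - 1")
      case True
      then show ?thesis using \<theta>0 \<open>w \<in> W \<inter> L\<close> by auto
    next
      case False
      then obtain w' where w': "w' \<in> W" "w' \<notin> L" "y = ?f w'" using y by blast
      have "w' \<in> lists (alphabet M)" by (rule W(1)[OF w'(1)])
      with \<theta>0 show ?thesis
      proof (elim disjE)
        assume L: "L = {w \<in> lists (alphabet M). ?f w > \<theta>0}"
        have "?f w' \<le> \<theta>0" using L w'(2) \<open>w' \<in> lists (alphabet M)\<close> by simp
        moreover have "\<theta>0 < ?f w" using L \<open>w \<in> W \<inter> L\<close> by simp
        ultimately show ?thesis using w'(3) by simp
      next
        assume L: "L = {w \<in> lists (alphabet M). ?f w \<ge> \<theta>0}"
        have "?f w' < \<theta>0" using L w'(2) \<open>w' \<in> lists (alphabet M)\<close> by simp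
        moreover have "\<theta>0 \<le> ?f w" using L \<open>w \<in> W \<inter> L\<close> by simp
        ultimately show ?thesis using w'(3) by simp
      qed
    qed
    then show ?thesis unfolding \<theta>_def using fW by (subst Max_less_iff) auto
  qed
  have J: "finite ?J" using M by (intro window_cores_finite) (simp add: ptm_wom_def)
  have fA: "finite (actions M)" using M by (intro finite_actions) (simp add: ptm_wom_def)
  have reach: "core_of (last cs) \<in> ?J" if "w \<in> W" "ptm_path M w cs" for w cs
    using path_core_in_window[OF M W(1) sp W(2)] that by blast
  have "eventually (\<lambda>z. \<forall>w\<in>W \<inter> L. \<theta> < ?g z w) (at_left 1)"
    using fW \<theta>' by (intro eventually_ball_finite ballI eventually_damped_value_greater[OF M W(1) J reach]) auto
  moreover have "eventually (\<lambda>z::real. z \<in> {0<..<1}) (at_left 1)" by (rule eventually_at_left_real) simp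
  ultimately have "eventually (\<lambda>z. z \<in> {0<..<1} \<and> (\<forall>w\<in>W \<inter> L. \<theta> < ?g z w)) (at_left 1)"
    by eventually_elim auto
  then obtain z where z: "0 < z" "z < 1" "\<forall>w\<in>W \<inter> L. \<theta> < ?g z w"
    using eventually_happens by force
  have i: "?i \<in> ?J"
  proof -
    obtain v where "v \<in> V" using shatter[of "{}"] by auto
    moreover obtain u where "u \<in> U" using False by auto
    ultimately have "u @ v \<in> W" by (auto simp: W_def)
    then show ?thesis using reach[of "u @ v" "[init_config M]"] by (simp add: ptm_path_def)
  qed
  obtain d :: "nat list \<Rightarrow> nat list \<Rightarrow> real" where d: "\<forall>u v. d u v \<noteq> 0"
    "rank_le ((K + 1) * (fact K * (K + 1) ^ K)\<^sup>2)
      (\<lambda>u v. (?g z (u @ v) - \<theta>) * (d u v)\<^sup>2)"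
    using rank_le_damped_value[OF J i fA less_imp_le[OF z(1)] z(2), of \<theta>] unfolding K by blast
  show ?thesis
  proof (rule card_shattered_le_rank[OF d(2) fin(1)])
    fix T assume "T \<subseteq> U"
    then obtain v where v: "v \<in> V" "\<forall>u\<in>U. u @ v \<in> L \<longleftrightarrow> u \<in> T" using shatter by blast
    show "\<exists>v. \<forall>u\<in>U. if u \<in> T then (?g z (u @ v) - \<theta>) * (d u v)\<^sup>2 > 0
      else (?g z (u @ v) - \<theta>) * (d u v)\<^sup>2 \<le> 0"
    proof (intro exI[of _ v] ballI)
      fix u assume u: "u \<in> U"
      then have w: "u @ v \<in> W" using v(1) by (auto simp: W_def)
      have dd: "(d u v)\<^sup>2 > 0" using d(1) by simp
      have up: "?g z (u @ v) \<le> ?f (u @ v)"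
        using damped_value_bounds(2)[OF M W(1)[OF w] J _ _ reach[OF w]] z by auto
      show "if u \<in> T then (?g z (u @ v) - \<theta>) * (d u v)\<^sup>2 > 0
        else (?g z (u @ v) - \<theta>) * (d u v)\<^sup>2 \<le> 0"
      proof (cases "u \<in> T")
        case True
        then have "\<theta> < ?g z (u @ v)" using z(3) v(2) u w by auto
        then show ?thesis using True dd by simp
      next
        case False
        then have "?g z (u @ v) \<le> \<theta>" using \<theta>[of "u @ v"] up v(2) u w by auto
        then show ?thesis using False dd by (simp add: mult_nonpos_nonneg)
      qed
    qed
  qed
qed simp

section \<open>Shattered prefixes and the final estimate\<close>

definition blocks :: "nat set \<Rightarrow> nat \<Rightarrow> nat \<Rightarrow> nat list" where
  "blocks T i n = concat (map (\<lambda>k. if k \<in> T then [1, 2] else [1]) [i..<i + n])"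

lemma blocks_Suc: "blocks T i (Suc n) = (if i \<in> T then [1, 2] else [1]) @ blocks T (Suc i) n"
proof -
  have "[i..<i + Suc n] = i # [Suc i..<Suc i + n]" by (simp add: upt_conv_Cons del: upt_Suc)
  then show ?thesis by (simp add: blocks_def del: upt_Suc)
qed

text \<open>The block of \<open>k\<close> ends after \<open>k - i + 1\<close> ones and contains a
  checkpoint precisely if \<open>k\<close> is in \<open>T\<close>. For \<open>i = 1\<close>, a
  surplus of \<open>j\<close> zeros is thus met at a checkpoint exactly for \<open>j\<close> in
  \<open>T\<close> within the range.\<close>

lemma balanced_check_blocks:
  "balanced_check (blocks T i n) d \<longleftrightarrow> (\<exists>k\<in>T. i \<le> k \<and> k < i + n \<and> d = int k - int i + 1)"
proof (induction n arbitrary: i d)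
  case 0
  show ?case by (simp add: blocks_def)
next
  case (Suc n)
  have "balanced_check (blocks T i (Suc n)) d \<longleftrightarrow>
    i \<in> T \<and> d = 1 \<or> (\<exists>k\<in>T. Suc i \<le> k \<and> k < Suc i + n \<and> d - 1 = int k - int (Suc i) + 1)"
    by (auto simp: blocks_Suc Suc.IH)
  also have "\<dots> \<longleftrightarrow> (\<exists>k\<in>T. i \<le> k \<and> k < i + Suc n \<and> d = int k - int i + 1)" (is "?l \<longleftrightarrow> ?r")
  proof
    assume ?l
    then show ?r
    proof (elim disjE bexE)
      fix k assume "k \<in> T" "Suc i \<le> k \<and> k < Suc i + n \<and> d - 1 = int k - int (Suc i) + 1"
      then show ?r by (intro bexI[of _ k]) auto
    qed (auto intro: bexI[of _ i])
  next
    assume ?r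
    then obtain k where "k \<in> T" "i \<le> k" "k < i + Suc n" "d = int k - int i + 1" by blast
    then show ?l by (cases "k = i") (auto intro: bexI[of _ k])
  qed
  finally show ?case .
qed

lemma balanced_check_replicate: "balanced_check (replicate j 0 @ v) d \<longleftrightarrow> balanced_check v (d + int j)"
  by (induction j arbitrary: d) (auto simp: algebra_simps)

lemma blocks_word: "set (blocks T i n) \<subseteq> {0, 1, 2}" "length (blocks T i n) \<le> 2 * n"
proof -
  show "set (blocks T i n) \<subseteq> {0, 1, 2}" by (auto simp: blocks_def split: if_splits)
  show "length (blocks T i n) \<le> 2 * n"
  proof (induction n arbitrary: i)
    case (Suc n)
    show ?case using Suc.IH[of "Suc i"] by (simp add: blocks_Suc)
  qed (simp add: blocks_def)
qed

text \<open>The true order is \<open>exp (O (X * ln X))\<close>; the crude estimate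
  \<open>X \<le> exp X\<close> gives a square instead, which is harmless for the sizes in
  question.\<close>

lemma fact_power_bound:
  assumes "K + 1 \<le> X"
  shows "real ((K + 1) * (fact K * (K + 1) ^ K)\<^sup>2) \<le> exp (4 * real X ^ 2)"
proof -
  let ?Y = "K + 1"
  have "(fact K :: nat) \<le> ?Y ^ K"
    using fact_le_power[of K, where 'a = nat] power_mono[of K ?Y K] by simp
  then have "?Y * (fact K * ?Y ^ K)\<^sup>2 \<le> ?Y * (?Y ^ K * ?Y ^ K)\<^sup>2"
    by (intro mult_le_mono power_mono) auto
  also have "\<dots> = ?Y ^ (4 * K + 1)" by (simp add: power_add power2_eq_square numeral_eq_Suc mult.assoc)
  also have "\<dots> \<le> ?Y ^ (4 * ?Y)" by (intro power_increasing) auto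
  also have "\<dots> \<le> X ^ (4 * ?Y)" using assms by (intro power_mono) auto
  also have "\<dots> \<le> X ^ (4 * X)" using assms by (intro power_increasing) auto
  finally have "real (?Y * (fact K * ?Y ^ K)\<^sup>2) \<le> real X ^ (4 * X)"
    using of_nat_mono by fastforce
  also have "\<dots> \<le> exp (real X) ^ (4 * X)"
  proof (rule power_mono)
    show "real X \<le> exp (real X)" using exp_ge_add_one_self[of "real X"] by linarith
  qed simp
  also have "\<dots> = exp (4 * real X ^ 2)" by (simp add: exp_of_nat_mult[symmetric] power2_eq_square)
  finally show ?thesis .
qed

text \<open>Absorbs the numbers of states and work symbols into one base, so that only the exponent
  \<open>S\<close> varies with the input length.\<close>

lemma window_count_bound:
  assumes "S \<ge> 1"
  shows "q * ((2 * S + 1) * g ^ (2 * S + 1)) + 1 \<le> (4 * (q + 1) * (g + 1) ^ 3 :: nat) ^ S"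
proof -
  have a: "2 * S + 1 \<le> 4 ^ S" using assms by (induction S rule: nat_induct_at_least) auto
  have b: "q + 1 \<le> (q + 1) ^ S" using assms by (intro self_le_power) auto
  have "g ^ (2 * S + 1) \<le> (g + 1) ^ (2 * S + 1)" by (intro power_mono) auto
  also have "\<dots> \<le> (g + 1) ^ (3 * S)" using assms by (intro power_increasing) auto
  finally have c: "g ^ (2 * S + 1) \<le> ((g + 1) ^ 3) ^ S" by (simp add: power_mult)
  have "q * ((2 * S + 1) * g ^ (2 * S + 1)) + 1 \<le> q * (4 ^ S * ((g + 1) ^ 3) ^ S) + 4 ^ S * ((g + 1) ^ 3) ^ S"
    using a c by (intro add_mono mult_le_mono) auto
  also have "\<dots> = (q + 1) * (4 ^ S * ((g + 1) ^ 3) ^ S)" by simp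
  also have "\<dots> \<le> (q + 1) ^ S * (4 ^ S * ((g + 1) ^ 3) ^ S)" using b by (intro mult_le_mono) auto
  also have "\<dots> = (4 * (q + 1) * (g + 1) ^ 3) ^ S" by (simp only: power_mult_distrib) simp
  finally show ?thesis .
qed

lemma small_space:
  fixes s :: "nat \<Rightarrow> real" and B :: nat
  assumes s: "s \<in> o(\<lambda>n. ln (ln (real n)))" and B: "B \<ge> 2"
  shows "\<exists>m S. S \<ge> 1 \<and> (\<forall>l\<le>3 * m. max 1 (s l) \<le> real S) \<and> exp (4 * (real B ^ S) ^ 2) < real m"
proof -
  define \<beta> where "\<beta> = 2 * ln (real B)"
  have \<beta>: "\<beta> > 0" using B by (simp add: \<beta>_def)
  \<comment> \<open>\<open>(B ^ S) ^ 2\<close> is \<open>exp (\<beta> * S)\<close>, where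
    \<open>S\<close> is \<open>\<epsilon> * ln (ln (3 * m))\<close> up to a constant; this
    \<open>\<epsilon>\<close> bounds it by a multiple of the square root of
    \<open>ln (3 * m)\<close>.\<close>
  define \<epsilon> where "\<epsilon> = 1 / (2 * \<beta>)"
  have \<epsilon>: "\<epsilon> > 0" using \<beta> by (simp add: \<epsilon>_def)
  obtain N0 where N0: "\<And>n. n \<ge> N0 \<Longrightarrow> norm (s n) \<le> \<epsilon> * norm (ln (ln (real n)))"
    using landau_o.smallD[OF s \<epsilon>] unfolding eventually_at_top_linorder by blast
  define N where "N = max N0 3"
  \<comment> \<open>\<open>C\<close> covers the short inputs, for which the asymptotic bound says
    nothing, and the minimal space 1.\<close>
  define C where "C = 1 + (\<Sum>l<N. \<bar>s l\<bar>)"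
  have C1: "C \<ge> 1" by (simp add: C_def sum_nonneg)
  have ln3: "1 < ln (real n)" if "n \<ge> 3" for n
  proof -
    have "exp 1 < (3::real)" using exp_le e_less_272 by linarith
    then have "1 < ln (3::real)" by (metis exp_gt_zero ln_exp ln_less_cancel_iff zero_less_numeral)
    also have "\<dots> \<le> ln (real n)" using that by simp
    finally show ?thesis .
  qed
  define c where "c = exp (\<beta> * (C + 1))"
  have "c > 0" by (simp add: c_def)
  \<comment> \<open>The exponent is of the order of the square root of \<open>ln m\<close>, so the
    left side grows more slowly than any positive power of \<open>m\<close>.\<close>
  then have "eventually (\<lambda>m::nat. exp (4 * (c * sqrt (ln (3 * real m)))) < real m) at_top"
    by real_asymp
  then obtain m where m: "exp (4 * (c * sqrt (ln (3 * real m)))) < real m" "m \<ge> 1"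
    unfolding eventually_at_top_linorder by (metis nle_le)
  define y where "y = ln (ln (real (3 * m)))"
  have l3m: "1 < ln (real (3 * m))" using m(2) by (intro ln3) simp
  then have y0: "y \<ge> 0" by (simp add: y_def)
  define S where "S = nat \<lceil>C + \<epsilon> * y\<rceil>"
  have Cy: "C + \<epsilon> * y \<ge> 1" using C1 y0 \<epsilon> by (simp add: add_increasing2)
  have S: "C + \<epsilon> * y \<le> real S" "real S \<le> C + \<epsilon> * y + 1" using Cy unfolding S_def by linarith+
  have S1: "S \<ge> 1" using S(1) Cy by linarith
  have sl: "max 1 (s l) \<le> real S" if "l \<le> 3 * m" for l
  proof (cases "l < N")
    case True
    then have "\<bar>s l\<bar> \<le> (\<Sum>l<N. \<bar>s l\<bar>)" by (intro member_le_sum) auto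
    then have "s l \<le> C" by (simp add: C_def)
    moreover have "0 \<le> \<epsilon> * y" using y0 \<epsilon> by simp
    ultimately show ?thesis using S(1) S1 by linarith
  next
    case False
    then have l: "l \<ge> N0" "l \<ge> 3" by (auto simp: N_def)
    have "ln (real l) \<le> ln (real (3 * m))" using l that by simp
    then have "ln (ln (real l)) \<le> y" using ln3[OF l(2)] l3m unfolding y_def by (subst ln_le_cancel_iff) auto
    moreover have "0 \<le> ln (ln (real l))" using ln3[OF l(2)] by simp
    moreover have "\<epsilon> * ln (ln (real l)) \<le> \<epsilon> * y"
      using calculation(1) \<epsilon> by (intro mult_left_mono) auto
    ultimately have "s l \<le> \<epsilon> * y" using N0[OF l(1)] by simp
    then show ?thesis using S(1) S1 C1 by linarith
  qed
  have "(real B ^ S) ^ 2 = exp (\<beta> * real S)"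
  proof -
    have "real B ^ S = exp (real S * ln (real B))" using B by (simp add: exp_of_nat_mult)
    then show ?thesis by (simp add: \<beta>_def exp_double[symmetric] algebra_simps)
  qed
  also have "\<dots> \<le> exp (\<beta> * (C + 1) + y / 2)"
  proof -
    have "\<beta> * real S \<le> \<beta> * (C + \<epsilon> * y + 1)" using S(2) \<beta> by (intro mult_left_mono) auto
    also have "\<dots> = \<beta> * (C + 1) + y / 2" using \<beta> by (simp add: \<epsilon>_def field_simps)
    finally show ?thesis by simp
  qed
  also have "\<dots> = c * sqrt (ln (3 * real m))"
  proof -
    have "exp (y / 2) = sqrt (exp y)"
      by (metis exp_ge_zero exp_half_le2 field_sum_of_halves mult_exp_exp power2_eq_square real_sqrt_abs2 abs_exp_cancel)
    then show ?thesis using l3m by (simp add: exp_add c_def y_def)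
  qed
  finally have "exp (4 * (real B ^ S) ^ 2) \<le> exp (4 * (c * sqrt (ln (3 * real m))))" by simp
  then have "exp (4 * (real B ^ S) ^ 2) < real m" using m(1) by linarith
  with S1 sl show ?thesis by blast
qed

lemma balanced_language_not_ptm_recognizable:
  assumes s: "s \<in> o(\<lambda>n. ln (ln (real n)))"
  shows "\<not> ptm_wom_recognizable s {0, 1, 2} balanced_language"
proof
  assume "ptm_wom_recognizable s {0, 1, 2} balanced_language"
  then obtain M where M: "ptm_wom M" "alphabet M = {0, 1, 2}" "uses_space {0, 1, 2} (ptm_path M) s"
    "recognizes_unbounded {0, 1, 2} (ptm_accept_prob M) balanced_language"
    unfolding ptm_wom_recognizable_def by blast
  define B where "B = 4 * (card (states M) + 1) * (card (work_symbols M) + 1) ^ 3"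
  have "B \<ge> 4 * 1 * 1 ^ 3" unfolding B_def by (intro mult_le_mono power_mono) auto
  then obtain m S where mS: "S \<ge> 1" "\<forall>l\<le>3 * m. max 1 (s l) \<le> real S" "exp (4 * (real B ^ S) ^ 2) < real m"
    using small_space[OF s, of B] by auto
  define K where "K = card (window_cores M S)"
  \<comment> \<open>A prefix has at most \<open>m\<close> letters and a suffix at most
    \<open>2 * m\<close>, which explains the length \<open>3 * m\<close> in
    \<open>small_space\<close>.\<close>
  let ?U = "(\<lambda>j. replicate j (0::nat)) ` {1..m}" and ?V = "(\<lambda>T. blocks T 1 m) ` Pow {1..m}"
  have inj: "inj_on (\<lambda>j. replicate j (0::nat)) {1..m}" by (auto simp: inj_on_def dest: arg_cong[where f = length])
  have "card ?U \<le> (K + 1) * (fact K * (K + 1) ^ K)\<^sup>2"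
  proof (rule ptm_card_shattered_le[OF M(1) _ _ _ _ _ _ K_def])
    show "uses_space (alphabet M) (ptm_path M) s"
      "recognizes_unbounded (alphabet M) (ptm_accept_prob M) balanced_language"
      using M by simp_all
    show "finite ?U" "finite ?V" by auto
    show "u @ v \<in> lists (alphabet M) \<and> max 1 (s (length (u @ v))) \<le> real S"
      if u: "u \<in> ?U" and v: "v \<in> ?V" for u v
    proof
      show "u @ v \<in> lists (alphabet M)"
        using u v blocks_word(1) unfolding M(2) lists_eq_set by fastforce
      have "length u \<le> m" "length v \<le> 2 * m" using u v blocks_word(2) by auto
      then have "length (u @ v) \<le> 3 * m" by simp
      then show "max 1 (s (length (u @ v))) \<le> real S" using mS(2) by blast
    qed
    fix T assume "T \<subseteq> ?U"
    let ?T = "{j \<in> {1..m}. replicate j 0 \<in> T}"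
    show "\<exists>v\<in>?V. \<forall>u\<in>?U. u @ v \<in> balanced_language \<longleftrightarrow> u \<in> T"
    proof (rule bexI[of _ "blocks ?T 1 m"], intro ballI)
      fix u assume "u \<in> ?U"
      then obtain j where j: "j \<in> {1..m}" "u = replicate j 0" by blast
      have "u @ blocks ?T 1 m \<in> lists {0, 1, 2}"
        using j(2) blocks_word(1)[of ?T 1 m] unfolding lists_eq_set by auto
      then have "u @ blocks ?T 1 m \<in> balanced_language \<longleftrightarrow> (\<exists>k\<in>?T. 1 \<le> k \<and> k < 1 + m \<and> int j = int k)"
        unfolding balanced_language_def j(2)
        by (simp add: balanced_check_replicate balanced_check_blocks)
      also have "\<dots> \<longleftrightarrow> u \<in> T" using j by auto
      finally show "u @ blocks ?T 1 m \<in> balanced_language \<longleftrightarrow> u \<in> T" .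
    qed auto
  qed
  then have "real m \<le> real ((K + 1) * (fact K * (K + 1) ^ K)\<^sup>2)"
    using card_image[OF inj] by (simp only: of_nat_le_iff) simp
  also have "\<dots> \<le> exp (4 * real (B ^ S) ^ 2)"
  proof (rule fact_power_bound)
    have ok: "machine_ok M" using M(1) by (simp add: ptm_wom_def)
    show "K + 1 \<le> B ^ S"
      unfolding K_def B_def window_cores_finite(2)[OF ok] by (rule window_count_bound[OF mS(1)])
  qed
  also have "\<dots> < real m" using mS(3) by simp
  finally show False by simp
qed

theorem corollary5:
  fixes s :: "nat \<Rightarrow> real"
  assumes "s \<in> o(\<lambda>n. ln (ln (real n)))"
  shows "(\<forall>A L. ptm_wom_recognizable s A L \<longrightarrow> qtm_wom_recognizable s A L) \<and>
         (\<exists>A L. qtm_wom_recognizable s A L \<and> \<not> ptm_wom_recognizable s A L)"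
  using ptm_wom_recognizable_imp_qtm qtm_recognizes_balanced_language
    balanced_language_not_ptm_recognizable[OF assms] by blast

end
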